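(* Let $G$ be a (not necessarily connected) finite simple graph and let $k\geq 3$ be an integer. Then the Hom complex $\operatorname{Hom}(G,C_k)$ is homotopy equivalent to a disjoint union of products of circles, i.e. of spaces of the form $(S^1)^d$ with $d\ge 0$, where $(S^1)^0$ is a point.
   Context: Graphs are finite, undirected and simple (no loops, no multiple edges). A graph homomorphism $G\to H$ is a function $V(G)\to V(H)$ preserving adjacency. For $k\ge 3$, $C_k$ is the cycle graph with $k$ vertices. For graphs $G,H$, the Hom complex $\operatorname{Hom}(G,H)$ is the following polyhedral complex (regarded as a topological space): its cells are indexed by the functions $\eta$ assigning to each $v\in V(G)$ a nonempty subset $\eta(v)\subseteq V(H)$ such that whenever $uv\in E(G)$, every element of $\eta(u)$ is adjacent in $H$ to every element of $\eta(v)$; the cell of $\eta$ is the product of simplices $\prod_{v\in V(G)}\Delta^{\eta(v)}$, viewed inside $\prod_{v\in V(G)}\Delta^{V(H)}$, where $\Delta^{S}$ denotes the simplex with vertex set $S$. Its vertices are the homomorphisms $G\to H$, and two homomorphisms are joined by an edge if and only if they differ at exactly one vertex of $G$. A disjoint union may be empty. *)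

theory Defs
  imports "HOL-Analysis.Analysis" "Graph_Theory.Pair_Digraph"
begin

text \<open>
  Finite simple graphs are rendered by the locale \<open>pair_graph\<close>: a finite vertex set
  \<open>pverts G\<close> (possibly empty) and a finite, symmetric, loopless relation \<open>parcs G\<close>,
  in which an undirected edge \<open>uv\<close> appears as both \<open>(u, v)\<close> and \<open>(v, u)\<close>.
\<close>

definition cycle_graph :: "nat \<Rightarrow> nat pair_pre_digraph" where
  "cycle_graph k =
     \<lparr> pverts = {..<k},
       parcs = {(i, j). i < k \<and> j < k \<and> (j = Suc i mod k \<or> i = Suc j mod k)} \<rparr>"

lemma pair_graph_cycle_graph:
  assumes "k \<ge> 3"
  shows "pair_graph (cycle_graph k)"
proof
  show "finite (parcs (cycle_graph k))"
    by (rule finite_subset [of _ "{..<k} \<times> {..<k}"]) (auto simp: cycle_graph_def)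
  show "fst e \<noteq> snd e" if "e \<in> parcs (cycle_graph k)" for e
    using that assms by (auto simp: cycle_graph_def mod_Suc split: if_splits)
qed (auto simp: cycle_graph_def symmetric_def sym_def)

definition hom_cells ::
    "'a pair_pre_digraph \<Rightarrow> 'b pair_pre_digraph \<Rightarrow> ('a \<Rightarrow> 'b set) set" where
  "hom_cells G H =
     {\<eta> \<in> pverts G \<rightarrow>\<^sub>E {S. S \<noteq> {} \<and> S \<subseteq> pverts H}.
        \<forall>(u, v) \<in> parcs G. \<forall>x \<in> \<eta> u. \<forall>y \<in> \<eta> v. (x, y) \<in> parcs H}"

text \<open>
  The simplex with vertex set \<open>S\<close>, as a face of the simplex with finite vertex set
  \<open>W \<supseteq> S\<close>; points are given by barycentric coordinates indexed by \<open>W\<close>.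
\<close>

definition simplex_face :: "'b set \<Rightarrow> 'b set \<Rightarrow> ('b \<Rightarrow> real) set" where
  "simplex_face W S =
     {t \<in> W \<rightarrow>\<^sub>E {0..}. (\<Sum>w\<in>W. t w) = 1 \<and> (\<forall>w \<in> W - S. t w = 0)}"

text \<open>
  Since \<open>G\<close> and \<open>H\<close> are finite, the topology of the polyhedral complex is the one
  induced from the ambient finite-dimensional space of real families indexed by
  \<open>pverts G\<close> and \<open>pverts H\<close>.
\<close>

definition Hom_complex ::
    "'a pair_pre_digraph \<Rightarrow> 'b pair_pre_digraph \<Rightarrow> ('a \<Rightarrow> 'b \<Rightarrow> real) topology" where
  "Hom_complex G H =
     subtopology
       (product_topology (\<lambda>v. product_topology (\<lambda>w. euclideanreal) (pverts H)) (pverts G))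
       (\<Union>\<eta> \<in> hom_cells G H. \<Pi>\<^sub>E v \<in> pverts G. simplex_face (pverts H) (\<eta> v))"

text \<open>For \<open>d = 0\<close> this is the one-point space.\<close>

definition circle_power :: "nat \<Rightarrow> (nat \<Rightarrow> complex) topology" where
  "circle_power d = product_topology (\<lambda>i. top_of_set (sphere (0::complex) 1)) {..<d}"

end

theory Submission
  imports Defs
begin

text \<open>
  An isolated vertex of $G$ contributes a simplex, which can be contracted, and for $k = 4$ the
  complex is a disjoint union of convex sets. Otherwise fix a homomorphism $f$ and orient every
  edge of $G$ so that $f$ increases by one along it. Moving the value at $v$ from $f(v)$ to
  $f(v) + 2b(v)$, with interpolation for real $b(v)$, describes the component of $f$ as the image
  of the path component of $0$ in the space of those real functions $b$ on the vertices that satisfy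
  $\lceil b(u) \rceil \le \lfloor b(v) \rfloor$ and $\lceil b(v) \rceil \le \lfloor b(u) \rfloor + 1$
  for every arc $vu$. Two such functions have the same image iff they differ by a translation that is,
  on each connected component of $G$, a multiple of a fixed period $N$.

  These inequalities are preserved by pointwise maxima and minima. Call a connected component of
  $G$ free if the function equal to $N$ on it and $0$ elsewhere lies in the path component of $0$. If it is
  free, a path from $0$ to that function extends to a periodic path $p$ indexed by the real line; otherwise the
  functions are bounded on it, and there is a path $p$ from a lower to an upper bound. In both cases the
  homotopy $\max(b, p(t))$ pushes every function onto the path, and dividing by the translations gives
  one circle for each free component.
\<close>

section \<open>Paths and quotients of compact spaces\<close>

text \<open>Heights move in steps of two because every remaining vertex has a neighbour: all values
  of a cell at it are adjacent to one value c of that neighbour, hence among c - 1 and c + 1. The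
  period \<open>N\<close> is the additive order of 2 modulo \<open>k\<close>. It is at least 3
  unless \<open>k = 4\<close>, where c + 1 is reached from c - 1 by a step in either direction, so
  that a cell no longer tells up from down and lifts are not unique.

  Straight-line homotopies leave the space of height functions; closure under maxima takes the place
  of convexity. The obstacle is that \<open>max(b, p(t))\<close> must commute with the translations.
  On a free component the time is therefore measured from the height of \<open>b\<close> itself and
  runs from far below it to far above it; on the other components no nonzero translation occurs, and
  the time simply runs through the unit interval. The space of height functions need not be compact,
  so maps out of the quotient are built on a compact set of height functions that meets every
  translation class.\<close>

lemma compact_quotient_factor:
  assumes "compact_space A" "Hausdorff_space Y" "continuous_map A Y q" "q ` topspace A = topspace Y"
    and "continuous_map A W h"
    and "\<And>a a'. \<lbrakk>a \<in> topspace A; a' \<in> topspace A; q a = q a'\<rbrakk> \<Longrightarrow> h a = h a'"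
  obtains g where "continuous_map Y W g" "\<And>a. a \<in> topspace A \<Longrightarrow> g (q a) = h a"
proof -
  \<comment> \<open>A continuous surjection from a compact space onto a Hausdorff space is
    closed.\<close>
  have "quotient_map A Y q"
    using assms by (intro continuous_imp_quotient_map) auto
  then show thesis
    using quotient_map_lift_exists[of A Y q W h] assms that by metis
qed

text \<open>Two adjacent closed intervals cover an open neighbourhood of the integer between them,
  and these neighbourhoods cover the line.\<close>

lemma continuous_on_unit_intervals:
  fixes f :: "real \<Rightarrow> 'b::topological_space"
  assumes "\<And>n::int. continuous_on {of_int n..of_int n + 1} f"
  shows "continuous_on S f"
proof -
  have "continuous_on {of_int n - 1<..<of_int n + 1} f" for n :: int
  proof -
    have "continuous_on ({of_int n - 1..of_int n} \<union> {of_int n..of_int n + 1}) f"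
      using assms[of "n - 1"] assms[of n] by (intro continuous_on_closed_Un) auto
    then show ?thesis
      by (rule continuous_on_subset) auto
  qed
  then have "continuous_on (\<Union>n::int. {of_int n - 1<..<of_int n + 1}) f"
    by (intro continuous_on_open_UN) auto
  moreover have "x \<in> (\<Union>n::int. {of_int n - 1<..<of_int n + 1})" for x :: real
    by (rule UN_I[of "\<lfloor>x\<rfloor>"]) (auto, linarith+)
  ultimately show ?thesis
    by (meson continuous_on_subset subsetI)
qed

lemma path_componentI:
  fixes g :: "real \<Rightarrow> 'b::topological_space"
  assumes "continuous_on {0..1} g" "\<And>t. t \<in> {0..1} \<Longrightarrow> g t \<in> S"
  shows "path_component S (g 0) (g 1)"
  unfolding path_component_def
  by (rule exI[of _ g]) (use assms in \<open>auto simp: path_def path_image_def pathstart_def pathfinish_def\<close>)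

lemma path_componentE:
  fixes x :: "'b::topological_space"
  assumes "path_component S x y"
  obtains g :: "real \<Rightarrow> 'b" where "continuous_on {0..1} g" "\<And>t. t \<in> {0..1} \<Longrightarrow> g t \<in> S" "g 0 = x" "g 1 = y"
  using assms unfolding path_component_def path_def path_image_def pathstart_def pathfinish_def
  by blast

lemma path_component_along_line:
  fixes p :: "real \<Rightarrow> 'b::topological_space"
  assumes "continuous_on UNIV p" "\<And>t. p t \<in> S"
  shows "path_component S (p 0) (p t)"
proof -
  have "continuous_on {0..1} (\<lambda>s. p (s * t))"
    by (rule continuous_on_compose2[OF assms(1)]) (auto intro!: continuous_intros)
  then have "path_component S (p (0 * t)) (p (1 * t))"
    by (rule path_componentI) (rule assms(2))
  then show ?thesis by simp
qed

lemma path_component_map: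
  fixes h :: "'c::topological_space \<Rightarrow> 'b::topological_space"
  assumes "path_component S x y" "continuous_on S h" "h ` S \<subseteq> T"
  shows "path_component T (h x) (h y)"
proof -
  obtain g :: "real \<Rightarrow> 'c" where g: "continuous_on {0..1} g" "\<And>t. t \<in> {0..1} \<Longrightarrow> g t \<in> S" "g 0 = x" "g 1 = y"
    using path_componentE[OF assms(1)] by blast
  have "continuous_on {0..1} (h \<circ> g)"
    using g by (intro continuous_on_compose continuous_on_subset[OF assms(2)]) auto
  then show ?thesis
    using path_componentI[of "h \<circ> g" T] g assms(3) by auto
qed

lemma continuous_on_coord [continuous_intros]:
  fixes S :: "('a \<Rightarrow> real) set"
  shows "continuous_on S (\<lambda>x. x i)"
  using continuous_on_product_coordinates by (rule continuous_on_subset) simp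

section \<open>Height functions\<close>

text \<open>For an arc from \<open>v\<close> to \<open>u\<close>, heights n at \<open>v\<close> and
  m at \<open>u\<close> give values that differ by 1 + 2(m - n), which is 1 or -1 iff m = n or m = n
  - 1. The condition demands this for all integers n, m between floor and ceiling of
  \<open>s\<close> and \<open>t\<close>; in particular at most one of \<open>s\<close>,
  \<open>t\<close> is not an integer.\<close>

definition arc_ok :: "real \<Rightarrow> real \<Rightarrow> bool" where
  "arc_ok s t \<longleftrightarrow> \<lceil>t\<rceil> \<le> \<lfloor>s\<rfloor> \<and> \<lceil>s\<rceil> \<le> \<lfloor>t\<rfloor> + 1"

lemma mono_floor: "mono (floor :: real \<Rightarrow> int)" and mono_ceiling: "mono (ceiling :: real \<Rightarrow> int)"
  by (auto intro: monoI floor_mono ceiling_mono)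

lemma ceiling_max: "\<lceil>max (x::real) y\<rceil> = max \<lceil>x\<rceil> \<lceil>y\<rceil>"
  by (simp add: max_of_mono mono_ceiling)

lemma floor_max: "\<lfloor>max (x::real) y\<rfloor> = max \<lfloor>x\<rfloor> \<lfloor>y\<rfloor>"
  by (simp add: max_of_mono mono_floor)

lemma ceiling_min: "\<lceil>min (x::real) y\<rceil> = min \<lceil>x\<rceil> \<lceil>y\<rceil>"
  by (simp add: min_of_mono mono_ceiling)

lemma floor_min: "\<lfloor>min (x::real) y\<rfloor> = min \<lfloor>x\<rfloor> \<lfloor>y\<rfloor>"
  by (simp add: min_of_mono mono_floor)

lemma arc_ok_max: "arc_ok s t \<Longrightarrow> arc_ok s' t' \<Longrightarrow> arc_ok (max s s') (max t t')"
  unfolding arc_ok_def ceiling_max floor_max by linarith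

lemma arc_ok_min: "arc_ok s t \<Longrightarrow> arc_ok s' t' \<Longrightarrow> arc_ok (min s s') (min t t')"
  unfolding arc_ok_def ceiling_min floor_min by linarith

lemma arc_ok_add_int: "arc_ok s t \<Longrightarrow> arc_ok (s + of_int n) (t + of_int n)"
  unfolding arc_ok_def by simp

lemma arc_ok_abs: "arc_ok s t \<Longrightarrow> \<bar>s - t\<bar> \<le> 1"
  unfolding arc_ok_def by linarith

lemma arc_ok_diff: "arc_ok s t \<Longrightarrow> 0 \<le> s - t \<and> s - t \<le> 1"
  unfolding arc_ok_def by linarith

text \<open>Inside the closed unit cell of a number, floors can only rise and ceilings only fall,
  which weakens nothing but the two inequalities.\<close>

lemma arc_ok_refine:
  assumes "arc_ok s t" "of_int \<lfloor>s\<rfloor> \<le> s'" "s' \<le> of_int \<lceil>s\<rceil>" "of_int \<lfloor>t\<rfloor> \<le> t'" "t' \<le> of_int \<lceil>t\<rceil>"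
  shows "arc_ok s' t'"
proof -
  have "\<lfloor>s\<rfloor> \<le> \<lfloor>s'\<rfloor>" "\<lceil>s'\<rceil> \<le> \<lceil>s\<rceil>" "\<lfloor>t\<rfloor> \<le> \<lfloor>t'\<rfloor>" "\<lceil>t'\<rceil> \<le> \<lceil>t\<rceil>"
    using assms by (simp_all add: le_floor_iff ceiling_le_iff)
  then show ?thesis
    using assms(1) unfolding arc_ok_def by linarith
qed

locale height_space =
  fixes V :: "'a set" and D :: "('a \<times> 'a) set" and N :: int
  assumes finite_V: "finite V" and D_sub: "D \<subseteq> V \<times> V" and N_pos: "N > 0"
begin

definition heights :: "('a \<Rightarrow> real) set" where
  "heights = {b. (\<forall>v. v \<notin> V \<longrightarrow> b v = 0) \<and> (\<forall>(v, u) \<in> D. arc_ok (b v) (b u))}"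

definition heights0 :: "('a \<Rightarrow> real) set" where
  "heights0 = {b. path_component heights (\<lambda>_. 0) b}"

text \<open>A chosen vertex of the connected component of \<open>v\<close>. It depends on the
  component only, since related vertices define the same predicate and hence the same
  choice.\<close>

definition rep :: "'a \<Rightarrow> 'a" where
  "rep v = (SOME u. (v, u) \<in> (D \<union> D\<inverse>)\<^sup>*)"

definition block :: "int \<Rightarrow> 'a \<Rightarrow> 'a \<Rightarrow> real" where
  "block m r = (\<lambda>v. if v \<in> V \<and> rep v = r then of_int (N * m) else 0)"

definition free_reps :: "'a set" where
  "free_reps = {r \<in> rep ` V. block 1 r \<in> heights0}"

lemma heightsI:
  "(\<And>v. v \<notin> V \<Longrightarrow> b v = 0) \<Longrightarrow> (\<And>v u. (v, u) \<in> D \<Longrightarrow> arc_ok (b v) (b u)) \<Longrightarrow> b \<in> heights"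
  by (auto simp: heights_def)

lemma heights_arc: "b \<in> heights \<Longrightarrow> (v, u) \<in> D \<Longrightarrow> arc_ok (b v) (b u)"
  by (auto simp: heights_def)

lemma heights_outside: "b \<in> heights \<Longrightarrow> v \<notin> V \<Longrightarrow> b v = 0"
  by (auto simp: heights_def)

lemma D_V: "(v, u) \<in> D \<Longrightarrow> v \<in> V" "(v, u) \<in> D \<Longrightarrow> u \<in> V"
  using D_sub by auto

lemma rep_related: "(v, rep v) \<in> (D \<union> D\<inverse>)\<^sup>*"
  unfolding rep_def by (rule someI[of _ v]) auto

lemma sym_related: "sym ((D \<union> D\<inverse>)\<^sup>*)"
  by (intro sym_rtrancl) (auto simp: sym_def)

lemma related_sym: "(v, u) \<in> (D \<union> D\<inverse>)\<^sup>* \<Longrightarrow> (u, v) \<in> (D \<union> D\<inverse>)\<^sup>*"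
  using sym_related by (meson symE)

lemma rep_cong:
  assumes "(v, u) \<in> (D \<union> D\<inverse>)\<^sup>*" shows "rep v = rep u"
proof -
  have "(v, w) \<in> (D \<union> D\<inverse>)\<^sup>* \<longleftrightarrow> (u, w) \<in> (D \<union> D\<inverse>)\<^sup>*" for w
    using assms related_sym rtrancl_trans by metis
  then show ?thesis unfolding rep_def by simp
qed

lemma rep_arc: "(v, u) \<in> D \<Longrightarrow> rep v = rep u"
  by (intro rep_cong) auto

lemma rep_rep [simp]: "rep (rep v) = rep v"
  using rep_cong[OF rep_related[of v]] by simp

lemma related_V: "(v, u) \<in> (D \<union> D\<inverse>)\<^sup>* \<Longrightarrow> v \<in> V \<Longrightarrow> u \<in> V"
  by (induction rule: rtrancl_induct) (use D_V in auto)

lemma rep_V: "v \<in> V \<Longrightarrow> rep v \<in> V"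
  using related_V rep_related by blast

lemma related_if_rep_eq: "rep u = rep v \<Longrightarrow> (u, v) \<in> (D \<union> D\<inverse>)\<^sup>*"
  by (metis related_sym rep_related rtrancl_trans)

lemma free_reps_V: "r \<in> free_reps \<Longrightarrow> r \<in> V" and rep_free_reps: "r \<in> free_reps \<Longrightarrow> rep r = r"
  unfolding free_reps_def using rep_V by auto

lemma finite_free_reps: "finite free_reps"
  using finite_V unfolding free_reps_def by auto

lemma heights0_heights: "b \<in> heights0 \<Longrightarrow> b \<in> heights"
  unfolding heights0_def using path_component_mem by auto

lemma heights0_step: "b \<in> heights0 \<Longrightarrow> path_component heights b b' \<Longrightarrow> b' \<in> heights0"
  unfolding heights0_def using path_component_trans by blast

lemma heights0_path: "b \<in> heights0 \<Longrightarrow> b' \<in> heights0 \<Longrightarrow> path_component heights b b'"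
  unfolding heights0_def using path_component_trans path_component_sym by blast

lemma zero_heights: "(\<lambda>_. 0) \<in> heights"
  by (intro heightsI) (auto simp: arc_ok_def)

lemma zero_heights0: "(\<lambda>_. 0) \<in> heights0"
  unfolding heights0_def using zero_heights path_component_refl by blast

section \<open>Lattice operations, gluing over components, and cells\<close>

lemma heights_max: "b \<in> heights \<Longrightarrow> b' \<in> heights \<Longrightarrow> (\<lambda>v. max (b v) (b' v)) \<in> heights"
  by (intro heightsI) (auto simp: heights_outside intro: arc_ok_max dest: heights_arc)

lemma heights_min: "b \<in> heights \<Longrightarrow> b' \<in> heights \<Longrightarrow> (\<lambda>v. min (b v) (b' v)) \<in> heights"
  by (intro heightsI) (auto simp: heights_outside intro: arc_ok_min dest: heights_arc)

text \<open>No arc joins two components, so each component can follow a function of its own.\<close>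

lemma heights_glue:
  assumes "\<And>r. B r \<in> heights" shows "(\<lambda>v. B (rep v) v) \<in> heights"
  by (intro heightsI) (use assms rep_arc heights_arc heights_outside in fastforce)+

lemma heights_translate:
  assumes "b \<in> heights" "\<And>v. v \<notin> V \<Longrightarrow> n v = 0" "\<And>v u. (v, u) \<in> D \<Longrightarrow> n v = n u"
  shows "(\<lambda>v. b v + of_int (n v)) \<in> heights"
proof (intro heightsI)
  fix v u assume vu: "(v, u) \<in> D"
  show "arc_ok (b v + of_int (n v)) (b u + of_int (n u))"
    using arc_ok_add_int[OF heights_arc[OF assms(1) vu], of "n v"] assms(3)[OF vu] by simp
qed (use assms heights_outside in auto)

lemma heights_refine:
  assumes "b \<in> heights" "\<And>v. of_int \<lfloor>b v\<rfloor> \<le> b' v \<and> b' v \<le> of_int \<lceil>b v\<rceil>"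
  shows "b' \<in> heights"
proof (intro heightsI)
  show "b' v = 0" if "v \<notin> V" for v
    using assms(2)[of v] heights_outside[OF assms(1) that] by auto
  show "arc_ok (b' v) (b' u)" if "(v, u) \<in> D" for v u
    using arc_ok_refine[OF heights_arc[OF assms(1) that]] assms(2) by blast
qed

text \<open>Two moves, from \<open>max 0 0\<close> to \<open>max 0 b\<close> and on to
  \<open>max b b'\<close>, each the image of a path under the maximum with a fixed height
  function.\<close>

lemma heights0_max:
  assumes "b \<in> heights0" "b' \<in> heights0" shows "(\<lambda>v. max (b v) (b' v)) \<in> heights0"
proof -
  have *: "path_component heights (\<lambda>v. max (c v) (d v)) (\<lambda>v. max (c v) (d' v))"
    if "c \<in> heights" "path_component heights d d'" for c d d'
    by (rule path_component_map[OF that(2), of "\<lambda>x v. max (c v) (x v)"])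
      (use that heights_max in \<open>auto intro!: continuous_intros\<close>)
  have "path_component heights (\<lambda>v. max 0 0) (\<lambda>v. max 0 (b v))"
    using *[OF zero_heights heights0_path[OF zero_heights0 assms(1)]] .
  moreover have "path_component heights (\<lambda>v. max (b v) 0) (\<lambda>v. max (b v) (b' v))"
    using *[OF heights0_heights[OF assms(1)] heights0_path[OF zero_heights0 assms(2)]] .
  ultimately show ?thesis
    using heights0_step[OF zero_heights0] path_component_trans by (simp add: max.commute) blast
qed

lemma heights0_min:
  assumes "b \<in> heights0" "b' \<in> heights0" shows "(\<lambda>v. min (b v) (b' v)) \<in> heights0"
proof -
  have *: "path_component heights (\<lambda>v. min (c v) (d v)) (\<lambda>v. min (c v) (d' v))"
    if "c \<in> heights" "path_component heights d d'" for c d d'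
    by (rule path_component_map[OF that(2), of "\<lambda>x v. min (c v) (x v)"])
      (use that heights_min in \<open>auto intro!: continuous_intros\<close>)
  have "path_component heights (\<lambda>v. min 0 0) (\<lambda>v. min 0 (b v))"
    using *[OF zero_heights heights0_path[OF zero_heights0 assms(1)]] .
  moreover have "path_component heights (\<lambda>v. min (b v) 0) (\<lambda>v. min (b v) (b' v))"
    using *[OF heights0_heights[OF assms(1)] heights0_path[OF zero_heights0 assms(2)]] .
  ultimately show ?thesis
    using heights0_step[OF zero_heights0] path_component_trans by (simp add: min.commute) blast
qed

text \<open>Paths from 0, one chosen for each \<open>r\<close>, are run simultaneously, each on its
  own component.\<close>

lemma heights0_glue:
  assumes "\<And>r. B r \<in> heights0" shows "(\<lambda>v. B (rep v) v) \<in> heights0"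
proof -
  have "\<forall>r. \<exists>g :: real \<Rightarrow> 'a \<Rightarrow> real. continuous_on {0..1} g \<and> (\<forall>t\<in>{0..1}. g t \<in> heights) \<and>
      g 0 = (\<lambda>_. 0) \<and> g 1 = B r"
  proof
    fix r
    obtain g :: "real \<Rightarrow> 'a \<Rightarrow> real" where g: "continuous_on {0..1} g" "\<And>t. t \<in> {0..1} \<Longrightarrow> g t \<in> heights"
        "g 0 = (\<lambda>_. 0)" "g 1 = B r"
      by (rule path_componentE[OF heights0_path[OF zero_heights0 assms[of r]]], rule that)
    show "\<exists>g :: real \<Rightarrow> 'a \<Rightarrow> real. continuous_on {0..1} g \<and> (\<forall>t\<in>{0..1}. g t \<in> heights) \<and>
        g 0 = (\<lambda>_. 0) \<and> g 1 = B r"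
      by (intro exI[of _ g] conjI ballI g)
  qed
  from choice[OF this] obtain g :: "'a \<Rightarrow> real \<Rightarrow> 'a \<Rightarrow> real" where
      *: "\<forall>r. continuous_on {0..1} (g r) \<and> (\<forall>t\<in>{0..1}. g r t \<in> heights) \<and> g r 0 = (\<lambda>_. 0) \<and> g r 1 = B r"
    by (rule exE)
  have g: "continuous_on {0..1} (g r)" "t \<in> {0..1} \<Longrightarrow> g r t \<in> heights" "g r 0 = (\<lambda>_. 0)" "g r 1 = B r" for r t
    using * by simp_all
  define h where "h t v = (if t \<in> {0..1} then g (rep v) t v else 0)" for t v
  have "h t \<in> heights" for t
  proof (cases "t \<in> {0..1}")
    case True
    then have "h t = (\<lambda>v. g (rep v) t v)" by (simp add: h_def fun_eq_iff)
    then show ?thesis using heights_glue[of "\<lambda>r. g r t"] g(2)[OF True] by simp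
  next
    case False
    then have "h t v = 0" for v unfolding h_def by (rule if_not_P)
    then have "h t = (\<lambda>_. 0)" by blast
    then show ?thesis using zero_heights by simp
  qed
  moreover have "continuous_on {0..1} h"
  proof (intro continuous_on_coordinatewise_then_product)
    fix v
    have "continuous_on {0..1} (\<lambda>t. g (rep v) t v)"
      by (rule continuous_on_product_then_coordinatewise, rule g)
    then show "continuous_on {0..1} (\<lambda>t. h t v)"
      by (rule continuous_on_eq) (simp add: h_def)
  qed
  ultimately have "path_component heights (h 0) (h 1)"
    by (intro path_componentI)
  moreover have "h 0 = (\<lambda>_. 0)" "h 1 = (\<lambda>v. B (rep v) v)"
    unfolding h_def by (simp_all add: g(3,4))
  ultimately show ?thesis
    using heights0_step[OF zero_heights0] by metis
qed

text \<open>The closed unit cell of \<open>c\<close> is convex and consists of height functions, so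
  segments are allowed inside one cell.\<close>

lemma heights_cell_path:
  assumes "c \<in> heights" "\<And>v. of_int \<lfloor>c v\<rfloor> \<le> b v \<and> b v \<le> of_int \<lceil>c v\<rceil>"
    and "\<And>v. of_int \<lfloor>c v\<rfloor> \<le> b' v \<and> b' v \<le> of_int \<lceil>c v\<rceil>"
  shows "path_component heights b b'"
proof -
  define g where "g t = (\<lambda>v. (1 - t) * b v + t * b' v)" for t :: real
  have "path_component heights (g 0) (g 1)"
  proof (rule path_componentI)
    show "continuous_on {0..1} g" unfolding g_def by (intro continuous_intros)
    fix t :: real assume t: "t \<in> {0..1}"
    show "g t \<in> heights"
    proof (rule heights_refine[OF assms(1)])
      fix v
      let ?I = "{of_int \<lfloor>c v\<rfloor>..of_int \<lceil>c v\<rceil>} :: real set"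
      have "convex ?I" "b v \<in> ?I" "b' v \<in> ?I" using assms(2,3)[of v] by auto
      from convexD_alt[OF this, of t] show "of_int \<lfloor>c v\<rfloor> \<le> g t v \<and> g t v \<le> of_int \<lceil>c v\<rceil>"
        using t by (simp add: g_def)
    qed
  qed
  then show ?thesis by (simp add: g_def)
qed

lemma heights0_refine:
  assumes "b \<in> heights0" "\<And>v. of_int \<lfloor>b v\<rfloor> \<le> b' v \<and> b' v \<le> of_int \<lceil>b v\<rceil>"
  shows "b' \<in> heights0"
  by (rule heights0_step[OF assms(1) heights_cell_path[OF heights0_heights[OF assms(1)]]])
    (use assms(2) in auto)

lemma heights0_unrefine:
  assumes "b \<in> heights0" "b' \<in> heights" "\<And>v. of_int \<lfloor>b' v\<rfloor> \<le> b v \<and> b v \<le> of_int \<lceil>b' v\<rceil>"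
  shows "b' \<in> heights0"
  by (rule heights0_step[OF assms(1) heights_cell_path[OF assms(2)]]) (use assms(3) in auto)

section \<open>Translations and free components\<close>

lemma block_heights: "block m r \<in> heights"
proof (intro heightsI)
  fix v u assume vu: "(v, u) \<in> D"
  have "arc_ok (of_int (N * m)) (of_int (N * m))" "arc_ok 0 0"
    by (simp_all add: arc_ok_def del: of_int_mult)
  then show "arc_ok (block m r v) (block m r u)"
    using rep_arc[OF vu] D_V[OF vu] by (simp add: block_def)
qed (simp add: block_def)

text \<open>A translation carries path components into path components, so it maps the one of 0 into
  itself as soon as it does so with a single point.\<close>

lemma heights0_translate_path:
  assumes "b \<in> heights0" "(\<lambda>v. b v + of_int (n v)) \<in> heights0" "c \<in> heights0"
    and "\<And>v. v \<notin> V \<Longrightarrow> n v = 0" "\<And>v u. (v, u) \<in> D \<Longrightarrow> n v = n u"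
  shows "(\<lambda>v. c v + of_int (n v)) \<in> heights0"
proof -
  have "path_component heights (\<lambda>v. b v + of_int (n v)) (\<lambda>v. c v + of_int (n v))"
    by (rule path_component_map[OF heights0_path[OF assms(1,3)], of "\<lambda>x v. x v + of_int (n v)"])
      (auto intro!: continuous_intros intro: heights_translate assms(4,5))
  then show ?thesis using heights0_step assms(2) by blast
qed

text \<open>The translation by \<open>- N * m\<close> on the component takes
  \<open>block m r\<close> to 0, hence 0 to \<open>block (- m) r\<close>.\<close>

lemma block_uminus_heights0:
  assumes "block m r \<in> heights0" shows "block (- m) r \<in> heights0"
proof -
  define n where "n = (\<lambda>v. if v \<in> V \<and> rep v = r then - N * m else 0)"
  have eq: "(\<lambda>v. block m r v + of_int (n v)) = (\<lambda>_. 0)" "(\<lambda>v. 0 + of_int (n v)) = block (- m) r"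
    by (auto simp: block_def n_def)
  have "(\<lambda>v. 0 + of_int (n v)) \<in> heights0"
  proof (rule heights0_translate_path[OF assms _ zero_heights0])
    show "(\<lambda>v. block m r v + of_int (n v)) \<in> heights0"
      unfolding eq by (rule zero_heights0)
    show "n v = n u" if "(v, u) \<in> D" for v u
      using rep_arc[OF that] D_V[OF that] by (simp add: n_def)
  qed (simp add: n_def)
  then show ?thesis unfolding eq .
qed

lemma heights0_restrict:
  assumes "b \<in> heights0" shows "(\<lambda>v. if rep v = r then b v else 0) \<in> heights0"
proof -
  have "(\<lambda>v. (if rep v = r then b else (\<lambda>_. 0)) v) \<in> heights0"
    by (rule heights0_glue[of "\<lambda>s. if s = r then b else (\<lambda>_. 0)"]) (use assms zero_heights0 in auto)
  then show ?thesis by (rule back_subst[of "\<lambda>x. x \<in> heights0"]) auto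
qed

text \<open>The function \<open>c\<close> is not assumed to be in the path component of 0: a path
  from 0 to \<open>b\<close>, truncated from above by \<open>c\<close>, still starts at 0 because
  \<open>c\<close> is nonnegative.\<close>

lemma heights0_min_path:
  assumes "b \<in> heights0" "c \<in> heights" "\<And>v. min 0 (c v) = 0" 
  shows "(\<lambda>v. min (b v) (c v)) \<in> heights0"
proof -
  have "path_component heights (\<lambda>v. min 0 (c v)) (\<lambda>v. min (b v) (c v))"
    by (rule path_component_map[OF heights0_path[OF zero_heights0 assms(1)], of "\<lambda>x v. min (x v) (c v)"])
      (use heights_min assms(2) in \<open>auto intro!: continuous_intros\<close>)
  then show ?thesis using heights0_step zero_heights0 assms(3) by simp
qed

lemma heights0_max_path:
  assumes "b \<in> heights0" "c \<in> heights" "\<And>v. max 0 (c v) = 0" 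
  shows "(\<lambda>v. max (b v) (c v)) \<in> heights0"
proof -
  have "path_component heights (\<lambda>v. max 0 (c v)) (\<lambda>v. max (b v) (c v))"
    by (rule path_component_map[OF heights0_path[OF zero_heights0 assms(1)], of "\<lambda>x v. max (x v) (c v)"])
      (use heights_max assms(2) in \<open>auto intro!: continuous_intros\<close>)
  then show ?thesis using heights0_step zero_heights0 assms(3) by simp
qed

text \<open>Truncating by \<open>block 1 r\<close> leaves exactly the block once \<open>b\<close> is
  at least \<open>N\<close> on the whole component. Freeness is thus a matter of unboundedness, and
  no path ending precisely at the block has to be found.\<close>

lemma block_free_if_ge:
  assumes "b \<in> heights0" "\<And>v. v \<in> V \<Longrightarrow> rep v = r \<Longrightarrow> of_int N \<le> b v"
  shows "block 1 r \<in> heights0"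
proof -
  let ?b = "\<lambda>v. if rep v = r then b v else 0"
  have "min (?b v) (block 1 r v) = block 1 r v" for v
    using assms(2)[of v] heights_outside[OF heights0_heights[OF assms(1)], of v]
    by (cases "v \<in> V"; cases "rep v = r") (simp_all add: block_def)
  then have eq: "(\<lambda>v. min (?b v) (block 1 r v)) = block 1 r"
    by (rule ext)
  have "(\<lambda>v. min (?b v) (block 1 r v)) \<in> heights0"
    by (rule heights0_min_path[OF heights0_restrict[OF assms(1)] block_heights])
      (use N_pos in \<open>auto simp: block_def\<close>)
  then show ?thesis
    unfolding eq .
qed

lemma block_free_if_le:
  assumes "b \<in> heights0" "\<And>v. v \<in> V \<Longrightarrow> rep v = r \<Longrightarrow> b v \<le> - of_int N"
  shows "block 1 r \<in> heights0"
proof -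
  let ?b = "\<lambda>v. if rep v = r then b v else 0"
  have "max (?b v) (block (-1) r v) = block (-1) r v" for v
    using assms(2)[of v] heights_outside[OF heights0_heights[OF assms(1)], of v]
    by (cases "v \<in> V"; cases "rep v = r") (simp_all add: block_def)
  then have eq: "(\<lambda>v. max (?b v) (block (-1) r v)) = block (-1) r"
    by (rule ext)
  have "(\<lambda>v. max (?b v) (block (-1) r v)) \<in> heights0"
    by (rule heights0_max_path[OF heights0_restrict[OF assms(1)] block_heights])
      (use N_pos in \<open>auto simp: block_def\<close>)
  then have "block (-1) r \<in> heights0"
    unfolding eq .
  then show ?thesis using block_uminus_heights0[of "-1" r] by simp
qed

text \<open>A larger multiple of the period is cut down to a single one by truncation. So the
  translations available on a component are all multiples of \<open>N\<close> or only 0, and each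
  free component contributes one full circle.\<close>

lemma block_free_if_block:
  assumes "block m r \<in> heights0" "m \<noteq> 0" shows "block 1 r \<in> heights0"
proof (cases "m > 0")
  case True
  then show ?thesis
    using N_pos by (intro block_free_if_ge[OF assms(1)]) (auto simp: block_def)
next
  case False
  then have "N * m \<le> - N"
    using N_pos assms(2) mult_left_mono[of m "-1" N] by simp
  then have "of_int (N * m) \<le> - (of_int N :: real)"
    by linarith
  then show ?thesis
    by (intro block_free_if_le[OF assms(1)]) (simp add: block_def)
qed

section \<open>Bounds on height functions\<close>

lemma related_bound:
  assumes "(v, u) \<in> (D \<union> D\<inverse>)\<^sup>*"
  shows "\<exists>c\<ge>0. \<forall>b\<in>heights. \<bar>b v - b u\<bar> \<le> (c::real)"
  using assms
proof (induction rule: rtrancl_induct)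
  case base
  then show ?case by (intro exI[of _ 0]) auto
next
  case (step u w)
  then obtain c where c: "c \<ge> 0" "\<forall>b\<in>heights. \<bar>b v - b u\<bar> \<le> c" by blast
  have "\<bar>b u - b w\<bar> \<le> 1" if "b \<in> heights" for b
  proof -
    from step(2) have "(u, w) \<in> D \<or> (w, u) \<in> D" by auto
    then show ?thesis
      using arc_ok_abs[OF heights_arc[OF that, of u w]] arc_ok_abs[OF heights_arc[OF that, of w u]]
      by (elim disjE) (simp_all add: abs_minus_commute)
  qed
  then have "\<bar>b v - b w\<bar> \<le> c + 1" if "b \<in> heights" for b
    using c(2) that by fastforce
  then show ?case using c(1) by (intro exI[of _ "c + 1"]) auto
qed

lemma uniform_bound:
  obtains B :: real where "B \<ge> 0" "\<And>b v u. b \<in> heights \<Longrightarrow> v \<in> V \<Longrightarrow> u \<in> V \<Longrightarrow> rep v = rep u \<Longrightarrow> \<bar>b v - b u\<bar> \<le> B"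
proof -
  have "\<exists>c\<ge>0. rep v = rep u \<longrightarrow> (\<forall>b\<in>heights. \<bar>b v - b u\<bar> \<le> (c::real))" for v u
    using related_bound[OF related_if_rep_eq] by (cases "rep v = rep u") auto
  then obtain c where c: "\<And>v u. c v u \<ge> 0" 
      "\<And>v u b. rep v = rep u \<Longrightarrow> b \<in> heights \<Longrightarrow> \<bar>b v - b u\<bar> \<le> (c v u::real)"
    by metis
  show thesis
  \<comment> \<open>The sum of all the nonnegative constants dominates each of them.\<close>
  proof (rule that[of "\<Sum>v\<in>V. \<Sum>u\<in>V. c v u"])
    show "0 \<le> (\<Sum>v\<in>V. \<Sum>u\<in>V. c v u)" using c by (intro sum_nonneg)
    fix b v u assume *: "b \<in> heights" "v \<in> V" "u \<in> V" "rep v = rep u"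
    have "\<bar>b v - b u\<bar> \<le> c v u" using c * by blast
    also have "\<dots> \<le> (\<Sum>u\<in>V. c v u)" by (rule member_le_sum) (use * c finite_V in auto)
    also have "\<dots> \<le> (\<Sum>v\<in>V. \<Sum>u\<in>V. c v u)"
      by (rule member_le_sum[of v V "\<lambda>v. \<Sum>u\<in>V. c v u"]) (use * c finite_V in \<open>auto intro: sum_nonneg\<close>)
    finally show "\<bar>b v - b u\<bar> \<le> (\<Sum>v\<in>V. \<Sum>u\<in>V. c v u)" .
  qed
qed

text \<open>Heights within a component differ by at most the uniform bound. A value beyond that
  bound plus \<open>N\<close> would therefore push the whole component to \<open>N\<close> or above,
  or to \<open>- N\<close> or below, and make it free.\<close>

lemma rigid_bound:
  obtains B :: real where "B \<ge> 0" 
    "\<And>b v u. b \<in> heights \<Longrightarrow> v \<in> V \<Longrightarrow> u \<in> V \<Longrightarrow> rep v = rep u \<Longrightarrow> \<bar>b v - b u\<bar> \<le> B"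
    "\<And>b v. b \<in> heights0 \<Longrightarrow> v \<in> V \<Longrightarrow> rep v \<notin> free_reps \<Longrightarrow> \<bar>b v\<bar> \<le> B"
proof -
  obtain B :: real where B: "B \<ge> 0" "\<And>b v u. b \<in> heights \<Longrightarrow> v \<in> V \<Longrightarrow> u \<in> V \<Longrightarrow> rep v = rep u \<Longrightarrow> \<bar>b v - b u\<bar> \<le> B"
    using uniform_bound by blast
  show thesis
  proof (rule that[of "B + of_int N"])
    fix b v assume *: "b \<in> heights0" "v \<in> V" "rep v \<notin> free_reps"
    show "\<bar>b v\<bar> \<le> B + of_int N"
    proof (rule ccontr)
      assume **: "\<not> \<bar>b v\<bar> \<le> B + of_int N"
      have close: "\<bar>b v - b u\<bar> \<le> B" if "u \<in> V" "rep u = rep v" for u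
        using B(2)[OF heights0_heights[OF *(1)] *(2) that(1)] that(2) by simp
      have "block 1 (rep v) \<in> heights0"
      proof (cases "b v \<ge> 0")
        case True
        then show ?thesis using ** close by (intro block_free_if_ge[OF *(1)]) force
      next
        case False
        then show ?thesis using ** close by (intro block_free_if_le[OF *(1)]) force
      qed
      then show False using * unfolding free_reps_def by blast
    qed
  qed (use B N_pos in \<open>fastforce+\<close>)
qed

lemma finite_upper:
  assumes "finite S" "S \<subseteq> heights0"
  shows "\<exists>h\<in>heights0. \<forall>f\<in>S. \<forall>v. f v \<le> h v"
  using assms
proof (induction rule: finite_induct)
  case empty
  then show ?case using zero_heights0 by blast
next
  case (insert f S)
  then obtain h where h: "h \<in> heights0" "\<forall>f\<in>S. \<forall>v. f v \<le> h v" by auto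
  have "\<forall>g\<in>insert f S. \<forall>v. g v \<le> max (f v) (h v)"
    using h(2) by (auto simp: le_max_iff_disj)
  moreover have "(\<lambda>v. max (f v) (h v)) \<in> heights0"
    using insert.prems h(1) by (intro heights0_max) auto
  ultimately show ?case by (rule bexI)
qed

lemma finite_lower:
  assumes "finite S" "S \<subseteq> heights0"
  shows "\<exists>h\<in>heights0. \<forall>f\<in>S. \<forall>v. h v \<le> f v"
  using assms
proof (induction rule: finite_induct)
  case empty
  then show ?case using zero_heights0 by blast
next
  case (insert f S)
  then obtain h where h: "h \<in> heights0" "\<forall>f\<in>S. \<forall>v. h v \<le> f v" by auto
  have "\<forall>g\<in>insert f S. \<forall>v. min (f v) (h v) \<le> g v"
    using h(2) by (auto simp: min_le_iff_disj)
  moreover have "(\<lambda>v. min (f v) (h v)) \<in> heights0"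
    using insert.prems h(1) by (intro heights0_min) auto
  ultimately show ?case by (rule bexI)
qed

lemma finite_bounded_int:
  "finite {f :: 'a \<Rightarrow> real. (\<forall>v. f v \<in> \<int>) \<and> (\<forall>v. v \<notin> V \<longrightarrow> f v = 0) \<and> (\<forall>v. \<bar>f v\<bar> \<le> B)}"
proof (rule finite_subset)
  let ?C = "of_int ` {- \<lceil>B\<rceil>..\<lceil>B\<rceil>} :: real set"
  show "finite {f. \<forall>v. (v \<in> V \<longrightarrow> f v \<in> ?C) \<and> (v \<notin> V \<longrightarrow> f v = 0)}"
    by (intro finite_set_of_finite_funs finite_V) auto
  have "x \<in> ?C" if x: "x \<in> \<int>" "\<bar>x\<bar> \<le> B" for x :: real
  proof -
    obtain n where "x = of_int n" using x(1) by (auto elim: Ints_cases)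
    then show ?thesis using x(2) by (intro image_eqI[of _ _ n]) (simp_all, linarith)
  qed
  then show "{f. (\<forall>v. f v \<in> \<int>) \<and> (\<forall>v. v \<notin> V \<longrightarrow> f v = 0) \<and> (\<forall>v. \<bar>f v\<bar> \<le> B)}
      \<subseteq> {f. \<forall>v. (v \<in> V \<longrightarrow> f v \<in> ?C) \<and> (v \<notin> V \<longrightarrow> f v = 0)}"
    by blast
qed

text \<open>Rounding up or down stays in the same closed cell, hence in \<open>heights0\<close>. On
  a component that is not free only finitely many integral functions are possible, and their maximum
  and minimum again belong to \<open>heights0\<close>.\<close>

lemma rigid_extremes:
  assumes "r \<notin> free_reps"
  obtains lo hi where "lo \<in> heights0" "hi \<in> heights0"
    "\<And>b v. b \<in> heights0 \<Longrightarrow> v \<in> V \<Longrightarrow> rep v = r \<Longrightarrow> lo v \<le> b v \<and> b v \<le> hi v"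
proof -
  obtain B :: real where B: "B \<ge> 0" "\<And>b v. b \<in> heights0 \<Longrightarrow> v \<in> V \<Longrightarrow> rep v \<notin> free_reps \<Longrightarrow> \<bar>b v\<bar> \<le> B"
    using rigid_bound by metis
  let ?F = "{f :: 'a \<Rightarrow> real. (\<forall>v. f v \<in> \<int>) \<and> (\<forall>v. v \<notin> V \<longrightarrow> f v = 0) \<and> (\<forall>v. \<bar>f v\<bar> \<le> B)} \<inter> heights0"
  have F: "finite ?F" using finite_bounded_int by blast
  obtain hi where hi: "hi \<in> heights0" "\<forall>f\<in>?F. \<forall>v. f v \<le> hi v"
    using finite_upper[OF F] by blast
  obtain lo where lo: "lo \<in> heights0" "\<forall>f\<in>?F. \<forall>v. lo v \<le> f v"
    using finite_lower[OF F] by blast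
  have mem: "(\<lambda>v. if rep v = r then c v else 0) \<in> ?F" if "c \<in> heights0" "\<And>v. c v \<in> \<int>" for c
  proof -
    have "\<bar>if rep v = r then c v else 0\<bar> \<le> B" for v
      using B(1) B(2)[OF that(1), of v] heights_outside[OF heights0_heights[OF that(1)], of v] assms
      by (cases "v \<in> V") auto
    then show ?thesis
      using heights0_restrict[OF that(1)] heights_outside[OF heights0_heights[OF that(1)]] that(2) by auto
  qed
  show thesis
  proof (rule that[OF lo(1) hi(1)])
    fix b v assume *: "b \<in> heights0" "v \<in> V" "rep v = r"
    have "(\<lambda>v. of_int \<lceil>b v\<rceil>) \<in> heights0" by (rule heights0_refine[OF *(1)]; linarith)
    from bspec[OF hi(2) mem[OF this], THEN spec[of _ v]] have "of_int \<lceil>b v\<rceil> \<le> hi v"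
      using *(3) by simp
    moreover have "(\<lambda>v. of_int \<lfloor>b v\<rfloor>) \<in> heights0" by (rule heights0_refine[OF *(1)]; linarith)
    from bspec[OF lo(2) mem[OF this], THEN spec[of _ v]] have "lo v \<le> of_int \<lfloor>b v\<rfloor>"
      using *(3) by simp
    ultimately show "lo v \<le> b v \<and> b v \<le> hi v" by linarith
  qed
qed

section \<open>Paths that sweep out a component\<close>

lemma free_path:
  assumes "r \<in> free_reps"
  obtains p :: "real \<Rightarrow> 'a \<Rightarrow> real" where "continuous_on UNIV p" "\<And>t. p t \<in> heights0"
    "\<And>t. p (t + 1) = (\<lambda>v. p t v + block 1 r v)" "p 0 = (\<lambda>_. 0)"
proof -
  have "block 1 r \<in> heights0" using assms by (simp add: free_reps_def)
  then obtain g :: "real \<Rightarrow> 'a \<Rightarrow> real" where g: "continuous_on {0..1} g" "\<And>t. t \<in> {0..1} \<Longrightarrow> g t \<in> heights"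
      "g 0 = (\<lambda>_. 0)" "g 1 = block 1 r"
    using path_componentE[OF heights0_path[OF zero_heights0]] by metis
  define p where "p t = (\<lambda>v. g (frac t) v + block \<lfloor>t\<rfloor> r v)" for t
  have p0: "p 0 = (\<lambda>_. 0)" by (rule ext) (simp add: p_def g(3) block_def)
  have p1: "p (t + 1) = (\<lambda>v. p t v + block 1 r v)" for t
    by (rule ext) (simp add: p_def frac_1_eq block_def ring_distribs)
  have p_heights: "p t \<in> heights" for t
  proof -
    define n where "n = (\<lambda>v. if v \<in> V \<and> rep v = r then N * \<lfloor>t\<rfloor> else 0)"
    have "(\<lambda>v. g (frac t) v + of_int (n v)) \<in> heights"
    proof (rule heights_translate[OF g(2)])
      show "n v = n u" if "(v, u) \<in> D" for v u
        using rep_arc[OF that] D_V[OF that] by (simp add: n_def)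
    qed (auto simp: n_def less_imp_le[OF frac_lt_1])
    moreover have "(\<lambda>v. g (frac t) v + of_int (n v)) = p t"
      by (rule ext) (simp add: p_def n_def block_def)
    ultimately show ?thesis by simp
  qed
  have cont: "continuous_on UNIV p"
  proof (rule continuous_on_unit_intervals)
    fix n :: int
    have "continuous_on {of_int n..of_int n + 1} (\<lambda>t v. g (t - of_int n) v + block n r v)"
    proof (rule continuous_on_coordinatewise_then_product)
      fix v
      have "continuous_on {0..1} (\<lambda>t. g t v)"
        by (rule continuous_on_product_then_coordinatewise, rule g)
      then have "continuous_on {of_int n..of_int n + 1} (\<lambda>t. g (t - of_int n) v)"
        by (rule continuous_on_compose2) (auto intro!: continuous_intros)
      then show "continuous_on {of_int n..of_int n + 1} (\<lambda>t. g (t - of_int n) v + block n r v)"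
        by (intro continuous_on_add continuous_on_const)
    qed
    then show "continuous_on {of_int n..of_int n + 1} p"
    proof (rule continuous_on_eq)
      fix t :: real assume t: "t \<in> {of_int n..of_int n + 1}"
      show "(\<lambda>v. g (t - of_int n) v + block n r v) = p t"
      \<comment> \<open>At the right end the formula of the next interval applies; both agree there
        because \<open>g 1 = block 1 r\<close> and \<open>g 0\<close> vanishes.\<close>
      proof (cases "t = of_int n + 1")
        case True
        then show ?thesis by (intro ext) (simp add: p_def g block_def algebra_simps)
      next
        case False
        then have "\<lfloor>t\<rfloor> = n" using t by (intro floor_unique) auto
        then show ?thesis by (simp add: p_def frac_def)
      qed
    qed
  qed
  have "p t \<in> heights0" for t
    using path_component_along_line[OF cont p_heights, of t] heights0_step[OF zero_heights0] by (simp add: p0)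
  then show thesis using that cont p0 p1 by blast
qed

lemma rigid_path:
  assumes "r \<notin> free_reps"
  obtains p :: "real \<Rightarrow> 'a \<Rightarrow> real" where "continuous_on UNIV p" "\<And>t. p t \<in> heights0"
    "\<And>b v. b \<in> heights0 \<Longrightarrow> v \<in> V \<Longrightarrow> rep v = r \<Longrightarrow> p 0 v \<le> b v \<and> b v \<le> p 1 v"
proof -
  obtain lo hi where lh: "lo \<in> heights0" "hi \<in> heights0"
    "\<And>b v. b \<in> heights0 \<Longrightarrow> v \<in> V \<Longrightarrow> rep v = r \<Longrightarrow> lo v \<le> b v \<and> b v \<le> hi v"
    using rigid_extremes[OF assms] by metis
  obtain g :: "real \<Rightarrow> 'a \<Rightarrow> real" where g: "continuous_on {0..1} g" "\<And>t. t \<in> {0..1} \<Longrightarrow> g t \<in> heights"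
      "g 0 = lo" "g 1 = hi"
    using path_componentE[OF heights0_path[OF lh(1,2)]] by metis
  \<comment> \<open>Clamping the time extends the path to the whole line, so that free and rigid
    components have paths of the same type.\<close>
  define p where "p t = g (max 0 (min 1 t))" for t
  have cont: "continuous_on UNIV p"
    unfolding p_def by (intro continuous_on_compose2[OF g(1)] continuous_intros) auto
  have p0: "p 0 = lo" "p 1 = hi" by (simp_all add: p_def g)
  have p_heights: "p t \<in> heights" for t
    unfolding p_def by (rule g) simp
  have "p t \<in> heights0" for t
    using path_component_along_line[OF cont p_heights, of t] heights0_step[OF lh(1)] by (simp add: p0)
  then show thesis using that cont p0 lh(3) by simp
qed

lemma path_family:
  obtains p :: "'a \<Rightarrow> real \<Rightarrow> 'a \<Rightarrow> real" where
    "\<And>r v. continuous_on UNIV (\<lambda>t. p r t v)" "\<And>r t. p r t \<in> heights0"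
    "\<And>r t v. r \<in> free_reps \<Longrightarrow> v \<in> V \<Longrightarrow> rep v = r \<Longrightarrow> p r (t + 1) v = p r t v + of_int N"
    "\<And>r v. r \<in> free_reps \<Longrightarrow> p r 0 v = 0"
    "\<And>r b v. r \<notin> free_reps \<Longrightarrow> b \<in> heights0 \<Longrightarrow> v \<in> V \<Longrightarrow> rep v = r \<Longrightarrow> p r 0 v \<le> b v \<and> b v \<le> p r 1 v"
proof -
  have "\<forall>r. \<exists>p :: real \<Rightarrow> 'a \<Rightarrow> real. continuous_on UNIV p \<and> (\<forall>t. p t \<in> heights0) \<and>
     (r \<in> free_reps \<longrightarrow> (\<forall>t. p (t + 1) = (\<lambda>v. p t v + block 1 r v)) \<and> p 0 = (\<lambda>_. 0)) \<and>
     (r \<notin> free_reps \<longrightarrow> (\<forall>b v. b \<in> heights0 \<longrightarrow> v \<in> V \<longrightarrow> rep v = r \<longrightarrow> p 0 v \<le> b v \<and> b v \<le> p 1 v))"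
  proof
    fix r
    show "\<exists>p :: real \<Rightarrow> 'a \<Rightarrow> real. continuous_on UNIV p \<and> (\<forall>t. p t \<in> heights0) \<and>
     (r \<in> free_reps \<longrightarrow> (\<forall>t. p (t + 1) = (\<lambda>v. p t v + block 1 r v)) \<and> p 0 = (\<lambda>_. 0)) \<and>
     (r \<notin> free_reps \<longrightarrow> (\<forall>b v. b \<in> heights0 \<longrightarrow> v \<in> V \<longrightarrow> rep v = r \<longrightarrow> p 0 v \<le> b v \<and> b v \<le> p 1 v))"
    proof (cases "r \<in> free_reps")
      case True
      obtain p :: "real \<Rightarrow> 'a \<Rightarrow> real" where "continuous_on UNIV p" "\<And>t. p t \<in> heights0"
        "\<And>t. p (t + 1) = (\<lambda>v. p t v + block 1 r v)" "p 0 = (\<lambda>_. 0)"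
        by (rule free_path[OF True], rule that)
      with True show ?thesis by (intro exI[of _ p]) simp
    next
      case False
      obtain p :: "real \<Rightarrow> 'a \<Rightarrow> real" where "continuous_on UNIV p" "\<And>t. p t \<in> heights0"
        "\<And>b v. b \<in> heights0 \<Longrightarrow> v \<in> V \<Longrightarrow> rep v = r \<Longrightarrow> p 0 v \<le> b v \<and> b v \<le> p 1 v"
        by (rule rigid_path[OF False], rule that)
      with False show ?thesis by (intro exI[of _ p]) simp
    qed
  qed
  from choice[OF this] obtain p :: "'a \<Rightarrow> real \<Rightarrow> 'a \<Rightarrow> real" where p: "\<forall>r. continuous_on UNIV (p r) \<and> (\<forall>t. p r t \<in> heights0) \<and>
     (r \<in> free_reps \<longrightarrow> (\<forall>t. p r (t + 1) = (\<lambda>v. p r t v + block 1 r v)) \<and> p r 0 = (\<lambda>_. 0)) \<and>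
     (r \<notin> free_reps \<longrightarrow> (\<forall>b v. b \<in> heights0 \<longrightarrow> v \<in> V \<longrightarrow> rep v = r \<longrightarrow> p r 0 v \<le> b v \<and> b v \<le> p r 1 v))"
    by (rule exE)
  show thesis
  proof (rule that[of p])
    show "continuous_on UNIV (\<lambda>t. p r t v)" for r v
      by (rule continuous_on_product_then_coordinatewise) (use p in simp)
  qed (use p in \<open>auto simp: block_def\<close>)
qed

definition shift :: "('a \<Rightarrow> int) \<Rightarrow> 'a \<Rightarrow> real" where
  "shift n = (\<lambda>v. if v \<in> V then of_int (N * n (rep v)) else 0)"

text \<open>At integer times the periodic path of a free component is constant on it, equal to a
  multiple of \<open>N\<close>. Gluing such values reaches \<open>shift n\<close> from 0, and the
  translation then carries all of \<open>heights0\<close> along.\<close>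

lemma heights0_shift:
  assumes "b \<in> heights0" "\<And>r. r \<notin> free_reps \<Longrightarrow> n r = 0"
  shows "(\<lambda>v. b v + shift n v) \<in> heights0"
proof -
  obtain p :: "'a \<Rightarrow> real \<Rightarrow> 'a \<Rightarrow> real" where p: "\<And>r t. p r t \<in> heights0"
    "\<And>r t v. r \<in> free_reps \<Longrightarrow> v \<in> V \<Longrightarrow> rep v = r \<Longrightarrow> p r (t + 1) v = p r t v + of_int N"
    "\<And>r v. r \<in> free_reps \<Longrightarrow> p r 0 v = 0"
    by (rule path_family, rule that)
  have step: "p r (of_int n) v = of_int (N * n)" if "r \<in> free_reps" "v \<in> V" "rep v = r" for r v n
  proof (induction n rule: int_induct[where k = 0])
    case base
    then show ?case using p(3)[OF that(1)] by simp
  next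
    case (step1 i)
    then show ?case using p(2)[OF that, of "of_int i"] by (simp add: algebra_simps)
  next
    case (step2 i)
    then show ?case using p(2)[OF that, of "of_int (i - 1)"] by (simp add: algebra_simps)
  qed
  have "(\<lambda>v. (if rep v \<in> free_reps then p (rep v) (of_int (n (rep v))) else (\<lambda>_. 0)) v) \<in> heights0"
    by (rule heights0_glue[of "\<lambda>r. if r \<in> free_reps then p r (of_int (n r)) else (\<lambda>_. 0)"])
      (simp add: p(1) zero_heights0)
  moreover have "(\<lambda>v. (if rep v \<in> free_reps then p (rep v) (of_int (n (rep v))) else (\<lambda>_. 0)) v) = shift n"
  proof
    fix v
    show "(if rep v \<in> free_reps then p (rep v) (of_int (n (rep v))) else (\<lambda>_. 0)) v = shift n v"
      using step assms(2)[of "rep v"] heights_outside[OF heights0_heights[OF p(1)], of v]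
      by (simp add: shift_def)
  qed
  ultimately have shift: "shift n \<in> heights0" by simp
  define m where "m v = (if v \<in> V then N * n (rep v) else 0)" for v
  have eq: "of_int (m v) = shift n v" for v by (simp add: m_def shift_def)
  have "(\<lambda>v. b v + of_int (m v)) \<in> heights0"
  proof (rule heights0_translate_path[OF zero_heights0 _ assms(1)])
    show "(\<lambda>v. 0 + of_int (m v)) \<in> heights0" using shift by (simp add: eq)
    show "m v = m u" if "(v, u) \<in> D" for v u
      using rep_arc[OF that] D_V[OF that] by (simp add: m_def)
  qed (simp add: m_def)
  then show ?thesis by (simp add: eq)
qed

text \<open>A translation of a single component that maps one point of \<^term>\<open>heights0\<close> into
  \<^term>\<open>heights0\<close> translates the path back to the origin, hence that component is free.\<close>

lemma translate_imp_free:
  assumes "b \<in> heights0" "b' \<in> heights0" "r \<in> rep ` V" "m \<noteq> 0"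
    and "\<And>v. v \<in> V \<Longrightarrow> rep v = r \<Longrightarrow> b v = b' v + of_int (N * m)"
  shows "r \<in> free_reps"
proof -
  define n where "n v = (if v \<in> V \<and> rep v = r then N * m else 0)" for v
  have eq: "(\<lambda>v. (if rep v = r then b' v else 0) + of_int (n v)) = (\<lambda>v. if rep v = r then b v else 0)"
  proof
    fix v
    show "(if rep v = r then b' v else 0) + of_int (n v) = (if rep v = r then b v else 0)"
      using assms(5)[of v] heights_outside[OF heights0_heights[OF assms(1)], of v]
        heights_outside[OF heights0_heights[OF assms(2)], of v]
      by (simp add: n_def)
  qed
  have "(\<lambda>v. 0 + of_int (n v)) \<in> heights0"
  proof (rule heights0_translate_path[OF heights0_restrict[OF assms(2)] _ zero_heights0])
    show "(\<lambda>v. (if rep v = r then b' v else 0) + of_int (n v)) \<in> heights0"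
      unfolding eq by (rule heights0_restrict[OF assms(1)])
    show "n v = n u" if "(v, u) \<in> D" for v u
      using rep_arc[OF that] D_V[OF that] by (simp add: n_def)
  qed (simp add: n_def)
  moreover have "(\<lambda>v. 0 + of_int (n v)) = block m r"
    by (rule ext) (simp add: n_def block_def)
  ultimately show ?thesis
    using block_free_if_block assms(3,4) by (simp add: free_reps_def)
qed

section \<open>Compact sets of height functions\<close>

lemma compact_box: "compact {b :: 'a \<Rightarrow> real. \<forall>v. f v \<le> b v \<and> b v \<le> g v}"
proof -
  have "compactin (product_topology (\<lambda>_. euclidean) UNIV) (PiE UNIV (\<lambda>v. {f v..g v}))"
    by (subst compactin_PiE) auto
  moreover have "PiE UNIV (\<lambda>v. {f v..g v}) = {b. \<forall>v. f v \<le> b v \<and> b v \<le> g v}"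
    by (auto simp: PiE_UNIV_domain)
  ultimately show ?thesis by (simp add: euclidean_product_topology)
qed

text \<open>Bounded height functions meet only finitely many closed cells. Each cell is a compact
  box and stays in \<open>heights0\<close>, so their union serves as \<open>K\<close>, although it
  may exceed the bound \<open>B\<close> a little.\<close>

lemma compact_core:
  obtains K where "compact K" "K \<subseteq> heights0" "\<And>b. b \<in> heights0 \<Longrightarrow> \<forall>v\<in>V. \<bar>b v\<bar> \<le> B \<Longrightarrow> b \<in> K"
proof -
  \<comment> \<open>Rounding moves a value by less than 1, hence the extra 1 in the bound for the
    corners.\<close>
  let ?S = "{f :: 'a \<Rightarrow> real. (\<forall>v. f v \<in> \<int>) \<and> (\<forall>v. v \<notin> V \<longrightarrow> f v = 0) \<and> (\<forall>v. \<bar>f v\<bar> \<le> \<bar>B\<bar> + 1)}"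
  let ?cell = "\<lambda>b :: 'a \<Rightarrow> real. ((\<lambda>v. of_int \<lfloor>b v\<rfloor> :: real), (\<lambda>v. of_int \<lceil>b v\<rceil> :: real))"
  let ?T = "?cell ` heights0 \<inter> (?S \<times> ?S)"
  let ?box = "\<lambda>(f :: 'a \<Rightarrow> real, g :: 'a \<Rightarrow> real). {b :: 'a \<Rightarrow> real. \<forall>v. f v \<le> b v \<and> b v \<le> g v}"
  have "finite ?T" using finite_bounded_int[of "\<bar>B\<bar> + 1"] by blast
  show thesis
  proof (rule that[of "\<Union> (?box ` ?T)"])
    show "compact (\<Union> (?box ` ?T))"
      using \<open>finite ?T\<close> compact_box by (intro compact_Union) auto
    show "\<Union> (?box ` ?T) \<subseteq> heights0"
      using heights0_refine by force
    fix b assume b: "b \<in> heights0" "\<forall>v\<in>V. \<bar>b v\<bar> \<le> B"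
    have "b v = 0" if "v \<notin> V" for v using heights_outside[OF heights0_heights[OF b(1)] that] .
    moreover from this have bB: "\<bar>b v\<bar> \<le> \<bar>B\<bar>" for v using b(2) by (cases "v \<in> V") auto
    have "\<bar>of_int \<lfloor>b v\<rfloor>\<bar> \<le> \<bar>B\<bar> + 1" "\<bar>of_int \<lceil>b v\<rceil>\<bar> \<le> \<bar>B\<bar> + 1" for v
      using bB[of v] by linarith+
    ultimately have "?cell b \<in> ?T" using b(1) by auto
    moreover have "b \<in> ?box (?cell b)" by auto
    ultimately show "b \<in> \<Union> (?box ` ?T)" by blast
  qed
qed

end

section \<open>Dividing height functions by translations\<close>

definition torus_point :: "nat \<Rightarrow> (nat \<Rightarrow> real) \<Rightarrow> nat \<Rightarrow> complex" where
  "torus_point d t = (\<lambda>i\<in>{..<d}. cis (2 * pi * t i))"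

definition unit_cube :: "nat \<Rightarrow> (nat \<Rightarrow> real) topology" where
  "unit_cube d = product_topology (\<lambda>_. top_of_set {0..1}) {..<d}"

lemma topspace_unit_cube: "topspace (unit_cube d) = (\<Pi>\<^sub>E i\<in>{..<d}. {0..1})"
  by (simp add: unit_cube_def)

lemma compact_space_unit_cube: "compact_space (unit_cube d)"
  unfolding unit_cube_def by (simp add: compact_space_product_topology compact_space_subtopology)

lemma continuous_map_unit_cube_coordinate:
  "i < d \<Longrightarrow> continuous_map (unit_cube d) euclideanreal (\<lambda>t. t i)"
  unfolding unit_cube_def
  using continuous_map_product_coordinates[of i "{..<d}" "\<lambda>_. top_of_set {0..1::real}"]
  by (simp add: continuous_map_in_subtopology)

lemma Hausdorff_circle_power: "Hausdorff_space (circle_power d)"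
  unfolding circle_power_def by (simp add: Hausdorff_space_product_topology Hausdorff_space_subtopology)

lemma continuous_map_torus_point:
  assumes "\<And>i. i < d \<Longrightarrow> continuous_map A euclideanreal (\<lambda>x. T x i)"
  shows "continuous_map A (circle_power d) (\<lambda>x. torus_point d (T x))"
  unfolding circle_power_def
proof (subst continuous_map_componentwise, intro conjI ballI)
  fix i assume i: "i \<in> {..<d}"
  have "continuous_map A euclidean (cis \<circ> (\<lambda>y. 2 * pi * y) \<circ> (\<lambda>x. T x i))"
    by (rule continuous_map_compose[OF assms]) (use i in \<open>auto intro!: continuous_intros\<close>)
  then show "continuous_map A (top_of_set (sphere 0 1)) (\<lambda>x. torus_point d (T x) i)"
    using i by (auto simp: continuous_map_in_subtopology torus_point_def o_def)
qed (auto simp: torus_point_def)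

lemma torus_point_eq_iff:
  "torus_point d t = torus_point d t' \<longleftrightarrow> (\<exists>m::nat \<Rightarrow> int. \<forall>i<d. t i = t' i + of_int (m i))"
proof -
  have *: "cis (2 * pi * x) = cis (2 * pi * y) \<longleftrightarrow> (\<exists>m::int. x = y + of_int m)" for x y
  proof -
    have "cis (2 * pi * x) = cis (2 * pi * y) \<longleftrightarrow> (\<exists>m::int. 2 * pi * x = 2 * pi * y + 2 * pi * of_int m)"
      using sin_cos_eq_iff[of "2 * pi * x" "2 * pi * y"] by (auto simp: complex_eq_iff)
    also have "\<dots> \<longleftrightarrow> (\<exists>m::int. x = y + of_int m)"
      by (simp flip: distrib_left)
    finally show ?thesis .
  qed
  have "torus_point d t = torus_point d t' \<longleftrightarrow> (\<forall>i<d. cis (2 * pi * t i) = cis (2 * pi * t' i))"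
    by (auto simp: torus_point_def fun_eq_iff)
  then show ?thesis unfolding * by metis
qed

lemma torus_point_in: "torus_point d t \<in> topspace (circle_power d)"
  by (auto simp: torus_point_def circle_power_def)

lemma torus_point_frac: "torus_point d (\<lambda>i\<in>{..<d}. frac (t i)) = torus_point d t"
  unfolding torus_point_eq_iff
  by (rule exI[of _ "\<lambda>i. - \<lfloor>t i\<rfloor>"]) (simp add: frac_def)

lemma frac_in_unit_cube: "(\<lambda>i\<in>{..<d}. frac (t i)) \<in> topspace (unit_cube d)"
  by (auto simp: topspace_unit_cube less_imp_le[OF frac_lt_1])

lemma torus_point_surj: "torus_point d ` topspace (unit_cube d) = topspace (circle_power d)"
proof
  show "torus_point d ` topspace (unit_cube d) \<subseteq> topspace (circle_power d)"
    using torus_point_in by blast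
  show "topspace (circle_power d) \<subseteq> torus_point d ` topspace (unit_cube d)"
  proof
    fix z assume z: "z \<in> topspace (circle_power d)"
    have "z = torus_point d (\<lambda>i. Arg (z i) / (2 * pi))"
    proof
      fix i
      show "z i = torus_point d (\<lambda>i. Arg (z i) / (2 * pi)) i"
      proof (cases "i < d")
        case True
        then have "norm (z i) = 1" using z by (auto simp: circle_power_def PiE_iff)
        then have "cis (Arg (z i)) = z i"
          by (metis cis_Arg norm_zero sgn_eq zero_neq_one of_real_1 div_by_1)
        then show ?thesis using True by (simp add: torus_point_def)
      next
        case False
        have "z \<in> (\<Pi>\<^sub>E i\<in>{..<d}. sphere 0 1)" using z by (simp add: circle_power_def)
        from PiE_arb[OF this, of i] have "z i = undefined" using False by simp
        then show ?thesis using False by (simp add: torus_point_def)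
      qed
    qed
    then show "z \<in> torus_point d ` topspace (unit_cube d)"
      using torus_point_frac frac_in_unit_cube by (metis image_eqI)
  qed
qed

context height_space begin

lemma shift_rep: "v \<in> V \<Longrightarrow> shift n v = of_int N * of_int (n (rep v))"
  by (simp add: shift_def)

text \<open>The map \<open>F\<close> reads the heights at the representatives of the free components
  modulo \<open>N\<close>, and \<open>G\<close> places each free component on its chosen path at the
  given time. Maxima with the paths deform the identity of \<open>P\<close> to
  \<open>G \<circ> F\<close>; linear interpolation between circle maps of degree one deforms the
  identity of the torus to \<open>F \<circ> G\<close>.\<close>

theorem homotopy_equivalent_circle_power:
  assumes Haus: "Hausdorff_space P" and cont_q: "continuous_map (top_of_set heights0) P q"
    and surj: "q ` heights0 = topspace P"
    and fib: "\<And>b b'. \<lbrakk>b \<in> heights0; b' \<in> heights0\<rbrakk> \<Longrightarrow> q b = q b' \<longleftrightarrow> (\<exists>n. \<forall>v. b v = b' v + shift n v)"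
  shows "P homotopy_equivalent_space circle_power (card free_reps)"
proof -
  define d where "d = card free_reps"
  obtain e where e: "bij_betw e {..<d} free_reps"
    using ex_bij_betw_nat_finite[OF finite_free_reps] by (auto simp: d_def atLeast0LessThan)
  define idx where "idx = inv_into {..<d} e"
  have idx: "idx r < d" "e (idx r) = r" if "r \<in> free_reps" for r
    using e that by (auto simp: idx_def bij_betw_def f_inv_into_f inv_into_into[of _ e "{..<d}", simplified])
  have e_free: "e i \<in> free_reps" and e_V: "e i \<in> V" and rep_e: "rep (e i) = e i" and idx_e: "idx (e i) = i" if "i < d" for i
    using e that free_reps_V rep_free_reps by (auto simp: idx_def bij_betw_def)
  have N1: "of_int N \<ge> (1::real)" using N_pos by simp

  obtain p :: "'a \<Rightarrow> real \<Rightarrow> 'a \<Rightarrow> real" where cont_p: "\<And>r v. continuous_on UNIV (\<lambda>t. p r t v)"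
    and p0: "\<And>r t. p r t \<in> heights0"
    and p_period: "\<And>r t v. r \<in> free_reps \<Longrightarrow> v \<in> V \<Longrightarrow> rep v = r \<Longrightarrow> p r (t + 1) v = p r t v + of_int N"
    and p_rigid: "\<And>r b v. r \<notin> free_reps \<Longrightarrow> b \<in> heights0 \<Longrightarrow> v \<in> V \<Longrightarrow> rep v = r \<Longrightarrow> p r 0 v \<le> b v \<and> b v \<le> p r 1 v"
    by (rule path_family, rule that)
  have p_add: "p r (t + of_int m) v = p r t v + of_int N * of_int m" if "r \<in> free_reps" "v \<in> V" "rep v = r" for r t v m
  proof (induction m rule: int_induct[where k = 0])
    case base
    then show ?case by simp
  next
    case (step1 i)
    then show ?case using p_period[OF that, of "t + of_int i"] by (simp add: algebra_simps)
  next
    case (step2 i)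
    then show ?case using p_period[OF that, of "t + of_int (i - 1)"] by (simp add: algebra_simps)
  qed
  have p_out: "p r t v = 0" if "v \<notin> V" for r t v
    using heights_outside[OF heights0_heights[OF p0] that] .

  obtain B :: real where B: "B \<ge> 0" 
    "\<And>b v u. b \<in> heights \<Longrightarrow> v \<in> V \<Longrightarrow> u \<in> V \<Longrightarrow> rep v = rep u \<Longrightarrow> \<bar>b v - b u\<bar> \<le> B"
    "\<And>b v. b \<in> heights0 \<Longrightarrow> v \<in> V \<Longrightarrow> rep v \<notin> free_reps \<Longrightarrow> \<bar>b v\<bar> \<le> B"
    by (rule rigid_bound, rule that)

  obtain a where a: "a \<ge> 0" "\<And>r t. r \<in> free_reps \<Longrightarrow> t \<in> {0..1} \<Longrightarrow> \<bar>p r t r\<bar> \<le> a"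
  proof -
    have "compact (\<Union>r\<in>free_reps. (\<lambda>t. p r t r) ` {0..1})"
      using finite_free_reps
      by (intro compact_UN compact_continuous_image continuous_on_subset[OF cont_p]) auto
    from compact_imp_bounded[OF this]
    obtain a where a: "\<forall>x\<in>\<Union>r\<in>free_reps. (\<lambda>t. p r t r) ` {0..1}. norm x \<le> a"
      unfolding bounded_iff by (rule exE)
    show thesis
    proof (rule that[of "max a 0"])
      fix r t assume "r \<in> free_reps" "t \<in> {0..1::real}"
      then have "norm (p r t r) \<le> a" by (intro bspec[OF a]) blast
      then show "\<bar>p r t r\<bar> \<le> max a 0" by simp
    qed simp
  qed
  \<comment> \<open>Periodicity keeps the path at bounded distance from the linear function
    \<open>N * t\<close>: \<open>a\<close> bounds it at \<open>r\<close> during one period,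
    \<open>N\<close> accounts for the fractional part of the time, and \<open>B\<close> for passing
    from \<open>r\<close> to \<open>v\<close>.\<close>
  have p_near: "\<bar>p r t v - of_int N * t\<bar> \<le> a + of_int N + B" if "r \<in> free_reps" "v \<in> V" "rep v = r" for r t v
  proof -
    have "rep r = r" "r \<in> V" using that(1) free_reps_V rep_free_reps by auto
    then have "\<bar>p r t v - p r t r\<bar> \<le> B" using B(2)[OF heights0_heights[OF p0] that(2)] that(3) by simp
    moreover have "p r t r = p r (frac t) r + of_int N * of_int \<lfloor>t\<rfloor>"
      using p_add[OF that(1) \<open>r \<in> V\<close> \<open>rep r = r\<close>, of "frac t" "\<lfloor>t\<rfloor>"] by (simp add: frac_def)
    moreover have "\<bar>p r (frac t) r\<bar> \<le> a" using a(2)[OF that(1)] by (simp add: less_imp_le[OF frac_lt_1])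
    moreover have "of_int N * t = of_int N * frac t + of_int N * of_int \<lfloor>t\<rfloor>"
      by (simp add: frac_def algebra_simps)
    moreover have "0 \<le> of_int N * frac t" "of_int N * frac t \<le> of_int N"
      using N1 mult_left_mono[of "frac t" 1 "of_int N"] less_imp_le[OF frac_lt_1] by auto
    ultimately show ?thesis by linarith
  qed
  \<comment> \<open>A time shift by \<open>C\<close> has to push the path entirely past
    \<open>b\<close>. One \<open>B\<close> comes from \<open>p_near\<close>, the other from
    comparing \<open>b v\<close> with the height at the representative. \<open>C\<close> is an
    integer so that the shift is invisible on the torus.\<close>
  define C where "C = \<lceil>a + of_int N + 2 * B\<rceil>"
  have C: "a + of_int N + 2 * B \<le> of_int N * of_int C"
  proof -
    have "a + of_int N + 2 * B \<le> of_int C" by (simp add: C_def)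
    moreover have "of_int C \<ge> (0::real)" using calculation a(1) B(1) N1 by linarith
    then have "1 * of_int C \<le> of_int N * (of_int C :: real)" using N1 by (intro mult_right_mono)
    ultimately show ?thesis by simp
  qed

  \<comment> \<open>Rigid components are parked at time 1, the upper end of their path, since this
    is where the maxima will leave them.\<close>
  define L where "L t = (\<lambda>v. p (rep v) (if rep v \<in> free_reps then t (idx (rep v)) else 1) v)" for t
  have L0: "L t \<in> heights0" for t
    unfolding L_def by (rule heights0_glue[of "\<lambda>r. p r (if r \<in> free_reps then t (idx r) else 1)"]) (rule p0)
  have L_e: "L t (e i) = p (e i) (t i) (e i)" if "i < d" for t i
    using that e_free rep_e idx_e by (simp add: L_def)
  have qL: "q (L t) = q (L t')" if "torus_point d t = torus_point d t'" for t t'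
  proof -
    obtain m where m: "\<forall>i<d. t i = t' i + of_int (m i)" using \<open>torus_point d t = torus_point d t'\<close> torus_point_eq_iff by blast
    have "L t v = L t' v + shift (\<lambda>r. if r \<in> free_reps then m (idx r) else 0) v" for v
    proof (cases "v \<in> V")
      case True
      then show ?thesis using m idx(1) p_add by (simp add: L_def shift_rep)
    qed (simp add: L_def p_out shift_def)
    then show ?thesis using fib[OF L0 L0] by blast
  qed

  obtain G where G: "continuous_map (circle_power d) P G"
    and G_cube: "\<And>t. t \<in> topspace (unit_cube d) \<Longrightarrow> G (torus_point d t) = q (L t)"
  proof (rule compact_quotient_factor[OF compact_space_unit_cube Hausdorff_circle_power _ torus_point_surj])
    show "continuous_map (unit_cube d) (circle_power d) (torus_point d)"
      by (intro continuous_map_torus_point continuous_map_unit_cube_coordinate)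
    have "continuous_map (unit_cube d) (top_of_set heights0) L"
      unfolding continuous_map_in_subtopology euclidean_product_topology[symmetric] continuous_map_componentwise_UNIV
    proof (intro conjI allI)
      fix v
      show "continuous_map (unit_cube d) euclideanreal (\<lambda>t. L t v)"
      proof (cases "rep v \<in> free_reps")
        case True
        have "continuous_map (unit_cube d) euclideanreal ((\<lambda>t. p (rep v) t v) \<circ> (\<lambda>t. t (idx (rep v))))"
          by (rule continuous_map_compose[OF continuous_map_unit_cube_coordinate]) (use cont_p idx(1)[OF True] in auto)
        then show ?thesis using True by (simp add: L_def o_def)
      qed (simp add: L_def)
    qed (use L0 in auto)
    then have "continuous_map (unit_cube d) P (q \<circ> L)"
      using cont_q by (rule continuous_map_compose)
    then show "continuous_map (unit_cube d) P (\<lambda>t. q (L t))" by (simp add: o_def)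
  qed (rule qL, assumption, rule that)
  have G_torus: "G (torus_point d t) = q (L t)" for t
    using G_cube[OF frac_in_unit_cube[of t d]] qL[OF torus_point_frac[of d t]] torus_point_frac[of d t] by simp

  define coords where "coords b = (\<lambda>i. b (e i) / of_int N)" for b :: "'a \<Rightarrow> real"
  have coords_shift: "coords b i = coords b' i + of_int (n (e i))" if "\<forall>v. b v = b' v + shift n v" "i < d" for b b' n i
    using that N_pos e_V rep_e by (simp add: coords_def shift_rep field_simps)
  have torus_coords: "torus_point d (coords b) = torus_point d (coords b')"
    if bb: "b \<in> heights0" "b' \<in> heights0" "q b = q b'" for b b'
  proof -
    obtain n where "\<forall>v. b v = b' v + shift n v" using fib[OF bb(1,2)] bb(3) by auto
    then show ?thesis
      unfolding torus_point_eq_iff using coords_shift[of b b' n] by (intro exI[of _ "\<lambda>i. n (e i)"]) simp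
  qed

  \<comment> \<open>The radius suffices for one function in each class: a translation brings the
    representative of each free component into the interval from 0 to \<open>N\<close>, the other
    vertices of the component follow within \<open>B\<close>, and rigid components are bounded by
    \<open>B\<close> anyway.\<close>
  obtain K where K: "compact K" "K \<subseteq> heights0" "\<And>b. b \<in> heights0 \<Longrightarrow> \<forall>v\<in>V. \<bar>b v\<bar> \<le> B + of_int N \<Longrightarrow> b \<in> K"
    by (rule compact_core[of "B + of_int N"], rule that)
  have qK: "q ` K = topspace P"
  proof
    show "q ` K \<subseteq> topspace P" using K(2) surj by blast
    show "topspace P \<subseteq> q ` K"
    proof
      fix x assume "x \<in> topspace P"
      then obtain b where b: "b \<in> heights0" "x = q b" using surj by blast
      define n where "n r = (if r \<in> free_reps then - \<lfloor>b r / of_int N\<rfloor> else 0)" for r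
      define b' where "b' = (\<lambda>v. b v + shift n v)"
      have b': "b' \<in> heights0" unfolding b'_def by (rule heights0_shift[OF b(1)]) (simp add: n_def)
      have "b' \<in> K"
      proof (rule K(3)[OF b'], rule ballI)
        fix v assume v: "v \<in> V"
        show "\<bar>b' v\<bar> \<le> B + of_int N"
        proof (cases "rep v \<in> free_reps")
          case True
          have "b' (rep v) = of_int N * frac (b (rep v) / of_int N)"
            using True v N_pos by (simp add: b'_def shift_rep n_def rep_V frac_def field_simps)
          then have "0 \<le> b' (rep v)" "b' (rep v) \<le> of_int N"
            using N1 mult_left_mono[of "frac (b (rep v) / of_int N)" 1 "of_int N"] less_imp_le[OF frac_lt_1] by auto
          then show ?thesis using B(2)[OF heights0_heights[OF b'] v rep_V[OF v]] by simp
        next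
          case False
          then show ?thesis using B(3)[OF b' v] N1 by simp
        qed
      qed
      moreover have "q b' = q b" using fib[OF b' b(1)] by (auto simp: b'_def)
      ultimately show "x \<in> q ` K" using b(2) by (metis image_eqI)
    qed
  qed
  have cont_qK: "continuous_map (top_of_set K) P q"
    using cont_q K(2) continuous_map_from_subtopology_mono by blast
  have compact_K: "compact_space (top_of_set K)"
    using K(1) by (simp add: compact_space_subtopology)

  obtain F where F: "continuous_map P (circle_power d) F"
    and F_K: "\<And>b. b \<in> topspace (top_of_set K) \<Longrightarrow> F (q b) = torus_point d (coords b)"
  proof (rule compact_quotient_factor[OF compact_K Haus cont_qK, of "circle_power d" "\<lambda>b. torus_point d (coords b)"])
    show "continuous_map (top_of_set K) (circle_power d) (\<lambda>b. torus_point d (coords b))"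
      by (rule continuous_map_torus_point) (use N_pos in \<open>auto simp: coords_def intro!: continuous_intros\<close>)
    show "q ` topspace (top_of_set K) = topspace P" using qK by simp
    show "torus_point d (coords b) = torus_point d (coords b')"
      if "b \<in> topspace (top_of_set K)" "b' \<in> topspace (top_of_set K)" "q b = q b'" for b b'
      using torus_coords[of b b'] that K(2) by auto
  qed (rule that)
  have F_q: "F (q b) = torus_point d (coords b)" if b: "b \<in> heights0" for b
  proof -
    have "q b \<in> q ` K" using qK surj b by blast
    then obtain b' where "b' \<in> K" "q b = q b'" by auto
    then show ?thesis using F_K torus_coords[OF b, of b'] K(2) by auto
  qed

  \<comment> \<open>On a free component the time is tied to the height of \<open>b\<close> at the
    representative, so raising \<open>b\<close> by a multiple of \<open>N\<close> advances the time
    by that multiple. As \<open>s\<close> runs from 0 to 1 the path moves from below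
    \<open>b\<close> to above it.\<close>
  define \<tau> where "\<tau> s b r = (if r \<in> free_reps then b r / of_int N + (2 * s - 1) * of_int C else s)" for s :: real and b :: "'a \<Rightarrow> real" and r
  define M where "M s b = (\<lambda>v. max (b v) (p (rep v) (\<tau> s b (rep v)) v))" for s b
  have M0: "M s b \<in> heights0" if "b \<in> heights0" for s b
    unfolding M_def by (intro heights0_max[OF that] heights0_glue[of "\<lambda>r. p r (\<tau> s b r)"] p0)
  have M_start: "M 0 b = b" if b: "b \<in> heights0" for b
  proof
    fix v
    show "M 0 b v = b v"
    proof (cases "v \<in> V")
      case v: True
      have "p (rep v) (\<tau> 0 b (rep v)) v \<le> b v"
      proof (cases "rep v \<in> free_reps")
        case True
        have "of_int N * \<tau> 0 b (rep v) = b (rep v) - of_int N * of_int C"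
          using True N_pos by (simp add: \<tau>_def field_simps)
        then show ?thesis
          using p_near[OF True v refl, of "\<tau> 0 b (rep v)"] C B(2)[OF heights0_heights[OF b] v rep_V[OF v]] by simp
      next
        case False
        then show ?thesis using p_rigid[OF False b v refl] by (simp add: \<tau>_def)
      qed
      then show ?thesis by (simp add: M_def)
    qed (simp add: M_def p_out heights_outside[OF heights0_heights[OF b]])
  qed
  \<comment> \<open>Everything now lies on the chosen paths, so only the torus coordinates of
    \<open>b\<close> are left.\<close>
  have M_end: "M 1 b = L (\<lambda>i. coords b i + of_int C)" if b: "b \<in> heights0" for b
  proof
    fix v
    show "M 1 b v = L (\<lambda>i. coords b i + of_int C) v"
    proof (cases "v \<in> V")
      case v: True
      have "b v \<le> p (rep v) (\<tau> 1 b (rep v)) v"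
      proof (cases "rep v \<in> free_reps")
        case True
        have "of_int N * \<tau> 1 b (rep v) = b (rep v) + of_int N * of_int C"
          using True N_pos by (simp add: \<tau>_def field_simps)
        then show ?thesis
          using p_near[OF True v refl, of "\<tau> 1 b (rep v)"] C B(2)[OF heights0_heights[OF b] v rep_V[OF v]] by simp
      next
        case False
        then show ?thesis using p_rigid[OF False b v refl] by (simp add: \<tau>_def)
      qed
      then have "M 1 b v = p (rep v) (\<tau> 1 b (rep v)) v" by (simp add: M_def)
      also have "\<dots> = L (\<lambda>i. coords b i + of_int C) v"
        using idx by (simp add: L_def \<tau>_def coords_def)
      finally show ?thesis .
    qed (simp add: M_def L_def p_out heights_outside[OF heights0_heights[OF b]])
  qed
  \<comment> \<open>The deformation descends to classes: both arguments of the maximum are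
    translated by the same amount. On a rigid component that amount is 0 by
    \<open>translate_imp_free\<close>, which is why the time there may ignore
    \<open>b\<close>.\<close>
  have M_fib: "q (M s b) = q (M s b')" if bb: "b \<in> heights0" "b' \<in> heights0" "q b = q b'" for s b b'
  proof -
    obtain n where n: "\<forall>v. b v = b' v + shift n v" using fib bb by blast
    have n0: "n (rep v) = 0" if "v \<in> V" "rep v \<notin> free_reps" for v
    proof (rule ccontr)
      assume nz: "n (rep v) \<noteq> 0"
      have "rep v \<in> free_reps"
        by (rule translate_imp_free[OF bb(1,2) _ nz]) (use n that in \<open>auto simp: shift_rep\<close>)
      then show False using that by blast
    qed
    have "M s b v = M s b' v + shift n v" for v
    proof (cases "v \<in> V")
      case v: True
      have "p (rep v) (\<tau> s b (rep v)) v = p (rep v) (\<tau> s b' (rep v)) v + shift n v"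
      proof (cases "rep v \<in> free_reps")
        case True
        have "\<tau> s b (rep v) = \<tau> s b' (rep v) + of_int (n (rep v))"
          using True v n rep_V[OF v] N_pos by (simp add: \<tau>_def shift_rep field_simps)
        then show ?thesis using p_add[OF True v refl] v by (simp add: shift_rep)
      next
        case False
        then show ?thesis using n0[OF v False] v by (simp add: \<tau>_def shift_rep)
      qed
      then show ?thesis using n by (simp add: M_def)
    qed (use n in \<open>simp add: M_def p_out shift_def\<close>)
    then show ?thesis using fib[OF M0[OF bb(1)] M0[OF bb(2)]] by blast
  qed

  let ?I = "top_of_set {0..1::real}"
  have I: "compact_space ?I" "Hausdorff_space ?I"
    by (simp_all add: compact_space_subtopology Hausdorff_space_subtopology)

  have GF: "homotopic_with (\<lambda>_. True) P P id (G \<circ> F)"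
  proof -
    \<comment> \<open>The homotopy is factored through the interval times \<open>K\<close>;
      compactness of this product makes the map onto the interval times \<open>P\<close> a quotient
      map.\<close>
    obtain h where h: "continuous_map (prod_topology ?I P) P h"
      and h_M: "\<And>sb. sb \<in> topspace (prod_topology ?I (top_of_set K)) \<Longrightarrow> h (fst sb, q (snd sb)) = q (M (fst sb) (snd sb))"
    proof (rule compact_quotient_factor[of "prod_topology ?I (top_of_set K)" "prod_topology ?I P"
          "\<lambda>sb. (fst sb, q (snd sb))" P "\<lambda>sb. q (M (fst sb) (snd sb))"])
      show "compact_space (prod_topology ?I (top_of_set K))" "Hausdorff_space (prod_topology ?I P)"
        using I compact_K Haus compact_space_prod_topology Hausdorff_space_prod_topology by metis+
      have "continuous_map (prod_topology ?I (top_of_set K)) P (q \<circ> snd)"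
        by (rule continuous_map_compose[OF continuous_map_snd cont_qK])
      then show "continuous_map (prod_topology ?I (top_of_set K)) (prod_topology ?I P) (\<lambda>sb. (fst sb, q (snd sb)))"
        unfolding o_def by (intro continuous_map_pairedI continuous_map_fst)
      show "(\<lambda>sb. (fst sb, q (snd sb))) ` topspace (prod_topology ?I (top_of_set K)) = topspace (prod_topology ?I P)"
        unfolding topspace_prod_topology qK[symmetric] by force
      have "continuous_map (prod_topology ?I (top_of_set K)) (top_of_set heights0) (\<lambda>sb. M (fst sb) (snd sb))"
        unfolding prod_topology_subtopology_eu
      proof (subst continuous_map_subtopology_eu, intro conjI)
        show "continuous_on ({0..1} \<times> K) (\<lambda>sb. M (fst sb) (snd sb))"
        proof (rule continuous_on_coordinatewise_then_product)
          fix v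
          have ev: "continuous_on S (\<lambda>sb. snd sb w :: real)" for S :: "(real \<times> ('a \<Rightarrow> real)) set" and w
            using continuous_on_compose2[OF continuous_on_coord[of UNIV w] continuous_on_snd[OF continuous_on_id]] by auto
          have "continuous_on ({0..1} \<times> K) (\<lambda>sb. \<tau> (fst sb) (snd sb) (rep v))"
            unfolding \<tau>_def using N_pos by (cases "rep v \<in> free_reps") (auto intro!: continuous_intros ev)
          then have "continuous_on ({0..1} \<times> K) (\<lambda>sb. p (rep v) (\<tau> (fst sb) (snd sb) (rep v)) v)"
            by (rule continuous_on_compose2[OF cont_p]) auto
          then show "continuous_on ({0..1} \<times> K) (\<lambda>sb. M (fst sb) (snd sb) v)"
            unfolding M_def by (intro continuous_on_max ev)
        qed
        show "(\<lambda>sb. M (fst sb) (snd sb)) \<in> {0..1} \<times> K \<rightarrow> heights0"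
          using M0 K(2) by auto
      qed
      then have "continuous_map (prod_topology ?I (top_of_set K)) P (q \<circ> (\<lambda>sb. M (fst sb) (snd sb)))"
        using cont_q by (rule continuous_map_compose)
      then show "continuous_map (prod_topology ?I (top_of_set K)) P (\<lambda>sb. q (M (fst sb) (snd sb)))"
        by (simp add: o_def)
      show "q (M (fst sb) (snd sb)) = q (M (fst sb') (snd sb'))"
        if "sb \<in> topspace (prod_topology ?I (top_of_set K))" "sb' \<in> topspace (prod_topology ?I (top_of_set K))"
          "(fst sb, q (snd sb)) = (fst sb', q (snd sb'))" for sb sb'
        using M_fib[of "snd sb" "snd sb'" "fst sb"] that subsetD[OF K(2)] by auto
    qed (rule that)
    have hq: "h (s, q b) = q (M s b)" if "s \<in> {0..1}" "b \<in> K" for s b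
      using h_M[of "(s, b)"] that by simp
    show ?thesis
    proof (subst homotopic_with, simp, intro exI conjI ballI)
      show "continuous_map (prod_topology ?I P) P h" by (rule h)
      fix x assume "x \<in> topspace P"
      then obtain b where b: "b \<in> K" "x = q b" using qK by blast
      then have b0: "b \<in> heights0" using K(2) by blast
      show "h (0, x) = id x" using hq[of 0 b] b M_start[OF b0] by simp
      have "torus_point d (\<lambda>i. coords b i + of_int C) = torus_point d (coords b)"
        unfolding torus_point_eq_iff by auto
      from qL[OF this] show "h (1, x) = (G \<circ> F) x"
        using hq[of 1 b] b M_end[OF b0] F_q[OF b0] G_torus by simp
    qed simp
  qed
  have FG: "homotopic_with (\<lambda>_. True) (circle_power d) (circle_power d) id (F \<circ> G)"
  proof -
    \<comment> \<open>Both \<open>t i\<close> and the height of the path at \<open>e i\<close>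
      divided by \<open>N\<close> grow by m when \<open>t i\<close> grows by an integer m, so every
      interpolation between them is well defined on the circle.\<close>
    define k where "k s t = torus_point d (\<lambda>i. (1 - s) * t i + s * (p (e i) (t i) (e i) / of_int N))" for s t
    obtain h where h: "continuous_map (prod_topology ?I (circle_power d)) (circle_power d) h"
      and h_k: "\<And>st. st \<in> topspace (prod_topology ?I (unit_cube d)) \<Longrightarrow> h (fst st, torus_point d (snd st)) = k (fst st) (snd st)"
    proof (rule compact_quotient_factor[of "prod_topology ?I (unit_cube d)" "prod_topology ?I (circle_power d)"
          "\<lambda>st. (fst st, torus_point d (snd st))" "circle_power d" "\<lambda>st. k (fst st) (snd st)"])
      show "compact_space (prod_topology ?I (unit_cube d))" "Hausdorff_space (prod_topology ?I (circle_power d))"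
        using I compact_space_unit_cube Hausdorff_circle_power compact_space_prod_topology Hausdorff_space_prod_topology
        by metis+
      have coord: "continuous_map (prod_topology ?I (unit_cube d)) euclideanreal (\<lambda>st. snd st i)" if "i < d" for i
        using continuous_map_compose[OF continuous_map_snd continuous_map_unit_cube_coordinate[OF that], of ?I] by (simp add: o_def)
      have time: "continuous_map (prod_topology ?I (unit_cube d)) euclideanreal fst"
        using continuous_map_fst continuous_map_in_subtopology by blast
      show "continuous_map (prod_topology ?I (unit_cube d)) (prod_topology ?I (circle_power d)) (\<lambda>st. (fst st, torus_point d (snd st)))"
        by (intro continuous_map_pairedI continuous_map_fst continuous_map_torus_point coord)
      show "(\<lambda>st. (fst st, torus_point d (snd st))) ` topspace (prod_topology ?I (unit_cube d)) = topspace (prod_topology ?I (circle_power d))"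
        unfolding topspace_prod_topology torus_point_surj[symmetric] by force
      show "continuous_map (prod_topology ?I (unit_cube d)) (circle_power d) (\<lambda>st. k (fst st) (snd st))"
        unfolding k_def
      proof (rule continuous_map_torus_point)
        fix i assume i: "i < d"
        have "continuous_map (prod_topology ?I (unit_cube d)) euclideanreal ((\<lambda>t. p (e i) t (e i)) \<circ> (\<lambda>st. snd st i))"
          by (rule continuous_map_compose[OF coord[OF i]]) (use cont_p in auto)
        then show "continuous_map (prod_topology ?I (unit_cube d)) euclideanreal
            (\<lambda>st. (1 - fst st) * snd st i + fst st * (p (e i) (snd st i) (e i) / of_int N))"
          using coord[OF i] time N_pos by (intro continuous_intros) (auto simp: o_def)
      qed
      fix st st' :: "real \<times> (nat \<Rightarrow> real)" assume *: "(fst st, torus_point d (snd st)) = (fst st', torus_point d (snd st'))"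
      then obtain m where m: "\<forall>i<d. snd st i = snd st' i + of_int (m i)"
        using torus_point_eq_iff by auto
      have "(1 - fst st) * snd st i + fst st * (p (e i) (snd st i) (e i) / of_int N)
          = (1 - fst st') * snd st' i + fst st' * (p (e i) (snd st' i) (e i) / of_int N) + of_int (m i)" if i: "i < d" for i
      proof -
        have "p (e i) (snd st i) (e i) / of_int N = p (e i) (snd st' i) (e i) / of_int N + of_int (m i)"
          using m i p_add[OF e_free[OF i] e_V[OF i] rep_e[OF i], of "snd st' i" "m i"] N_pos
          by (simp add: add_divide_distrib)
        moreover have "snd st i = snd st' i + of_int (m i)" "fst st = fst st'" using m i * by auto
        ultimately show ?thesis by (simp only:) (simp add: algebra_simps)
      qed
      then show "k (fst st) (snd st) = k (fst st') (snd st')"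
        unfolding k_def torus_point_eq_iff by blast
    qed (rule that)
    have hk: "h (s, torus_point d t) = k s t" if "s \<in> {0..1}" "t \<in> topspace (unit_cube d)" for s t
      using h_k[of "(s, t)"] that by simp
    show ?thesis
    proof (subst homotopic_with, simp, intro exI conjI ballI)
      show "continuous_map (prod_topology ?I (circle_power d)) (circle_power d) h" by (rule h)
      fix x assume "x \<in> topspace (circle_power d)"
      then obtain t where t: "t \<in> topspace (unit_cube d)" "x = torus_point d t" using torus_point_surj by blast
      show "h (0, x) = id x" using hk[of 0 t] t by (simp add: k_def)
      have "torus_point d (coords (L t)) = torus_point d (\<lambda>i. p (e i) (t i) (e i) / of_int N)"
        unfolding torus_point_eq_iff by (rule exI[of _ "\<lambda>_. 0"]) (simp add: coords_def L_e)
      then show "h (1, x) = (F \<circ> G) x"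
        using hk[of 1 t] t F_q[OF L0] G_torus by (simp add: k_def)
    qed simp
  qed
  show ?thesis
    unfolding homotopy_equivalent_space_def d_def[symmetric]
    by (intro exI[of _ F] exI[of _ G] conjI F G homotopic_with_symD[OF GF] homotopic_with_symD[OF FG])
qed

end

section \<open>Open partitions and homotopy equivalence\<close>

lemma homotopic_on_open_partition:
  assumes X: "topspace X = (\<Union>i\<in>I. C i)" and ope: "\<And>i. i \<in> I \<Longrightarrow> openin X (C i)"
    and disj: "\<And>i j. i \<in> I \<Longrightarrow> j \<in> I \<Longrightarrow> C i \<inter> C j \<noteq> {} \<Longrightarrow> i = j"
    and hom: "\<And>i. i \<in> I \<Longrightarrow> homotopic_with (\<lambda>_. True) (subtopology X (C i)) Y u v"
  shows "homotopic_with (\<lambda>_. True) X Y u v"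
proof -
  let ?J = "top_of_set {0..1::real}"
  have "\<forall>i\<in>I. \<exists>h. continuous_map (prod_topology ?J (subtopology X (C i))) Y h \<and> (\<forall>x. h (0, x) = u x) \<and> (\<forall>x. h (1, x) = v x)"
    using hom unfolding homotopic_with_def by blast
  from bchoice[OF this] obtain h where h: "\<forall>i\<in>I. continuous_map (prod_topology ?J (subtopology X (C i))) Y (h i)
      \<and> (\<forall>x. h i (0, x) = u x) \<and> (\<forall>x. h i (1, x) = v x)"
    by (rule exE)
  obtain g where g: "continuous_map (prod_topology ?J X) Y g"
    "\<And>x i. \<lbrakk>i \<in> I; x \<in> topspace (prod_topology ?J X) \<inter> ({0..1} \<times> C i)\<rbrakk> \<Longrightarrow> g x = h i x"
  proof (rule pasting_lemma_exists[of "prod_topology ?J X" "\<lambda>i. {0..1} \<times> C i" I Y h])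
    show "topspace (prod_topology ?J X) \<subseteq> (\<Union>i\<in>I. {0..1} \<times> C i)" using X by auto
    show "openin (prod_topology ?J X) ({0..1} \<times> C i)" if "i \<in> I" for i
      using ope[OF that] openin_topspace[of ?J] by (simp add: openin_prod_Times_iff)
    show "continuous_map (subtopology (prod_topology ?J X) ({0..1} \<times> C i)) Y (h i)" if "i \<in> I" for i
      using h that by (simp add: subtopology_Times subtopology_subtopology)
    show "h i x = h j x" if "i \<in> I" "j \<in> I" "x \<in> topspace (prod_topology ?J X) \<inter> ({0..1} \<times> C i) \<inter> ({0..1} \<times> C j)" for i j x
      using disj[OF that(1,2)] that(3) by blast
  qed (rule that)
  show ?thesis
  proof (subst homotopic_with, simp, intro exI conjI ballI)
    show "continuous_map (prod_topology ?J X) Y g" by (rule g)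
    fix x assume x: "x \<in> topspace X"
    then obtain i where i: "i \<in> I" "x \<in> C i" using X by blast
    show "g (0, x) = u x" "g (1, x) = v x" using g(2)[OF i(1)] i x h by auto
  qed simp
qed

lemma homotopy_equivalent_open_partitions:
  assumes X: "topspace X = (\<Union>i\<in>I. C i)" and opeX: "\<And>i. i \<in> I \<Longrightarrow> openin X (C i)"
    and disjX: "\<And>i j. i \<in> I \<Longrightarrow> j \<in> I \<Longrightarrow> C i \<inter> C j \<noteq> {} \<Longrightarrow> i = j"
    and Y: "topspace Y = (\<Union>i\<in>I. D i)" and opeY: "\<And>i. i \<in> I \<Longrightarrow> openin Y (D i)"
    and disjY: "\<And>i j. i \<in> I \<Longrightarrow> j \<in> I \<Longrightarrow> D i \<inter> D j \<noteq> {} \<Longrightarrow> i = j"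
    and eqv: "\<And>i. i \<in> I \<Longrightarrow> subtopology X (C i) homotopy_equivalent_space subtopology Y (D i)"
  shows "X homotopy_equivalent_space Y"
proof -
  have "\<forall>i\<in>I. \<exists>fg. continuous_map (subtopology X (C i)) (subtopology Y (D i)) (fst fg) \<and>
      continuous_map (subtopology Y (D i)) (subtopology X (C i)) (snd fg) \<and>
      homotopic_with (\<lambda>_. True) (subtopology X (C i)) (subtopology X (C i)) (snd fg \<circ> fst fg) id \<and>
      homotopic_with (\<lambda>_. True) (subtopology Y (D i)) (subtopology Y (D i)) (fst fg \<circ> snd fg) id"
    using eqv unfolding homotopy_equivalent_space_def by auto
  from bchoice[OF this] obtain fg where fg: "\<forall>i\<in>I. continuous_map (subtopology X (C i)) (subtopology Y (D i)) (fst (fg i)) \<and>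
      continuous_map (subtopology Y (D i)) (subtopology X (C i)) (snd (fg i)) \<and>
      homotopic_with (\<lambda>_. True) (subtopology X (C i)) (subtopology X (C i)) (snd (fg i) \<circ> fst (fg i)) id \<and>
      homotopic_with (\<lambda>_. True) (subtopology Y (D i)) (subtopology Y (D i)) (fst (fg i) \<circ> snd (fg i)) id"
    by (rule exE)
  define f where "f i = fst (fg i)" for i
  define g where "g i = snd (fg i)" for i
  have f: "continuous_map (subtopology X (C i)) (subtopology Y (D i)) (f i)"
    and g: "continuous_map (subtopology Y (D i)) (subtopology X (C i)) (g i)"
    and gf: "homotopic_with (\<lambda>_. True) (subtopology X (C i)) (subtopology X (C i)) (g i \<circ> f i) id"
    and fg: "homotopic_with (\<lambda>_. True) (subtopology Y (D i)) (subtopology Y (D i)) (f i \<circ> g i) id" if "i \<in> I" for i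
    using fg that by (auto simp: f_def g_def)
  have CX: "C i \<subseteq> topspace X" and DY: "D i \<subseteq> topspace Y" if "i \<in> I" for i
    using X Y that by auto
  obtain F where F: "continuous_map X Y F" "\<And>x i. \<lbrakk>i \<in> I; x \<in> topspace X \<inter> C i\<rbrakk> \<Longrightarrow> F x = f i x"
  proof (rule pasting_lemma_exists[of X C I Y f])
    show "continuous_map (subtopology X (C i)) Y (f i)" if "i \<in> I" for i
      using f[OF that] continuous_map_in_subtopology by blast
    show "f i x = f j x" if "i \<in> I" "j \<in> I" "x \<in> topspace X \<inter> C i \<inter> C j" for i j x
      using disjX[OF that(1,2)] that(3) by blast
  qed (use X opeX in \<open>simp_all\<close>)
  obtain G where G: "continuous_map Y X G" "\<And>x i. \<lbrakk>i \<in> I; x \<in> topspace Y \<inter> D i\<rbrakk> \<Longrightarrow> G x = g i x"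
  proof (rule pasting_lemma_exists[of Y D I X g])
    show "continuous_map (subtopology Y (D i)) X (g i)" if "i \<in> I" for i
      using g[OF that] continuous_map_in_subtopology by blast
    show "g i x = g j x" if "i \<in> I" "j \<in> I" "x \<in> topspace Y \<inter> D i \<inter> D j" for i j x
      using disjY[OF that(1,2)] that(3) by blast
  qed (use Y opeY in \<open>simp_all\<close>)
  have "homotopic_with (\<lambda>_. True) X X (G \<circ> F) id"
  proof (rule homotopic_on_open_partition[OF X opeX disjX])
    fix i assume i: "i \<in> I"
    have "homotopic_with (\<lambda>_. True) (subtopology X (C i)) X (id \<circ> (g i \<circ> f i)) (id \<circ> id)"
      using gf[OF i] by (rule homotopic_with_compose_continuous_map_left) (simp_all add: continuous_map_from_subtopology)
    then show "homotopic_with (\<lambda>_. True) (subtopology X (C i)) X (G \<circ> F) id"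
    proof (rule homotopic_with_eq)
      fix x assume x: "x \<in> topspace (subtopology X (C i))"
      then have "f i x \<in> D i" "f i x \<in> topspace Y"
        using continuous_map_image_subset_topspace[OF f[OF i]] by auto
      then show "(G \<circ> F) x = (id \<circ> (g i \<circ> f i)) x"
        using x i F(2)[OF i] G(2)[OF i] by auto
    qed simp_all
  qed
  moreover have "homotopic_with (\<lambda>_. True) Y Y (F \<circ> G) id"
  proof (rule homotopic_on_open_partition[OF Y opeY disjY])
    fix i assume i: "i \<in> I"
    have "homotopic_with (\<lambda>_. True) (subtopology Y (D i)) Y (id \<circ> (f i \<circ> g i)) (id \<circ> id)"
      using fg[OF i] by (rule homotopic_with_compose_continuous_map_left) (simp_all add: continuous_map_from_subtopology)
    then show "homotopic_with (\<lambda>_. True) (subtopology Y (D i)) Y (F \<circ> G) id"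
    proof (rule homotopic_with_eq)
      fix x assume x: "x \<in> topspace (subtopology Y (D i))"
      then have "g i x \<in> C i" "g i x \<in> topspace X"
        using continuous_map_image_subset_topspace[OF g[OF i]] by auto
      then show "(F \<circ> G) x = (id \<circ> (f i \<circ> g i)) x"
        using x i G(2)[OF i] F(2)[OF i] by auto
    qed simp_all
  qed
  ultimately show ?thesis
    unfolding homotopy_equivalent_space_def using F(1) G(1) by blast
qed

lemma homotopy_equivalent_sum_topology:
  assumes X: "topspace X = (\<Union>i\<in>I. C i)" and ope: "\<And>i. i \<in> I \<Longrightarrow> openin X (C i)"
    and disj: "\<And>i j. i \<in> I \<Longrightarrow> j \<in> I \<Longrightarrow> C i \<inter> C j \<noteq> {} \<Longrightarrow> i = j"
    and eqv: "\<And>i. i \<in> I \<Longrightarrow> subtopology X (C i) homotopy_equivalent_space Y i"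
  shows "X homotopy_equivalent_space sum_topology Y I"
proof (rule homotopy_equivalent_open_partitions[OF X ope disj])
  show "topspace (sum_topology Y I) = (\<Union>i\<in>I. Pair i ` topspace (Y i))" by auto
  fix i assume i: "i \<in> I"
  show "openin (sum_topology Y I) (Pair i ` topspace (Y i))"
    using open_map_component_injection[OF i, of Y] unfolding open_map_def by blast
  have "Y i homeomorphic_space subtopology (sum_topology Y I) (Pair i ` topspace (Y i))"
    using embedding_map_component_injection[OF i, of Y] embedding_map_imp_homeomorphic_space by blast
  then show "subtopology X (C i) homotopy_equivalent_space subtopology (sum_topology Y I) (Pair i ` topspace (Y i))"
    using eqv[OF i] homeomorphic_imp_homotopy_equivalent_space homotopy_eqv_trans by blast
qed auto

lemma finite_partition_circle_powers:
  assumes "finite \<C>" "topspace X = \<Union>\<C>" "\<And>C. C \<in> \<C> \<Longrightarrow> openin X C"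
    and "\<And>C C'. C \<in> \<C> \<Longrightarrow> C' \<in> \<C> \<Longrightarrow> C \<inter> C' \<noteq> {} \<Longrightarrow> C = C'"
    and "\<And>C. C \<in> \<C> \<Longrightarrow> \<exists>d. subtopology X C homotopy_equivalent_space circle_power d"
  shows "\<exists>(I :: nat set) d. X homotopy_equivalent_space sum_topology (\<lambda>i. circle_power (d i)) I"
proof -
  obtain e where e: "bij_betw e {..<card \<C>} \<C>"
    using ex_bij_betw_nat_finite[OF assms(1)] by (auto simp: atLeast0LessThan)
  obtain d where d: "\<And>C. C \<in> \<C> \<Longrightarrow> subtopology X C homotopy_equivalent_space circle_power (d C)"
    using assms(5) by metis
  have "X homotopy_equivalent_space sum_topology (\<lambda>i. circle_power (d (e i))) {..<card \<C>}"
  proof (rule homotopy_equivalent_sum_topology[of X e])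
    show "topspace X = (\<Union>i<card \<C>. e i)" using assms(2) e by (auto simp: bij_betw_def)
    show "i = j" if "i \<in> {..<card \<C>}" "j \<in> {..<card \<C>}" "e i \<inter> e j \<noteq> {}" for i j
    proof -
      have "e i = e j" using that bij_betwE[OF e] by (intro assms(4)) auto
      then show ?thesis using that e by (auto simp: bij_betw_def inj_on_def)
    qed
  qed (use assms(3) d bij_betwE[OF e] in auto)
  then show ?thesis by (intro exI)
qed

section \<open>Points of Hom complexes\<close>

text \<open>Membership in the complex, read off from the supports of the barycentric coordinates;
  these form the smallest cell containing the point, so no cell has to be named.\<close>

definition hom_points :: "'a pair_pre_digraph \<Rightarrow> 'b pair_pre_digraph \<Rightarrow> ('a \<Rightarrow> 'b \<Rightarrow> real) set" where
  "hom_points G H = {x \<in> pverts G \<rightarrow>\<^sub>E (pverts H \<rightarrow>\<^sub>E {0..}).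
     (\<forall>v\<in>pverts G. (\<Sum>w\<in>pverts H. x v w) = 1) \<and>
     (\<forall>(u, v)\<in>parcs G. \<forall>a\<in>pverts H. \<forall>b\<in>pverts H. x u a \<noteq> 0 \<longrightarrow> x v b \<noteq> 0 \<longrightarrow> (a, b) \<in> parcs H)}"

lemma hom_points_eq:
  assumes "parcs G \<subseteq> pverts G \<times> pverts G"
  shows "(\<Union>\<eta> \<in> hom_cells G H. \<Pi>\<^sub>E v \<in> pverts G. simplex_face (pverts H) (\<eta> v)) = hom_points G H"
proof
  show "(\<Union>\<eta> \<in> hom_cells G H. \<Pi>\<^sub>E v \<in> pverts G. simplex_face (pverts H) (\<eta> v)) \<subseteq> hom_points G H"
  proof
    fix x assume "x \<in> (\<Union>\<eta> \<in> hom_cells G H. \<Pi>\<^sub>E v \<in> pverts G. simplex_face (pverts H) (\<eta> v))"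
    then obtain \<eta> where \<eta>: "\<eta> \<in> hom_cells G H" "x \<in> (\<Pi>\<^sub>E v \<in> pverts G. simplex_face (pverts H) (\<eta> v))" by blast
    have xv: "x v \<in> pverts H \<rightarrow>\<^sub>E {0..}" "(\<Sum>w\<in>pverts H. x v w) = 1" "\<forall>w\<in>pverts H - \<eta> v. x v w = 0"
      if "v \<in> pverts G" for v
      using PiE_mem[OF \<eta>(2) that] by (simp_all add: simplex_face_def)
    have adj: "(a, b) \<in> parcs H" if "(u, v) \<in> parcs G" "a \<in> pverts H" "b \<in> pverts H" "x u a \<noteq> 0" "x v b \<noteq> 0" for u v a b
    proof -
      have "u \<in> pverts G" "v \<in> pverts G" using assms that(1) by auto
      then have "a \<in> \<eta> u" "b \<in> \<eta> v" using xv(3) that by auto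
      then show ?thesis using \<eta>(1) that(1) unfolding hom_cells_def by blast
    qed
    have "x \<in> pverts G \<rightarrow>\<^sub>E (pverts H \<rightarrow>\<^sub>E {0..})"
      using \<eta>(2) xv(1) by (auto simp: PiE_def)
    then show "x \<in> hom_points G H"
      using xv(2) adj unfolding hom_points_def by blast
  qed
  show "hom_points G H \<subseteq> (\<Union>\<eta> \<in> hom_cells G H. \<Pi>\<^sub>E v \<in> pverts G. simplex_face (pverts H) (\<eta> v))"
  proof
    fix x assume x: "x \<in> hom_points G H"
    define \<eta> where "\<eta> = (\<lambda>v\<in>pverts G. {w \<in> pverts H. x v w \<noteq> 0})"
    have sum1: "(\<Sum>w\<in>pverts H. x v w) = 1" if "v \<in> pverts G" for v
      using x that by (simp add: hom_points_def)
    have ne: "\<eta> v \<noteq> {}" if "v \<in> pverts G" for v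
    proof
      assume "\<eta> v = {}"
      then have "(\<Sum>w\<in>pverts H. x v w) = 0" using that by (intro sum.neutral) (auto simp: \<eta>_def)
      then show False using sum1[OF that] by simp
    qed
    have "\<eta> \<in> pverts G \<rightarrow>\<^sub>E {S. S \<noteq> {} \<and> S \<subseteq> pverts H}"
      using ne by (auto simp: \<eta>_def)
    moreover have "(a, b) \<in> parcs H" if uv: "(u, v) \<in> parcs G" and "a \<in> \<eta> u" "b \<in> \<eta> v" for u v a b
    proof -
      have "u \<in> pverts G" "v \<in> pverts G" using assms uv by auto
      then have "a \<in> pverts H" "b \<in> pverts H" "x u a \<noteq> 0" "x v b \<noteq> 0" using that by (auto simp: \<eta>_def)
      then show ?thesis using x uv unfolding hom_points_def by blast
    qed
    ultimately have "\<eta> \<in> hom_cells G H" unfolding hom_cells_def by blast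
    moreover have "x \<in> (\<Pi>\<^sub>E v \<in> pverts G. simplex_face (pverts H) (\<eta> v))"
    proof (rule PiE_I)
      fix v assume v: "v \<in> pverts G"
      have "x v \<in> pverts H \<rightarrow>\<^sub>E {0..}" using x v by (auto simp: hom_points_def)
      then show "x v \<in> simplex_face (pverts H) (\<eta> v)"
        using sum1[OF v] v by (auto simp: simplex_face_def \<eta>_def)
    next
      fix v assume "v \<notin> pverts G"
      moreover have "x \<in> pverts G \<rightarrow>\<^sub>E (pverts H \<rightarrow>\<^sub>E {0..})" using x by (simp add: hom_points_def)
      ultimately show "x v = undefined" by (rule PiE_arb[rotated])
    qed
    ultimately show "x \<in> (\<Union>\<eta> \<in> hom_cells G H. \<Pi>\<^sub>E v \<in> pverts G. simplex_face (pverts H) (\<eta> v))" by blast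
  qed
qed

locale hom_complex =
  fixes G :: "'a pair_pre_digraph" and H :: "'b pair_pre_digraph"
  assumes finite_G: "finite (pverts G)" and finite_H: "finite (pverts H)"
    and arcs_G: "parcs G \<subseteq> pverts G \<times> pverts G"
begin

lemma Hom_complex_eq:
  "Hom_complex G H = subtopology
     (product_topology (\<lambda>v. product_topology (\<lambda>w. euclideanreal) (pverts H)) (pverts G)) (hom_points G H)"
  unfolding Hom_complex_def hom_points_eq[OF arcs_G] ..

lemma hom_points_PiE: "hom_points G H \<subseteq> pverts G \<rightarrow>\<^sub>E (pverts H \<rightarrow>\<^sub>E UNIV)"
proof -
  have "(pverts G \<rightarrow>\<^sub>E (pverts H \<rightarrow>\<^sub>E {0..})) \<subseteq> pverts G \<rightarrow>\<^sub>E (pverts H \<rightarrow>\<^sub>E (UNIV :: real set))"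
    by (intro PiE_mono) simp
  then show ?thesis unfolding hom_points_def by blast
qed

lemma topspace_Hom_complex: "topspace (Hom_complex G H) = hom_points G H"
  unfolding Hom_complex_eq using hom_points_PiE by (simp only: topspace_subtopology topspace_product_topology topspace_euclidean Int_absorb1)

lemma Hausdorff_Hom_complex: "Hausdorff_space (Hom_complex G H)"
  unfolding Hom_complex_eq
  by (intro Hausdorff_space_subtopology) (simp add: Hausdorff_space_product_topology)

lemma continuous_map_into_Hom_complex:
  assumes "\<And>a. a \<in> topspace A \<Longrightarrow> f a \<in> hom_points G H"
    and "\<And>v w. v \<in> pverts G \<Longrightarrow> w \<in> pverts H \<Longrightarrow> continuous_map A euclideanreal (\<lambda>a. f a v w)"
  shows "continuous_map A (Hom_complex G H) f"
  unfolding Hom_complex_eq continuous_map_in_subtopology continuous_map_componentwise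
proof (intro conjI ballI)
  have P: "f a \<in> pverts G \<rightarrow>\<^sub>E (pverts H \<rightarrow>\<^sub>E UNIV)" if "a \<in> topspace A" for a
    using assms(1)[OF that] hom_points_PiE by blast
  show "f ` topspace A \<subseteq> extensional (pverts G)" using P by (auto simp: PiE_def)
  show "(\<lambda>a. f a v) ` topspace A \<subseteq> extensional (pverts H)" if "v \<in> pverts G" for v
    using PiE_mem[OF P that] by (auto simp: PiE_def)
qed (use assms in auto)

lemma continuous_map_coordinate:
  assumes "v \<in> pverts G" "w \<in> pverts H"
  shows "continuous_map (Hom_complex G H) euclideanreal (\<lambda>x. x v w)"
  unfolding Hom_complex_eq
proof (rule continuous_map_from_subtopology)
  have "continuous_map (product_topology (\<lambda>v. product_topology (\<lambda>w. euclideanreal) (pverts H)) (pverts G))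
      (product_topology (\<lambda>w. euclideanreal) (pverts H)) (\<lambda>x. x v)"
    by (rule continuous_map_product_coordinates[OF assms(1)])
  from continuous_map_product_then_coordinatewise(1)[OF this assms(2)]
  show "continuous_map (product_topology (\<lambda>v. product_topology (\<lambda>w. euclideanreal) (pverts H)) (pverts G))
      euclideanreal (\<lambda>x. x v w)" .
qed

text \<open>Inclusion of supports: the smallest cell of \<open>x\<close> is a face of the smallest
  cell of \<open>y\<close>.\<close>

definition refines :: "('a \<Rightarrow> 'b \<Rightarrow> real) \<Rightarrow> ('a \<Rightarrow> 'b \<Rightarrow> real) \<Rightarrow> bool" where
  "refines x y \<longleftrightarrow> (\<forall>v\<in>pverts G. \<forall>w\<in>pverts H. x v w \<noteq> 0 \<longrightarrow> y v w \<noteq> 0)"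

text \<open>A point has finitely many nonzero coordinates, and staying nonzero is an open condition;
  so the points whose support contains that of \<open>x\<close> form a neighbourhood of
  \<open>x\<close>, its open star.\<close>

lemma openin_if_star_closed:
  assumes S: "S \<subseteq> hom_points G H"
    and star: "\<And>x y. x \<in> S \<Longrightarrow> y \<in> hom_points G H \<Longrightarrow> refines x y \<Longrightarrow> y \<in> S"
  shows "openin (Hom_complex G H) S"
proof (subst openin_subopen, intro ballI)
  fix x assume x: "x \<in> S"
  define P where "P = {(v, w) \<in> pverts G \<times> pverts H. x v w \<noteq> 0}"
  have "finite P" using finite_G finite_H by (auto simp: P_def intro: finite_subset[of _ "pverts G \<times> pverts H"])
  \<comment> \<open>Intersecting with the whole space keeps \<open>U\<close> correct when
    \<open>P\<close> is empty, as for a graph without vertices.\<close>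
  define U where "U = topspace (Hom_complex G H) \<inter> (\<Inter>(v, w)\<in>P. {y \<in> topspace (Hom_complex G H). y v w \<in> - {0}})"
  have "openin (Hom_complex G H) U"
  proof (cases "P = {}")
    case False
    have "openin (Hom_complex G H) (\<Inter>(v, w)\<in>P. {y \<in> topspace (Hom_complex G H). y v w \<in> - {0}})"
    proof (rule openin_INT2[OF \<open>finite P\<close> False])
      fix p assume "p \<in> P"
      then obtain v w where "p = (v, w)" "v \<in> pverts G" "w \<in> pverts H" by (auto simp: P_def)
      then show "openin (Hom_complex G H) (case p of (v, w) \<Rightarrow> {y \<in> topspace (Hom_complex G H). y v w \<in> - {0}})"
        using openin_continuous_map_preimage[OF continuous_map_coordinate, of v w "- {0}"] by auto
    qed
    then show ?thesis unfolding U_def by blast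
  qed (simp add: U_def)
  moreover have "x \<in> U" using x S by (auto simp: U_def P_def topspace_Hom_complex)
  moreover have "U \<subseteq> S"
  proof
    fix y assume "y \<in> U"
    then have "y \<in> hom_points G H" "refines x y" by (auto simp: U_def P_def topspace_Hom_complex refines_def)
    then show "y \<in> S" using star x by blast
  qed
  ultimately show "\<exists>T. openin (Hom_complex G H) T \<and> x \<in> T \<and> T \<subseteq> S" by blast
qed

end

lemma hom_pointsD:
  assumes "x \<in> hom_points G H" "v \<in> pverts G"
  shows "x v \<in> extensional (pverts H)" "w \<in> pverts H \<Longrightarrow> 0 \<le> x v w" "(\<Sum>w\<in>pverts H. x v w) = 1"
    "\<exists>w\<in>pverts H. x v w \<noteq> 0"
proof -
  have x: "x \<in> pverts G \<rightarrow>\<^sub>E (pverts H \<rightarrow>\<^sub>E {0..})" using assms(1) by (simp add: hom_points_def)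
  from PiE_mem[OF this assms(2)] show "x v \<in> extensional (pverts H)" "w \<in> pverts H \<Longrightarrow> 0 \<le> x v w"
    by (auto simp: PiE_def)
  show s: "(\<Sum>w\<in>pverts H. x v w) = 1" using assms by (simp add: hom_points_def)
  show "\<exists>w\<in>pverts H. x v w \<noteq> 0"
  proof (rule ccontr)
    assume "\<not> ?thesis"
    then have "(\<Sum>w\<in>pverts H. x v w) = 0" by (intro sum.neutral) auto
    then show False using s by simp
  qed
qed

lemma hom_points_extensional: "x \<in> hom_points G H \<Longrightarrow> x \<in> extensional (pverts G)"
  by (simp add: hom_points_def PiE_def)

lemma hom_points_adj:
  assumes "x \<in> hom_points G H" "(u, v) \<in> parcs G" "a \<in> pverts H" "b \<in> pverts H" "x u a \<noteq> 0" "x v b \<noteq> 0"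
  shows "(a, b) \<in> parcs H"
  using assms unfolding hom_points_def by blast

lemma hom_pointsI:
  assumes "x \<in> extensional (pverts G)" "\<And>v. v \<in> pverts G \<Longrightarrow> x v \<in> extensional (pverts H)"
    and "\<And>v w. v \<in> pverts G \<Longrightarrow> w \<in> pverts H \<Longrightarrow> 0 \<le> x v w"
    and "\<And>v. v \<in> pverts G \<Longrightarrow> (\<Sum>w\<in>pverts H. x v w) = 1"
    and "\<And>u v a b. (u, v) \<in> parcs G \<Longrightarrow> a \<in> pverts H \<Longrightarrow> b \<in> pverts H \<Longrightarrow> x u a \<noteq> 0 \<Longrightarrow> x v b \<noteq> 0 \<Longrightarrow> (a, b) \<in> parcs H"
  shows "x \<in> hom_points G H"
proof -
  have "x v \<in> pverts H \<rightarrow>\<^sub>E {0..}" if "v \<in> pverts G" for v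
    using assms(2,3)[OF that] by (simp add: PiE_def Pi_def)
  then have "x \<in> pverts G \<rightarrow>\<^sub>E (pverts H \<rightarrow>\<^sub>E {0..})"
    using assms(1) by (simp add: PiE_def Pi_def)
  then show ?thesis using assms(4,5) unfolding hom_points_def by blast
qed

text \<open>No arc constrains the coordinate at an isolated vertex: it ranges over a full simplex
  and can slide linearly to the vertex \<open>w0\<close>. The neighbours that the other vertices
  keep are what makes the later lifts unique.\<close>

lemma remove_isolated:
  fixes G :: "'a pair_pre_digraph" and H :: "'b pair_pre_digraph"
  assumes fin: "finite (pverts G)" "finite (pverts H)" and arcs: "parcs G \<subseteq> pverts G \<times> pverts G"
    and sym: "sym (parcs G)" and w0: "w0 \<in> pverts H"
  defines "G' \<equiv> \<lparr>pverts = Domain (parcs G), parcs = parcs G\<rparr>"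
  shows "Hom_complex G H homotopy_equivalent_space Hom_complex G' H"
proof -
  have V': "pverts G' \<subseteq> pverts G" "parcs G' = parcs G" using arcs by (auto simp: G'_def)
  have arcs': "parcs G \<subseteq> pverts G' \<times> pverts G'"
    using sym by (auto simp: G'_def dest: symD)
  interpret X: hom_complex G H by unfold_locales (fact fin arcs)+
  interpret Y: hom_complex G' H
    by unfold_locales (use fin arcs' V' finite_subset in auto)
  define pt where "pt = (\<lambda>w\<in>pverts H. if w = w0 then 1 else 0 :: real)"
  have pt_sum: "(\<Sum>w\<in>pverts H. pt w) = 1"
    using w0 fin by (simp add: pt_def)
  define r where "r x = restrict x (pverts G')" for x :: "'a \<Rightarrow> 'b \<Rightarrow> real"
  define s where "s y = (\<lambda>v\<in>pverts G. if v \<in> pverts G' then y v else pt)" for y :: "'a \<Rightarrow> 'b \<Rightarrow> real"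
  define h where "h tx = (\<lambda>v\<in>pverts G. if v \<in> pverts G' then snd tx v else
      (\<lambda>w\<in>pverts H. (1 - fst tx) * pt w + fst tx * snd tx v w))" for tx :: "real \<times> ('a \<Rightarrow> 'b \<Rightarrow> real)"
  have r: "r x \<in> hom_points G' H" if x: "x \<in> hom_points G H" for x
  proof (rule hom_pointsI)
    fix u v a b assume "(u, v) \<in> parcs G'" "a \<in> pverts H" "b \<in> pverts H" "r x u a \<noteq> 0" "r x v b \<noteq> 0"
    then show "(a, b) \<in> parcs H"
      using hom_points_adj[OF x, of u v a b] V'(2) arcs' by (auto simp: r_def split: if_splits)
  qed (use hom_pointsD[OF x] V' in \<open>auto simp: r_def subset_iff\<close>)
  have s: "s y \<in> hom_points G H" if y: "y \<in> hom_points G' H" for y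
  proof (rule hom_pointsI)
    fix u v a b assume *: "(u, v) \<in> parcs G" "a \<in> pverts H" "b \<in> pverts H" "s y u a \<noteq> 0" "s y v b \<noteq> 0"
    then have "u \<in> pverts G'" "v \<in> pverts G'" "u \<in> pverts G" "v \<in> pverts G" using arcs arcs' by auto
    then show "(a, b) \<in> parcs H"
      using * hom_points_adj[OF y, of u v a b] V'(2) by (simp add: s_def)
  next
    show "s y v \<in> extensional (pverts H)" if "v \<in> pverts G" for v
      using hom_pointsD(1)[OF y] that by (simp add: s_def pt_def)
    show "0 \<le> s y v w" if "v \<in> pverts G" "w \<in> pverts H" for v w
      using hom_pointsD(2)[OF y] that by (simp add: s_def pt_def)
    show "(\<Sum>w\<in>pverts H. s y v w) = 1" if "v \<in> pverts G" for v
      using hom_pointsD(3)[OF y] that pt_sum by (simp add: s_def)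
  qed (simp add: s_def)
  have h: "h tx \<in> hom_points G H" if tx: "fst tx \<in> {0..1}" "snd tx \<in> hom_points G H" for tx
  proof (rule hom_pointsI)
    fix u v a b assume *: "(u, v) \<in> parcs G" "a \<in> pverts H" "b \<in> pverts H" "h tx u a \<noteq> 0" "h tx v b \<noteq> 0"
    then have "u \<in> pverts G'" "v \<in> pverts G'" "u \<in> pverts G" "v \<in> pverts G" using arcs arcs' by auto
    then show "(a, b) \<in> parcs H"
      using * hom_points_adj[OF tx(2), of u v a b] by (simp add: h_def)
  next
    show "h tx v \<in> extensional (pverts H)" if "v \<in> pverts G" for v
      using hom_pointsD(1)[OF tx(2)] that by (simp add: h_def)
    show "0 \<le> h tx v w" if "v \<in> pverts G" "w \<in> pverts H" for v w
      using hom_pointsD(2)[OF tx(2) that] that tx(1) by (simp add: h_def pt_def)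
    show "(\<Sum>w\<in>pverts H. h tx v w) = 1" if "v \<in> pverts G" for v
      using hom_pointsD(3)[OF tx(2)] that pt_sum
      by (simp add: h_def sum.distrib flip: sum_distrib_left)
  qed (simp add: h_def)
  have cont_r: "continuous_map (Hom_complex G H) (Hom_complex G' H) r"
  proof (rule Y.continuous_map_into_Hom_complex)
    fix v w assume "v \<in> pverts G'" "w \<in> pverts H"
    then show "continuous_map (Hom_complex G H) euclideanreal (\<lambda>a. r a v w)"
      using X.continuous_map_coordinate[of v w] V'(1) by (auto simp: r_def)
  qed (use r X.topspace_Hom_complex in auto)
  have cont_s: "continuous_map (Hom_complex G' H) (Hom_complex G H) s"
  proof (rule X.continuous_map_into_Hom_complex)
    fix v w assume "v \<in> pverts G" "w \<in> pverts H"
    then show "continuous_map (Hom_complex G' H) euclideanreal (\<lambda>a. s a v w)"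
      using Y.continuous_map_coordinate[of v w] by (cases "v \<in> pverts G'") (auto simp: s_def)
  qed (use s Y.topspace_Hom_complex in auto)
  show ?thesis
  proof (rule deformation_retraction_imp_homotopy_equivalent_space)
    show "retraction_maps (Hom_complex G H) (Hom_complex G' H) r s"
      unfolding retraction_maps_def
    proof (intro conjI cont_r cont_s ballI)
      fix y assume "y \<in> topspace (Hom_complex G' H)"
      then have "y \<in> extensional (pverts G')" using hom_points_extensional Y.topspace_Hom_complex by auto
      then show "r (s y) = y" using V'(1) by (auto simp: r_def s_def extensional_def fun_eq_iff)
    qed
    show "homotopic_with (\<lambda>x. True) (Hom_complex G H) (Hom_complex G H) (s \<circ> r) id"
    proof (subst homotopic_with, simp, intro exI conjI ballI)
      let ?P = "prod_topology (top_of_set {0..1::real}) (Hom_complex G H)"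
      show "continuous_map ?P (Hom_complex G H) h"
      proof (rule X.continuous_map_into_Hom_complex)
        fix v w assume vw: "v \<in> pverts G" "w \<in> pverts H"
        have time: "continuous_map ?P euclideanreal fst"
          using continuous_map_fst continuous_map_in_subtopology by blast
        have coord: "continuous_map ?P euclideanreal (\<lambda>tx. snd tx v w)"
          using continuous_map_compose[OF continuous_map_snd X.continuous_map_coordinate[OF vw], of "top_of_set {0..1}"]
          by (simp add: o_def)
        show "continuous_map ?P euclideanreal (\<lambda>tx. h tx v w)"
        proof (cases "v \<in> pverts G'")
          case True
          then show ?thesis using coord vw by (simp add: h_def)
        next
          case False
          have "continuous_map ?P euclideanreal (\<lambda>tx. (1 - fst tx) * pt w + fst tx * snd tx v w)"
            by (intro continuous_intros time coord) auto
          then show ?thesis using False vw by (simp add: h_def)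
        qed
      qed (use h X.topspace_Hom_complex in auto)
      fix x assume "x \<in> topspace (Hom_complex G H)"
      then have x: "x \<in> hom_points G H" using X.topspace_Hom_complex by auto
      show "h (0, x) = (s \<circ> r) x"
        by (rule ext) (auto simp: h_def s_def r_def pt_def fun_eq_iff)
      show "h (1, x) = id x"
      proof
        fix v
        show "h (1, x) v = id x v"
        proof (cases "v \<in> pverts G")
          case True
          then show ?thesis using hom_pointsD(1)[OF x True]
            by (auto simp: h_def extensional_def fun_eq_iff)
        next
          case False
          then show ?thesis using hom_points_extensional[OF x] by (simp add: h_def extensional_def)
        qed
      qed
    qed simp
  qed
qed

section \<open>The cycle of length four\<close>

lemma contractible_imp_circle_power_0:
  assumes "contractible_space X" "topspace X \<noteq> {}"
  shows "X homotopy_equivalent_space circle_power 0"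
proof -
  obtain x where x: "x \<in> topspace X" using assms(2) by blast
  define y where "y = (\<lambda>_::nat. undefined :: complex)"
  have top: "topspace (circle_power 0) = {y}" by (simp add: circle_power_def y_def)
  have f: "continuous_map X (circle_power 0) (\<lambda>_. y)" and g: "continuous_map (circle_power 0) X (\<lambda>_. x)"
    using x top by auto
  have "homotopic_with (\<lambda>_. True) X X ((\<lambda>_. x) \<circ> (\<lambda>_. y)) id"
    using assms(1) x by (intro homotopic_into_contractible_space) (auto simp: o_def)
  moreover have "homotopic_with (\<lambda>_. True) (circle_power 0) (circle_power 0) ((\<lambda>_. y) \<circ> (\<lambda>_. x)) id"
    by (rule homotopic_with_equal) (use top in \<open>auto simp: o_def\<close>)
  ultimately show ?thesis
    unfolding homotopy_equivalent_space_def using f g by blast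
qed

text \<open>This cycle is the complete bipartite graph on the two parity classes, so adjacency
  depends on parity alone.\<close>

lemma cycle_graph_4_arc: "(i, j) \<in> parcs (cycle_graph 4) \<longleftrightarrow> i < 4 \<and> j < 4 \<and> even i \<noteq> even j"
proof -
  have *: "n = 0 \<or> n = 1 \<or> n = 2 \<or> n = 3" if "n < 4" for n :: nat using that by linarith
  show ?thesis
    using *[of i] *[of j] by (auto simp: cycle_graph_def)
qed

text \<open>A vertex with a neighbour has all its values in one parity class. The set
  \<open>A\<close> of vertices with even values is therefore locally constant, and for fixed
  \<open>A\<close> the coordinates vary freely in simplices, which gives a convex set.\<close>

lemma Hom_cycle_4:
  assumes fin: "finite (pverts G)" and arcs: "parcs G \<subseteq> pverts G \<times> pverts G" and sym: "sym (parcs G)"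
    and nonisolated: "\<And>v. v \<in> pverts G \<Longrightarrow> \<exists>u. (v, u) \<in> parcs G"
  shows "\<exists>(I :: nat set) d. Hom_complex G (cycle_graph 4) homotopy_equivalent_space sum_topology (\<lambda>i. circle_power (d i)) I"
proof -
  let ?H = "cycle_graph 4"
  have H: "pverts ?H = {..<4}" by (simp add: cycle_graph_def)
  interpret hom_complex G ?H by unfold_locales (use fin arcs in \<open>auto simp: H\<close>)
  define Q where "Q A = {x \<in> hom_points G ?H. \<forall>v\<in>pverts G. \<forall>w<4. x v w \<noteq> 0 \<longrightarrow> (even w \<longleftrightarrow> v \<in> A)}" for A
  have parity: "even w \<noteq> even b" if "x \<in> hom_points G ?H" "(v, u) \<in> parcs G" "w < 4" "b < 4" "x v w \<noteq> 0" "x u b \<noteq> 0" for x v u w b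
    using hom_points_adj[OF that(1,2), of w b] that by (auto simp: H cycle_graph_4_arc)
  have same: "even w \<longleftrightarrow> even w'" if x: "x \<in> hom_points G ?H" and v: "v \<in> pverts G" and w: "w < 4" "w' < 4" "x v w \<noteq> 0" "x v w' \<noteq> 0" for x v w w'
  proof -
    obtain u where u: "(v, u) \<in> parcs G" using nonisolated[OF v] by blast
    then have "u \<in> pverts G" using arcs by auto
    then obtain b where "b < 4" "x u b \<noteq> 0" using hom_pointsD(4)[OF x] by (auto simp: H)
    then show ?thesis using parity[OF x u w(1) _ w(3)] parity[OF x u w(2) _ w(4)] by blast
  qed
  have in_Q: "x \<in> Q {v \<in> pverts G. \<exists>w<4. x v w \<noteq> 0 \<and> even w}" if x: "x \<in> hom_points G ?H" for x
    unfolding Q_def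
  proof (intro CollectI conjI x ballI allI impI)
    fix v w assume v: "v \<in> pverts G" and w: "w < 4" "x v w \<noteq> 0"
    show "even w \<longleftrightarrow> v \<in> {v \<in> pverts G. \<exists>w<4. x v w \<noteq> 0 \<and> even w}"
      using v w same[OF x v w(1) _ w(2)] by blast
  qed
  show ?thesis
  \<comment> \<open>Empty classes are dropped because they are not equivalent to a point.\<close>
  proof (rule finite_partition_circle_powers[of "Q ` Pow (pverts G) - {{}}"])
    show "finite (Q ` Pow (pverts G) - {{}})" using fin by auto
    show "topspace (Hom_complex G ?H) = \<Union> (Q ` Pow (pverts G) - {{}})"
      unfolding topspace_Hom_complex
    proof
      show "hom_points G ?H \<subseteq> \<Union> (Q ` Pow (pverts G) - {{}})"
      proof
        fix x assume "x \<in> hom_points G ?H"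
        note x = in_Q[OF this]
        then have "Q {v \<in> pverts G. \<exists>w<4. x v w \<noteq> 0 \<and> even w} \<noteq> {}" by (metis empty_iff)
        then have "Q {v \<in> pverts G. \<exists>w<4. x v w \<noteq> 0 \<and> even w} \<in> Q ` Pow (pverts G) - {{}}"
          by (intro DiffI imageI) simp_all
        then show "x \<in> \<Union> (Q ` Pow (pverts G) - {{}})" using x by (rule UnionI)
      qed
    qed (auto simp: Q_def)
    show "openin (Hom_complex G ?H) C" if "C \<in> Q ` Pow (pverts G) - {{}}" for C
    proof -
      obtain A where A: "C = Q A" using \<open>C \<in> _\<close> by blast
      show ?thesis unfolding A
      proof (rule openin_if_star_closed)
        show "Q A \<subseteq> hom_points G ?H" by (auto simp: Q_def)
        fix x y assume xy: "x \<in> Q A" "y \<in> hom_points G ?H" "refines x y"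
        have "even w \<longleftrightarrow> v \<in> A" if v: "v \<in> pverts G" and w: "w < 4" "y v w \<noteq> 0" for v w
        proof -
          have "x \<in> hom_points G ?H" using xy(1) by (simp add: Q_def)
          from hom_pointsD(4)[OF this v] obtain w' where w': "w' < 4" "x v w' \<noteq> 0" by (auto simp: H)
          then have "y v w' \<noteq> 0" using xy(3) v by (simp add: refines_def H)
          then have "even w \<longleftrightarrow> even w'" using same[OF xy(2) v w(1) w'(1) w(2)] by simp
          then show ?thesis using xy(1) v w' by (auto simp: Q_def)
        qed
        then show "y \<in> Q A" using xy(2) by (auto simp: Q_def)
      qed
    qed
    show "C = C'" if C: "C \<in> Q ` Pow (pverts G) - {{}}" "C' \<in> Q ` Pow (pverts G) - {{}}" "C \<inter> C' \<noteq> {}" for C C'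
    proof -
      obtain A A' where A: "C = Q A" "C' = Q A'" "A \<subseteq> pverts G" "A' \<subseteq> pverts G" using C(1,2) by blast
      obtain x where x: "x \<in> Q A" "x \<in> Q A'" using C(3) A by blast
      have "v \<in> A \<longleftrightarrow> v \<in> A'" if v: "v \<in> pverts G" for v
      proof -
        have "x \<in> hom_points G ?H" using x(1) by (simp add: Q_def)
        from hom_pointsD(4)[OF this v] obtain w where "w < 4" "x v w \<noteq> 0" by (auto simp: H)
        then show ?thesis using x v by (auto simp: Q_def)
      qed
      then have "A = A'" using A(3,4) by blast
      then show ?thesis using A(1,2) by simp
    qed
    show "\<exists>d. subtopology (Hom_complex G ?H) C homotopy_equivalent_space circle_power d" if C: "C \<in> Q ` Pow (pverts G) - {{}}" for C
    proof -
      obtain A x0 where A: "C = Q A" and x0: "x0 \<in> Q A" using C by blast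
      have Qh: "x \<in> Q A \<Longrightarrow> x \<in> hom_points G ?H" for x by (simp add: Q_def)
      define h where "h tx = (\<lambda>v\<in>pverts G. \<lambda>w\<in>pverts ?H. (1 - fst tx) * snd tx v w + fst tx * x0 v w)" for tx :: "real \<times> ('a \<Rightarrow> nat \<Rightarrow> real)"
      have par: "even w \<longleftrightarrow> v \<in> A" if "x \<in> Q A" "v \<in> pverts G" "w < 4" "h (t, x) v w \<noteq> 0" for t x v w
      proof -
        have "x v w \<noteq> 0 \<or> x0 v w \<noteq> 0" using that by (auto simp: h_def H)
        then show ?thesis using that(1-3) x0 by (auto simp: Q_def)
      qed
      have h: "h (t, x) \<in> Q A" if t: "t \<in> {0..1}" and x: "x \<in> Q A" for t x
      proof -
        have "h (t, x) \<in> hom_points G ?H"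
        proof (rule hom_pointsI)
          fix u v a b assume *: "(u, v) \<in> parcs G" "a \<in> pverts ?H" "b \<in> pverts ?H" "h (t, x) u a \<noteq> 0" "h (t, x) v b \<noteq> 0"
          have V: "u \<in> pverts G" "v \<in> pverts G" using *(1) arcs by auto
          obtain a' where a': "a' < 4" "x0 u a' \<noteq> 0" using hom_pointsD(4)[OF Qh[OF x0] V(1)] by (auto simp: H)
          obtain b' where b': "b' < 4" "x0 v b' \<noteq> 0" using hom_pointsD(4)[OF Qh[OF x0] V(2)] by (auto simp: H)
          have "even a' \<noteq> even b'" using parity[OF Qh[OF x0] *(1) a'(1) b'(1) a'(2) b'(2)] .
          moreover have "even a' \<longleftrightarrow> u \<in> A" "even b' \<longleftrightarrow> v \<in> A" using x0 V a' b' by (auto simp: Q_def)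
          ultimately show "(a, b) \<in> parcs ?H"
            using par[OF x V(1) _ *(4)] par[OF x V(2) _ *(5)] *(2,3) by (simp add: cycle_graph_4_arc H)
        next
          show "0 \<le> h (t, x) v w" if "v \<in> pverts G" "w \<in> pverts ?H" for v w
            using hom_pointsD(2)[OF Qh[OF x] that] hom_pointsD(2)[OF Qh[OF x0] that] t that by (simp add: h_def)
          show "(\<Sum>w\<in>pverts ?H. h (t, x) v w) = 1" if "v \<in> pverts G" for v
            using hom_pointsD(3)[OF Qh[OF x] that] hom_pointsD(3)[OF Qh[OF x0] that] that
            by (simp add: h_def sum.distrib flip: sum_distrib_left)
        qed (simp_all add: h_def)
        then show ?thesis using par[OF x] by (auto simp: Q_def)
      qed
      let ?X = "subtopology (Hom_complex G ?H) (Q A)"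
      have top: "topspace ?X = Q A" using Qh by (auto simp: topspace_Hom_complex)
      have "homotopic_with (\<lambda>_. True) ?X ?X id (\<lambda>_. x0)"
      proof (subst homotopic_with, simp, intro exI conjI ballI)
        let ?P = "prod_topology (top_of_set {0..1::real}) ?X"
        show "continuous_map ?P ?X h"
          unfolding continuous_map_in_subtopology
        proof (intro conjI continuous_map_into_Hom_complex)
          fix v w assume vw: "v \<in> pverts G" "w \<in> pverts ?H"
          have time: "continuous_map ?P euclideanreal fst"
            using continuous_map_fst continuous_map_in_subtopology by blast
          have coord: "continuous_map ?P euclideanreal (\<lambda>tx. snd tx v w)"
            using continuous_map_compose[OF continuous_map_snd continuous_map_from_subtopology[OF continuous_map_coordinate[OF vw]], of "top_of_set {0..1}"]
            by (simp add: o_def)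
          have "continuous_map ?P euclideanreal (\<lambda>tx. (1 - fst tx) * snd tx v w + fst tx * x0 v w)"
            by (intro continuous_intros time coord) auto
          then show "continuous_map ?P euclideanreal (\<lambda>tx. h tx v w)" using vw by (simp add: h_def)
        qed (use h Qh top in auto)
        fix x assume "x \<in> topspace ?X"
        then have x: "x \<in> hom_points G ?H" using top Qh by auto
        have eq: "y = (\<lambda>v\<in>pverts G. \<lambda>w\<in>pverts ?H. y v w)" if y: "y \<in> hom_points G ?H" for y
          using hom_points_extensional[OF y] hom_pointsD(1)[OF y] by (auto simp: extensional_def fun_eq_iff)
        show "h (0, x) = id x" using eq[OF x] by (simp add: h_def)
        show "h (1, x) = x0" using eq[OF Qh[OF x0]] by (simp add: h_def)
      qed simp
      then have "contractible_space ?X" unfolding contractible_space_def by blast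
      moreover have "topspace ?X \<noteq> {}" using top x0 by blast
      ultimately show ?thesis unfolding A by (intro exI[of _ 0] contractible_imp_circle_power_0)
    qed
  qed
qed

section \<open>Maps into a cycle of length other than four\<close>

definition interpolate :: "(int \<Rightarrow> real) \<Rightarrow> real \<Rightarrow> real" where
  "interpolate F t = (1 - frac t) * F \<lfloor>t\<rfloor> + frac t * F (\<lfloor>t\<rfloor> + 1)"

text \<open>At the right end \<open>interpolate\<close> uses the next pair of integers but has the
  same value. Including this end allows pasting over closed intervals.\<close>

lemma interpolate_unit:
  assumes "of_int m \<le> t" "t \<le> of_int m + 1"
  shows "interpolate F t = (1 - (t - of_int m)) * F m + (t - of_int m) * F (m + 1)"
proof (cases "t = of_int m + 1")
  case True
  then show ?thesis by (simp add: interpolate_def)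
next
  case False
  then have "\<lfloor>t\<rfloor> = m" using assms by (intro floor_unique) auto
  then show ?thesis by (simp add: interpolate_def frac_def)
qed

lemma continuous_on_interpolate: "continuous_on S (interpolate F)"
proof (rule continuous_on_unit_intervals)
  fix n :: int
  have "continuous_on {of_int n..of_int n + 1} (\<lambda>t. (1 - (t - of_int n)) * F n + (t - of_int n) * F (n + 1))"
    by (intro continuous_intros)
  then show "continuous_on {of_int n..of_int n + 1} (interpolate F)"
    by (rule continuous_on_eq) (rule interpolate_unit[symmetric]; simp)
qed

lemma ceiling_if_frac: "\<lceil>t\<rceil> = (if frac t = 0 then \<lfloor>t\<rfloor> else \<lfloor>t\<rfloor> + 1)" for t :: real
  by (auto simp: frac_def ceiling_altdef)

lemma cycle_graph_arc_mod:
  assumes "k > 0"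
  shows "(nat (a mod int k), nat (b mod int k)) \<in> parcs (cycle_graph k) \<longleftrightarrow> int k dvd b - a - 1 \<or> int k dvd a - b - 1"
proof -
  have *: "nat (b mod int k) = Suc (nat (a mod int k)) mod k \<longleftrightarrow> int k dvd b - a - 1" for a b
  proof -
    have int_nat: "int (nat (c mod int k)) = c mod int k" for c
      using assms by simp
    have "int (Suc (nat (a mod int k)) mod k) = (int (nat (a mod int k)) + 1) mod int k"
      by (simp only: zmod_int of_nat_Suc add.commute)
    then have "nat (b mod int k) = Suc (nat (a mod int k)) mod k \<longleftrightarrow> b mod int k = (a mod int k + 1) mod int k"
      unfolding int_nat using int_nat[of b] by (metis of_nat_eq_iff)
    also have "\<dots> \<longleftrightarrow> b mod int k = (a + 1) mod int k" by (simp add: mod_add_left_eq)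
    also have "\<dots> \<longleftrightarrow> int k dvd b - a - 1" by (simp add: mod_eq_dvd_iff algebra_simps)
    finally show ?thesis .
  qed
  have "nat (a mod int k) < k" "nat (b mod int k) < k" using assms by (simp_all add: nat_less_iff)
  then show ?thesis unfolding cycle_graph_def using *[of b a] *[of a b] by simp
qed

lemma cycle_graph_arc_sym: "(i, j) \<in> parcs (cycle_graph k) \<Longrightarrow> (j, i) \<in> parcs (cycle_graph k)"
  by (auto simp: cycle_graph_def)

section \<open>Heights relative to a homomorphism into the cycle\<close>

locale cycle_hom =
  fixes G :: "'a pair_pre_digraph" and k :: nat and f :: "'a \<Rightarrow> nat"
  assumes finite_pverts: "finite (pverts G)" and parcs_sub: "parcs G \<subseteq> pverts G \<times> pverts G"
    and sym_parcs: "sym (parcs G)"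
    and nonisolated: "v \<in> pverts G \<Longrightarrow> \<exists>u. (v, u) \<in> parcs G"
    and k: "k \<ge> 3" "k \<noteq> 4"
    and f_less: "v \<in> pverts G \<Longrightarrow> f v < k"
    and f_hom: "(u, v) \<in> parcs G \<Longrightarrow> (f u, f v) \<in> parcs (cycle_graph k)"
begin

text \<open>The additive order of 2 modulo \<open>k\<close>: adding 2 repeatedly returns to the same
  vertex of the cycle after exactly this many steps.\<close>

definition period :: int where
  "period = (if even k then int k div 2 else int k)"

definition up_arcs :: "('a \<times> 'a) set" where
  "up_arcs = {(v, u) \<in> parcs G. f u = Suc (f v) mod k}"

lemma period_ge: "period \<ge> 3"
proof (cases "even k")
  case True
  then obtain j where "k = 2 * j" by blast
  then show ?thesis unfolding period_def using k by simp
qed (use k in \<open>simp add: period_def\<close>)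

lemma period_dvd: "int k dvd 2 * n \<longleftrightarrow> period dvd n"
proof (cases "even k")
  case True
  then obtain j where "k = 2 * j" by blast
  then show ?thesis unfolding period_def by simp
next
  case False
  then have "coprime (int k) 2" by simp
  then show ?thesis using False by (simp add: period_def coprime_dvd_mult_right_iff)
qed

sublocale height_space "pverts G" up_arcs period
  by unfold_locales (use finite_pverts parcs_sub period_ge in \<open>auto simp: up_arcs_def\<close>)

lemma pverts_cycle: "pverts (cycle_graph k) = {..<k}"
  by (simp add: cycle_graph_def)

sublocale hom_complex G "cycle_graph k"
  by unfold_locales (use finite_pverts parcs_sub in \<open>auto simp: pverts_cycle\<close>)

lemma up_or_down: "(u, v) \<in> parcs G \<Longrightarrow> (u, v) \<in> up_arcs \<or> (v, u) \<in> up_arcs"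
  using f_hom[of u v] sym_parcs by (auto simp: up_arcs_def cycle_graph_def dest: symD)

lemma up_arcs_parcs: "(v, u) \<in> up_arcs \<Longrightarrow> (v, u) \<in> parcs G"
  by (simp add: up_arcs_def)

definition pos :: "'a \<Rightarrow> int \<Rightarrow> nat" where
  "pos v n = nat ((int (f v) + 2 * n) mod int k)"

lemma pos_less: "pos v n < k"
  using k by (simp add: pos_def nat_less_iff)

lemma pos_zero: "v \<in> pverts G \<Longrightarrow> pos v 0 = f v"
  using f_less by (simp add: pos_def nat_mod_distrib)

lemma pos_eq_iff: "pos v n = pos v m \<longleftrightarrow> period dvd n - m"
proof -
  have "pos v n = pos v m \<longleftrightarrow> (int (f v) + 2 * n) mod int k = (int (f v) + 2 * m) mod int k"
    using k by (simp add: pos_def eq_nat_nat_iff)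
  also have "\<dots> \<longleftrightarrow> int k dvd 2 * (n - m)" by (simp add: mod_eq_dvd_iff algebra_simps)
  finally show ?thesis unfolding period_dvd .
qed

text \<open>Modulo \<open>k\<close> the two values differ by 1 + 2(n - m), which has to be 1 or -1;
  halving the resulting conditions replaces \<open>k\<close> by the period.\<close>

lemma pos_adj_iff:
  assumes "(v, u) \<in> up_arcs"
  shows "(pos v m, pos u n) \<in> parcs (cycle_graph k) \<longleftrightarrow> period dvd n - m \<or> period dvd n - m + 1"
proof -
  have "int (f u) = (int (f v) + 1) mod int k"
    using assms by (simp add: up_arcs_def zmod_int add.commute)
  then have "pos u n = nat ((int (f v) + 1 + 2 * n) mod int k)"
    by (simp add: pos_def mod_add_left_eq)
  then have "(pos v m, pos u n) \<in> parcs (cycle_graph k) \<longleftrightarrow>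
      int k dvd int (f v) + 1 + 2 * n - (int (f v) + 2 * m) - 1 \<or>
      int k dvd int (f v) + 2 * m - (int (f v) + 1 + 2 * n) - 1"
    using k cycle_graph_arc_mod[of k "int (f v) + 2 * m" "int (f v) + 1 + 2 * n"] by (simp only: pos_def)
  also have "int (f v) + 1 + 2 * n - (int (f v) + 2 * m) - 1 = 2 * (n - m)" by simp
  also have "int (f v) + 2 * m - (int (f v) + 1 + 2 * n) - 1 = - (2 * (n - m + 1))" by simp
  finally show ?thesis by (simp only: dvd_minus_iff period_dvd)
qed

text \<open>In this window congruence modulo the period already gives equality. Period 2 would also
  admit \<open>-2\<close> and \<open>1\<close>.\<close>

lemma period_dvd_small:
  assumes "period dvd d \<or> period dvd d + 1" "-2 \<le> d" "d \<le> 1"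
  shows "d = 0 \<or> d = -1"
proof -
  have "\<not> period dvd 1" "\<not> period dvd 2" "\<not> period dvd -1" "\<not> period dvd -2"
    using period_ge zdvd_imp_le[of period 1] zdvd_imp_le[of period 2] by auto
  moreover have "d = -2 \<or> d = -1 \<or> d = 0 \<or> d = 1" using assms by linarith
  ultimately show ?thesis using assms(1) by auto
qed

lemma pos_neq: "pos v n \<noteq> pos v (n + 1)" "pos v (n + 1) \<noteq> pos v (n - 1)"
  using period_ge zdvd_imp_le[of period 1] zdvd_imp_le[of period 2] by (auto simp: pos_eq_iff)

text \<open>An integral height n at \<open>v\<close> stands for the single value
  \<open>pos v n\<close>; between two integers the weight is divided linearly, so unit cells of
  heights map to cells of the complex.\<close>

definition realize :: "('a \<Rightarrow> real) \<Rightarrow> 'a \<Rightarrow> nat \<Rightarrow> real" where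
  "realize b = (\<lambda>v\<in>pverts G. \<lambda>w\<in>{..<k}. interpolate (\<lambda>n. if pos v n = w then 1 else 0) (b v))"

lemma realize_unit:
  assumes "v \<in> pverts G" "w < k" "of_int m \<le> b v" "b v \<le> of_int m + 1"
  shows "realize b v w = (1 - (b v - of_int m)) * (if pos v m = w then 1 else 0) + (b v - of_int m) * (if pos v (m + 1) = w then 1 else 0)"
  using assms interpolate_unit[OF assms(3,4)] by (simp add: realize_def)

lemma realize_nonzero_iff:
  assumes "v \<in> pverts G" "w < k"
  shows "realize b v w \<noteq> 0 \<longleftrightarrow> (\<exists>n. \<lfloor>b v\<rfloor> \<le> n \<and> n \<le> \<lceil>b v\<rceil> \<and> w = pos v n)"
proof -
  have 1: "0 < 1 - frac (b v)" "0 \<le> frac (b v)" using frac_lt_1[of "b v"] by simp_all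
  have "realize b v w = (1 - frac (b v)) * (if pos v \<lfloor>b v\<rfloor> = w then 1 else 0) + frac (b v) * (if pos v (\<lfloor>b v\<rfloor> + 1) = w then 1 else 0)"
    using assms by (simp add: realize_def interpolate_def)
  also have "\<dots> \<noteq> 0 \<longleftrightarrow> w = pos v \<lfloor>b v\<rfloor> \<or> (frac (b v) \<noteq> 0 \<and> w = pos v (\<lfloor>b v\<rfloor> + 1))"
    using 1 pos_neq(1)[of v "\<lfloor>b v\<rfloor>"] by auto
  also have "\<dots> \<longleftrightarrow> (\<exists>n. \<lfloor>b v\<rfloor> \<le> n \<and> n \<le> \<lceil>b v\<rceil> \<and> w = pos v n)"
  proof (cases "frac (b v) = 0")
    case True
    then have "\<lfloor>b v\<rfloor> \<le> n \<and> n \<le> \<lceil>b v\<rceil> \<longleftrightarrow> n = \<lfloor>b v\<rfloor>" for n unfolding ceiling_if_frac by auto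
    then show ?thesis using True by metis
  next
    case False
    then have "\<lfloor>b v\<rfloor> \<le> n \<and> n \<le> \<lceil>b v\<rceil> \<longleftrightarrow> n = \<lfloor>b v\<rfloor> \<or> n = \<lfloor>b v\<rfloor> + 1" for n unfolding ceiling_if_frac by auto
    then show ?thesis using False by metis
  qed
  finally show ?thesis .
qed

lemma realize_hom_points:
  assumes b: "b \<in> heights"
  shows "realize b \<in> hom_points G (cycle_graph k)"
proof (rule hom_pointsI)
  show "0 \<le> realize b v w" if "v \<in> pverts G" "w \<in> pverts (cycle_graph k)" for v w
    using that less_imp_le[OF frac_lt_1[of "b v"]] by (simp add: realize_def interpolate_def pverts_cycle)
  show "(\<Sum>w\<in>pverts (cycle_graph k). realize b v w) = 1" if "v \<in> pverts G" for v
    using that pos_less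
    by (simp add: realize_def interpolate_def pverts_cycle sum.distrib flip: sum_distrib_left)
  fix u v x y
  assume *: "(u, v) \<in> parcs G" "x \<in> pverts (cycle_graph k)" "y \<in> pverts (cycle_graph k)" "realize b u x \<noteq> 0" "realize b v y \<noteq> 0"
  then have V: "u \<in> pverts G" "v \<in> pverts G" "x < k" "y < k" using parcs_sub by (auto simp: pverts_cycle)
  obtain m where m: "\<lfloor>b u\<rfloor> \<le> m" "m \<le> \<lceil>b u\<rceil>" "x = pos u m" using realize_nonzero_iff[OF V(1,3)] *(4) by blast
  obtain n where n: "\<lfloor>b v\<rfloor> \<le> n" "n \<le> \<lceil>b v\<rceil>" "y = pos v n" using realize_nonzero_iff[OF V(2,4)] *(5) by blast
  have adj: "(pos v n, pos u m) \<in> parcs (cycle_graph k)"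
    if "(v, u) \<in> up_arcs" "\<lfloor>b u\<rfloor> \<le> m" "m \<le> \<lceil>b u\<rceil>" "\<lfloor>b v\<rfloor> \<le> n" "n \<le> \<lceil>b v\<rceil>" for v u m n
  proof -
    have "m - n = 0 \<or> m - n + 1 = 0"
      using heights_arc[OF b that(1)] that(2-5) unfolding arc_ok_def by linarith
    then show ?thesis unfolding pos_adj_iff[OF that(1)] by (metis dvd_0_right)
  qed
  show "(x, y) \<in> parcs (cycle_graph k)"
    using up_or_down[OF *(1)] adj[of v u m n] adj[of u v n m] m n cycle_graph_arc_sym by blast
qed (auto simp: realize_def pverts_cycle)

lemma continuous_map_realize: "continuous_map (top_of_set heights0) (Hom_complex G (cycle_graph k)) realize"
proof (rule continuous_map_into_Hom_complex)
  show "realize b \<in> hom_points G (cycle_graph k)" if "b \<in> topspace (top_of_set heights0)" for b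
    using that realize_hom_points heights0_heights by auto
  fix v w assume vw: "v \<in> pverts G" "w \<in> pverts (cycle_graph k)"
  have "continuous_on heights0 (\<lambda>b. interpolate (\<lambda>n. if pos v n = w then 1 else 0) (b v))"
    by (rule continuous_on_compose2[OF continuous_on_interpolate[of UNIV] continuous_on_coord]) simp
  then show "continuous_map (top_of_set heights0) euclideanreal (\<lambda>b. realize b v w)"
    using vw by (simp add: realize_def pverts_cycle)
qed

text \<open>The positions of m and m + 1 cannot be read in the reverse order, since the period does
  not divide 2. Hence the point determines the floor modulo the period, and the weight there
  determines the fractional part.\<close>

lemma realize_eq_vertex_iff:
  assumes v: "v \<in> pverts G"
  shows "realize b v = realize b' v \<longleftrightarrow> (\<exists>n. b v = b' v + of_int (period * n))"
proof
  have pos_shift: "pos v (i + period * n) = pos v i" for i n by (simp add: pos_eq_iff)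
  show "realize b v = realize b' v" if "\<exists>n. b v = b' v + of_int (period * n)"
  proof -
    obtain n where n: "b v = b' v + of_int (period * n)" using \<open>\<exists>n. b v = b' v + of_int (period * n)\<close> by blast
    have "frac (b v) = frac (b' v)" unfolding n by (simp add: frac_def)
    moreover have "\<lfloor>b v\<rfloor> = \<lfloor>b' v\<rfloor> + period * n" unfolding n by (simp only: floor_add_int)
    moreover have "pos v (\<lfloor>b' v\<rfloor> + period * n + 1) = pos v (\<lfloor>b' v\<rfloor> + 1)"
      using pos_shift[of "\<lfloor>b' v\<rfloor> + 1" n] by (simp add: algebra_simps)
    ultimately show ?thesis using v by (simp add: realize_def interpolate_def pos_shift)
  qed
  assume eq: "realize b v = realize b' v"
  have val0: "realize c v (pos v \<lfloor>c v\<rfloor>) = 1 - frac (c v)" for c :: "'a \<Rightarrow> real"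
    using v pos_less[of v] pos_neq(1)[of v "\<lfloor>c v\<rfloor>"] by (simp add: realize_def interpolate_def)
  have supp: "pos v i = pos v \<lfloor>b v\<rfloor> \<or> (frac (b v) \<noteq> 0 \<and> pos v i = pos v (\<lfloor>b v\<rfloor> + 1))"
    if "\<lfloor>b' v\<rfloor> \<le> i" "i \<le> \<lceil>b' v\<rceil>" for i
  proof -
    have "realize b v (pos v i) \<noteq> 0"
      unfolding eq realize_nonzero_iff[OF v pos_less] using that by blast
    then obtain n where "\<lfloor>b v\<rfloor> \<le> n" "n \<le> \<lceil>b v\<rceil>" "pos v i = pos v n"
      unfolding realize_nonzero_iff[OF v pos_less] by blast
    moreover from this have "n = \<lfloor>b v\<rfloor> \<or> (frac (b v) \<noteq> 0 \<and> n = \<lfloor>b v\<rfloor> + 1)"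
      unfolding ceiling_if_frac by (auto split: if_splits)
    ultimately show ?thesis by auto
  qed
  have "pos v \<lfloor>b' v\<rfloor> = pos v \<lfloor>b v\<rfloor>"
  proof (rule ccontr)
    assume neq: "pos v \<lfloor>b' v\<rfloor> \<noteq> pos v \<lfloor>b v\<rfloor>"
    then have 1: "frac (b v) \<noteq> 0" "pos v \<lfloor>b' v\<rfloor> = pos v (\<lfloor>b v\<rfloor> + 1)"
      using supp[of "\<lfloor>b' v\<rfloor>"] by auto
    show False
    proof (cases "frac (b' v) = 0")
      case True
      \<comment> \<open>An integral \<open>b' v\<close> puts all the weight on one position, but
        \<open>b\<close> gives that position only \<open>frac (b v)\<close>, which is less than
        1.\<close>
      have "realize b v (pos v (\<lfloor>b v\<rfloor> + 1)) = 1" using val0[of b'] True 1(2) eq by simp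
      then have "frac (b v) = 1"
        using v pos_less[of v] pos_neq(1)[of v "\<lfloor>b v\<rfloor>"] by (simp add: realize_def interpolate_def)
      then show False using frac_lt_1[of "b v"] by simp
    next
      case False
      then have "pos v (\<lfloor>b' v\<rfloor> + 1) = pos v \<lfloor>b v\<rfloor> \<or> pos v (\<lfloor>b' v\<rfloor> + 1) = pos v (\<lfloor>b v\<rfloor> + 1)"
        using supp[of "\<lfloor>b' v\<rfloor> + 1"] by (auto simp: ceiling_if_frac)
      then show False
      proof
        assume "pos v (\<lfloor>b' v\<rfloor> + 1) = pos v \<lfloor>b v\<rfloor>"
        from dvd_diff[OF this[unfolded pos_eq_iff] 1(2)[unfolded pos_eq_iff]]
        show False using period_ge zdvd_imp_le[of period 2] by simp
      next
        assume "pos v (\<lfloor>b' v\<rfloor> + 1) = pos v (\<lfloor>b v\<rfloor> + 1)"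
        then show False using 1(2) pos_neq(1)[of v "\<lfloor>b' v\<rfloor>"] by simp
      qed
    qed
  qed
  then obtain n where n: "\<lfloor>b v\<rfloor> - \<lfloor>b' v\<rfloor> = period * n" unfolding pos_eq_iff by (metis dvd_def dvd_minus_iff minus_diff_eq)
  have "frac (b v) = frac (b' v)"
    using val0[of b] val0[of b'] eq \<open>pos v \<lfloor>b' v\<rfloor> = pos v \<lfloor>b v\<rfloor>\<close> by simp
  then have "b v = b' v + of_int (\<lfloor>b v\<rfloor> - \<lfloor>b' v\<rfloor>)" by (simp add: frac_def)
  then show "\<exists>n. b v = b' v + of_int (period * n)" unfolding n by blast
qed

text \<open>Each vertex has its own multiple of the period at first. Along an arc both functions
  drop by an amount between 0 and 1, so the two multiples differ by at most 1 in height, less than a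
  period, and must agree; hence they are constant on components.\<close>

lemma realize_eq_iff:
  assumes b: "b \<in> heights0" "b' \<in> heights0"
  shows "realize b = realize b' \<longleftrightarrow> (\<exists>n. \<forall>v. b v = b' v + shift n v)"
proof
  assume "\<exists>n. \<forall>v. b v = b' v + shift n v"
  then obtain n where n: "b v = b' v + shift n v" for v by blast
  have "realize b v = realize b' v" if "v \<in> pverts G" for v
    unfolding realize_eq_vertex_iff[OF that] using n[of v] that by (auto simp: shift_def)
  moreover have "realize b v = realize b' v" if "v \<notin> pverts G" for v
    using that by (simp add: realize_def)
  ultimately show "realize b = realize b'" by blast
next
  assume eq: "realize b = realize b'"
  have "\<forall>v\<in>pverts G. \<exists>n. b v = b' v + of_int (period * n)"
    using realize_eq_vertex_iff[of _ b b'] eq by simp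
  from bchoice[OF this] obtain n where n: "\<forall>v\<in>pverts G. b v = b' v + of_int (period * n v)" by blast
  have const: "n v = n u" if vu: "(v, u) \<in> up_arcs" for v u
  proof -
    have V: "v \<in> pverts G" "u \<in> pverts G" using D_V[OF vu] .
    have "0 \<le> b v - b u" "b v - b u \<le> 1" "0 \<le> b' v - b' u" "b' v - b' u \<le> 1"
      using arc_ok_diff[OF heights_arc[OF heights0_heights[OF b(1)] vu]]
        arc_ok_diff[OF heights_arc[OF heights0_heights[OF b(2)] vu]] by auto
    moreover have "b v - b u = b' v - b' u + of_int (period * (n v - n u))"
      using n V by (simp add: right_diff_distrib)
    ultimately have "of_int (period * (n v - n u)) \<le> (1::real)" "(- 1::real) \<le> of_int (period * (n v - n u))"
      by linarith+
    then have le: "\<bar>period * (n v - n u)\<bar> \<le> 1" by linarith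
    show ?thesis
    proof (rule ccontr)
      assume "n v \<noteq> n u"
      then have "1 \<le> \<bar>n v - n u\<bar>" by linarith
      then have "3 * 1 \<le> \<bar>period\<bar> * \<bar>n v - n u\<bar>" using period_ge by (intro mult_mono) auto
      then show False using le by (simp add: abs_mult)
    qed
  qed
  have related: "n v = n u" if "(v, u) \<in> (up_arcs \<union> up_arcs\<inverse>)\<^sup>*" for v u
    using that by (induction rule: rtrancl_induct) (auto dest: const)
  have "b v = b' v + shift n v" for v
  proof (cases "v \<in> pverts G")
    case True
    then show ?thesis using n related[OF rep_related[of v]] by (simp add: shift_def)
  next
    case False
    then show ?thesis
      using heights_outside[OF heights0_heights[OF b(1)] False] heights_outside[OF heights0_heights[OF b(2)] False]
      by (simp add: shift_def)
  qed
  then show "\<exists>n. \<forall>v. b v = b' v + shift n v" by blast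
qed

section \<open>Lifting points of neighbouring cells\<close>

lemma two_point_weights:
  assumes x: "x \<in> hom_points G (cycle_graph k)" and v: "v \<in> pverts G"
    and supp: "\<And>w. w < k \<Longrightarrow> x v w \<noteq> 0 \<Longrightarrow> w = pos v m \<or> w = pos v (m + 1)"
  shows "x v (pos v m) + x v (pos v (m + 1)) = 1"
    and "b v = of_int m + x v (pos v (m + 1)) \<Longrightarrow> realize b v = x v"
proof -
  have "(\<Sum>w<k. x v w) = (\<Sum>w\<in>{pos v m, pos v (m + 1)}. x v w)"
    using supp pos_less by (intro sum.mono_neutral_right) auto
  then show sum1: "x v (pos v m) + x v (pos v (m + 1)) = 1"
    using hom_pointsD(3)[OF x v] pos_neq(1)[of v m] by (simp add: pverts_cycle)
  assume b: "b v = of_int m + x v (pos v (m + 1))"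
  have nonneg: "0 \<le> x v (pos v i)" for i
    using hom_pointsD(2)[OF x v] pos_less by (simp add: pverts_cycle)
  have rng: "of_int m \<le> b v" "b v \<le> of_int m + 1"
    using b nonneg[of m] nonneg[of "m + 1"] sum1 by linarith+
  show "realize b v = x v"
  proof
    fix w
    show "realize b v w = x v w"
    proof (cases "w < k")
      case True
      have "realize b v w = x v (pos v m) * (if pos v m = w then 1 else 0) + x v (pos v (m + 1)) * (if pos v (m + 1) = w then 1 else 0)"
        using realize_unit[of v w m b, OF v True rng] b sum1 by simp
      also have "\<dots> = x v w"
        using supp[OF True] pos_neq(1)[of v m] by auto
      finally show ?thesis .
    next
      case False
      then show ?thesis
        using v hom_pointsD(1)[OF x v] by (simp add: realize_def extensional_def pverts_cycle)
    qed
  qed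
qed

lemma realize_eqI:
  assumes "x \<in> hom_points G (cycle_graph k)" "\<And>v. v \<in> pverts G \<Longrightarrow> realize b v = x v"
  shows "realize b = x"
proof
  fix v
  show "realize b v = x v"
    using assms hom_points_extensional[OF assms(1)] by (cases "v \<in> pverts G") (auto simp: realize_def extensional_def)
qed

text \<open>The supports of \<open>x\<close> lie among the positions of the closed unit cell of
  \<open>b'\<close>, so its weights prescribe heights inside that cell, which belongs to
  \<open>heights0\<close> by \<open>heights0_refine\<close>. An integral \<open>b' v\<close> allows
  one position only and is kept.\<close>

lemma lift_face:
  assumes b': "b' \<in> heights0" and x: "x \<in> hom_points G (cycle_graph k)" and ref: "refines x (realize b')"
  shows "x \<in> realize ` heights0"
proof -
  define b where "b v = (if v \<notin> pverts G then 0 else if frac (b' v) = 0 then b' v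
      else of_int \<lfloor>b' v\<rfloor> + x v (pos v (\<lfloor>b' v\<rfloor> + 1)))" for v
  have supp: "w = pos v \<lfloor>b' v\<rfloor> \<or> (frac (b' v) \<noteq> 0 \<and> w = pos v (\<lfloor>b' v\<rfloor> + 1))"
    if v: "v \<in> pverts G" and w: "w < k" "x v w \<noteq> 0" for v w
  proof -
    have "realize b' v w \<noteq> 0" using ref v w by (simp add: refines_def pverts_cycle)
    then obtain n where "\<lfloor>b' v\<rfloor> \<le> n" "n \<le> \<lceil>b' v\<rceil>" "w = pos v n"
      unfolding realize_nonzero_iff[OF v w(1)] by blast
    moreover from this have "n = \<lfloor>b' v\<rfloor> \<or> (frac (b' v) \<noteq> 0 \<and> n = \<lfloor>b' v\<rfloor> + 1)"
      unfolding ceiling_if_frac by (auto split: if_splits)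
    ultimately show ?thesis by auto
  qed
  have weights: "x v (pos v \<lfloor>b' v\<rfloor>) + x v (pos v (\<lfloor>b' v\<rfloor> + 1)) = 1"
    and real: "b v = of_int \<lfloor>b' v\<rfloor> + x v (pos v (\<lfloor>b' v\<rfloor> + 1)) \<Longrightarrow> realize b v = x v"
    if v: "v \<in> pverts G" for v
    using two_point_weights(1)[OF x v, where m = "\<lfloor>b' v\<rfloor>"]
      two_point_weights(2)[OF x v, where m = "\<lfloor>b' v\<rfloor>" and b = b] supp[OF v] by blast+
  have nonneg: "0 \<le> x v (pos v i)" if "v \<in> pverts G" for v i
    using hom_pointsD(2)[OF x that] pos_less by (simp add: pverts_cycle)
  have b_eq: "b v = of_int \<lfloor>b' v\<rfloor> + x v (pos v (\<lfloor>b' v\<rfloor> + 1))" if v: "v \<in> pverts G" for v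
  proof (cases "frac (b' v) = 0")
    case True
    have "x v (pos v (\<lfloor>b' v\<rfloor> + 1)) = 0"
      using supp[OF v pos_less[of v "\<lfloor>b' v\<rfloor> + 1"]] True pos_neq(1)[of v "\<lfloor>b' v\<rfloor>"] by auto
    then show ?thesis using True v by (simp add: b_def frac_def)
  qed (use v in \<open>simp add: b_def\<close>)
  have "b \<in> heights0"
  proof (rule heights0_refine[OF b'])
    fix v
    show "of_int \<lfloor>b' v\<rfloor> \<le> b v \<and> b v \<le> of_int \<lceil>b' v\<rceil>"
    proof (cases "v \<in> pverts G \<and> frac (b' v) \<noteq> 0")
      case True
      then show ?thesis
        using b_eq[of v] weights[of v] nonneg[of v "\<lfloor>b' v\<rfloor>"] nonneg[of v "\<lfloor>b' v\<rfloor> + 1"] by (simp add: ceiling_if_frac)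
    next
      case False
      then show ?thesis
        using heights_outside[OF heights0_heights[OF b'], of v] by (auto simp: b_def)
    qed
  qed
  moreover have "realize b = x" using x real b_eq by (intro realize_eqI) auto
  ultimately show ?thesis by blast
qed

text \<open>As every vertex has a neighbour, the values at it of a point in a larger cell are
  among $c - 1$ and $c + 1$ for a vertex $c$ of the cycle; since the period is at least three,
  this determines the lift.\<close>

lemma lift_coface:
  assumes b: "b \<in> heights0" and y: "y \<in> hom_points G (cycle_graph k)" and ref: "refines (realize b) y"
  shows "y \<in> realize ` heights0"
proof -
  have supp_b: "y v (pos v n) \<noteq> 0" if "v \<in> pverts G" "\<lfloor>b v\<rfloor> \<le> n" "n \<le> \<lceil>b v\<rceil>" for v n
    using ref that realize_nonzero_iff[OF that(1) pos_less] pos_less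
    unfolding refines_def pverts_cycle by (metis lessThan_iff)
  have "\<forall>v\<in>pverts G. \<exists>m. (\<forall>w<k. y v w \<noteq> 0 \<longrightarrow> w = pos v m \<or> w = pos v (m + 1)) \<and> of_int m \<le> b v \<and> b v \<le> of_int m + 1"
  proof
    fix v assume v: "v \<in> pverts G"
    obtain u where u: "(v, u) \<in> parcs G" using nonisolated[OF v] by blast
    then have "u \<in> pverts G" using parcs_sub by auto
    then obtain c where c: "c < k" "y u c \<noteq> 0" using hom_pointsD(4)[OF y] by (auto simp: pverts_cycle)
    define m0 where "m0 = \<lfloor>b v\<rfloor>"
    have near: "int k dvd int w - int c - 1 \<or> int k dvd int w - int c + 1" if "w < k" "y v w \<noteq> 0" for w
    proof -
      have "(w, c) \<in> parcs (cycle_graph k)"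
        using hom_points_adj[OF y u, of w c] that c by (simp add: pverts_cycle)
      then have "int k dvd int c - int w - 1 \<or> int k dvd int w - int c - 1"
        using cycle_graph_arc_mod[of k "int w" "int c"] that(1) c(1) by simp
      then show ?thesis
        using dvd_minus_iff[of "int k" "int c - int w - 1"] by (auto simp: algebra_simps)
    qed
    have pos_eqI: "w = pos v i" if "w < k" "int k dvd int w - (int (f v) + 2 * i)" for w i
    proof -
      have "int w mod int k = (int (f v) + 2 * i) mod int k" using that(2) by (simp add: mod_eq_dvd_iff)
      then show ?thesis using that(1) by (simp add: pos_def flip: zmod_int)
    qed
    have same: "int k dvd int (pos v i) - (int (f v) + 2 * i)" for i
      using k by (simp add: pos_def flip: mod_eq_dvd_iff)
    have m0: "y v (pos v m0) \<noteq> 0" using supp_b[OF v, of m0] unfolding m0_def by linarith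
    have *: "w = pos v i" if "w < k" "int k dvd int w - int c + a" "int k dvd int (pos v m0) - int c + a'" "a' - a = 2 * (i - m0)" for w i a a'
    proof (rule pos_eqI[OF that(1)])
      have "int k dvd (int w - int c + a) - (int (pos v m0) - int c + a') + (int (pos v m0) - (int (f v) + 2 * m0))"
        by (intro dvd_add dvd_diff that same)
      also have "\<dots> = int w - (int (f v) + 2 * i)" using that(4) by simp
      finally show "int k dvd int w - (int (f v) + 2 * i)" .
    qed
    \<comment> \<open>The position of \<open>m0\<close> is c - 1 or c + 1. The other candidate is
      accordingly one step up or one step down, which decides between \<open>m0\<close> and
      \<open>m0 - 1\<close> as the lower end.\<close>
    show "\<exists>m. (\<forall>w<k. y v w \<noteq> 0 \<longrightarrow> w = pos v m \<or> w = pos v (m + 1)) \<and> of_int m \<le> b v \<and> b v \<le> of_int m + 1"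
      using near[OF pos_less m0]
    proof
      assume c1: "int k dvd int (pos v m0) - int c + 1"
      have "w = pos v m0 \<or> w = pos v (m0 + 1)" if "w < k" "y v w \<noteq> 0" for w
        using near[OF that] *[where a = 1 and i = m0, OF that(1) _ c1] *[where a = "-1" and i = "m0 + 1", OF that(1) _ c1] by auto
      moreover have "of_int m0 \<le> b v" "b v \<le> of_int m0 + 1" unfolding m0_def by linarith+
      ultimately show ?thesis by blast
    next
      assume "int k dvd int (pos v m0) - int c - 1"
      then have c1: "int k dvd int (pos v m0) - int c + - 1" by simp
      have lower: "w = pos v (m0 - 1) \<or> w = pos v m0" if "w < k" "y v w \<noteq> 0" for w
        using near[OF that] *[where a = 1 and i = "m0 - 1", OF that(1) _ c1] *[where a = "-1" and i = m0, OF that(1) _ c1] by auto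
      have "b v = of_int m0"
      \<comment> \<open>A non-integral \<open>b v\<close> would also put weight on the position of
        \<open>m0 + 1\<close>, which is neither of the two allowed ones.\<close>
      proof (rule ccontr)
        assume "b v \<noteq> of_int m0"
        then have "\<lceil>b v\<rceil> = m0 + 1" unfolding m0_def by linarith
        then have "y v (pos v (m0 + 1)) \<noteq> 0" using supp_b[OF v, of "m0 + 1"] by (simp add: m0_def)
        then show False using lower[OF pos_less] pos_neq[of v m0] by metis
      qed
      then show ?thesis using lower by (intro exI[of _ "m0 - 1"]) simp
    qed
  qed
  from bchoice[OF this] obtain m where m: "\<forall>v\<in>pverts G. (\<forall>w<k. y v w \<noteq> 0 \<longrightarrow> w = pos v (m v) \<or> w = pos v (m v + 1)) \<and>
      of_int (m v) \<le> b v \<and> b v \<le> of_int (m v) + 1"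
    by (rule exE)
  define b' where "b' v = (if v \<in> pverts G then of_int (m v) + y v (pos v (m v + 1)) else 0)" for v
  have weights: "y v (pos v (m v)) + y v (pos v (m v + 1)) = 1" and real: "realize b' v = y v"
    if v: "v \<in> pverts G" for v
    using two_point_weights(1)[OF y v, where m = "m v"]
      two_point_weights(2)[OF y v, where m = "m v" and b = b'] m v by (simp_all add: b'_def)
  have nonneg: "0 \<le> y v (pos v i)" if "v \<in> pverts G" for v i
    using hom_pointsD(2)[OF y that] pos_less by (simp add: pverts_cycle)
  have realize_b': "realize b' = y" using y real by (rule realize_eqI)
  \<comment> \<open>Unless \<open>b v\<close> is the upper end \<open>m v + 1\<close>, the position
    of \<open>m v\<close> carries weight already in \<open>realize b\<close>, hence in
    \<open>y\<close>, and this keeps \<open>b' v\<close> below \<open>m v + 1\<close>. The lower end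
    is dual.\<close>
  have cell: "of_int \<lfloor>b' v\<rfloor> \<le> b v \<and> b v \<le> of_int \<lceil>b' v\<rceil>" for v
  proof (cases "v \<in> pverts G")
    case v: True
    have rng: "of_int (m v) \<le> b v" "b v \<le> of_int (m v) + 1" using m v by auto
    have b'v: "b' v = of_int (m v) + y v (pos v (m v + 1))" using v by (simp add: b'_def)
    show ?thesis
    proof (intro conjI)
      show "of_int \<lfloor>b' v\<rfloor> \<le> b v"
      proof (cases "b v = of_int (m v) + 1")
        case True
        then show ?thesis
          using b'v weights[OF v] nonneg[OF v, of "m v"] by linarith
      next
        case False
        then have "\<lfloor>b v\<rfloor> = m v" using rng by (intro floor_unique) auto
        moreover have "m v \<le> \<lceil>b v\<rceil>" using rng by linarith
        ultimately have "y v (pos v (m v)) \<noteq> 0" using supp_b[OF v, of "m v"] by simp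
        then have "b' v < of_int (m v) + 1" using b'v weights[OF v] nonneg[OF v, of "m v"] by linarith
        then have "\<lfloor>b' v\<rfloor> \<le> m v" by linarith
        then show ?thesis using rng by linarith
      qed
      show "b v \<le> of_int \<lceil>b' v\<rceil>"
      proof (cases "b v = of_int (m v)")
        case True
        then show ?thesis using b'v nonneg[OF v, of "m v + 1"] by linarith
      next
        case False
        then have "\<lceil>b v\<rceil> = m v + 1" using rng by (intro ceiling_unique) auto
        moreover have "\<lfloor>b v\<rfloor> \<le> m v + 1" using rng by linarith
        ultimately have "y v (pos v (m v + 1)) \<noteq> 0" using supp_b[OF v, of "m v + 1"] by simp
        then have "of_int (m v) < b' v" using b'v nonneg[OF v, of "m v + 1"] by linarith
        then have "m v + 1 \<le> \<lceil>b' v\<rceil>" by linarith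
        then show ?thesis using rng by linarith
      qed
    qed
  next
    case False
    then show ?thesis using heights_outside[OF heights0_heights[OF b] False] by (simp add: b'_def)
  qed
  have "b' \<in> heights"
  proof (rule heightsI)
    fix v u assume vu: "(v, u) \<in> up_arcs"
    have V: "v \<in> pverts G" "u \<in> pverts G" using D_V[OF vu] .
    have dvd: "period dvd j - i \<or> period dvd j - i + 1"
      if "\<lfloor>b' v\<rfloor> \<le> i" "i \<le> \<lceil>b' v\<rceil>" "\<lfloor>b' u\<rfloor> \<le> j" "j \<le> \<lceil>b' u\<rceil>" for i j
    proof -
      have "y v (pos v i) \<noteq> 0" "y u (pos u j) \<noteq> 0"
        using realize_nonzero_iff[OF V(1) pos_less, of b'] realize_nonzero_iff[OF V(2) pos_less, of b'] that
        unfolding realize_b' by blast+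
      then have "(pos v i, pos u j) \<in> parcs (cycle_graph k)"
        using hom_points_adj[OF y up_arcs_parcs[OF vu]] pos_less by (simp add: pverts_cycle)
      then show ?thesis using pos_adj_iff[OF vu] by blast
    qed
    have start: "\<lfloor>b u\<rfloor> - \<lfloor>b v\<rfloor> = 0 \<or> \<lfloor>b u\<rfloor> - \<lfloor>b v\<rfloor> = -1"
      using heights_arc[OF heights0_heights[OF b] vu] unfolding arc_ok_def by linarith
    have rng: "\<lfloor>b' v\<rfloor> \<le> \<lfloor>b v\<rfloor>" "\<lfloor>b v\<rfloor> \<le> \<lceil>b' v\<rceil>" "\<lfloor>b' u\<rfloor> \<le> \<lfloor>b u\<rfloor>" "\<lfloor>b u\<rfloor> \<le> \<lceil>b' u\<rceil>"
      using cell[of v] cell[of u] by (simp_all add: le_floor_iff) linarith+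
    \<comment> \<open>Adjacency in \<open>y\<close> gives this only modulo the period. Starting from
      the floors of \<open>b\<close>, where it holds exactly, first \<open>i\<close> and then
      \<open>j\<close> is changed by at most 1, so the difference never leaves the window of
      \<open>period_dvd_small\<close>.\<close>
    have near: "j - i = 0 \<or> j - i = -1"
      if ij: "\<lfloor>b' v\<rfloor> \<le> i" "i \<le> \<lceil>b' v\<rceil>" "\<lfloor>b' u\<rfloor> \<le> j" "j \<le> \<lceil>b' u\<rceil>" for i j
    proof -
      have w: "\<lceil>b' v\<rceil> \<le> \<lfloor>b' v\<rfloor> + 1" "\<lceil>b' u\<rceil> \<le> \<lfloor>b' u\<rfloor> + 1" by linarith+
      have "\<lfloor>b u\<rfloor> - i = 0 \<or> \<lfloor>b u\<rfloor> - i = -1"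
        by (rule period_dvd_small[OF dvd[OF ij(1,2) rng(3,4)]]) (use start rng ij w in linarith)+
      then show ?thesis
        using period_dvd_small[OF dvd[OF ij]] rng ij w by linarith
    qed
    have "\<lfloor>b' v\<rfloor> \<le> \<lceil>b' v\<rceil>" "\<lfloor>b' u\<rfloor> \<le> \<lceil>b' u\<rceil>" by linarith+
    then show "arc_ok (b' v) (b' u)"
      using near[of "\<lfloor>b' v\<rfloor>" "\<lceil>b' u\<rceil>"] near[of "\<lceil>b' v\<rceil>" "\<lfloor>b' u\<rfloor>"] unfolding arc_ok_def by auto
  qed (simp add: b'_def)
  then have "b' \<in> heights0" using heights0_unrefine[OF b] cell by blast
  then show ?thesis using realize_b' by blast
qed

section \<open>Connected components of the complex\<close>

definition piece :: "('a \<Rightarrow> nat \<Rightarrow> real) set" where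
  "piece = realize ` heights0"

lemma piece_sub: "piece \<subseteq> hom_points G (cycle_graph k)"
  using realize_hom_points heights0_heights by (auto simp: piece_def)

lemma openin_piece: "openin (Hom_complex G (cycle_graph k)) piece"
  using lift_coface by (intro openin_if_star_closed piece_sub) (auto simp: piece_def)

text \<open>By \<open>lift_face\<close> a point outside the piece has no point of the piece in its
  open star, so the complement is open by the same criterion as the piece itself.\<close>

lemma closedin_piece: "closedin (Hom_complex G (cycle_graph k)) piece"
proof -
  have "openin (Hom_complex G (cycle_graph k)) (hom_points G (cycle_graph k) - piece)"
    using lift_face by (intro openin_if_star_closed) (auto simp: piece_def)
  then show ?thesis using piece_sub by (simp add: closedin_def topspace_Hom_complex)
qed

lemma connectedin_piece: "connectedin (Hom_complex G (cycle_graph k)) piece"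
proof -
  have "path_connected heights0"
    unfolding heights0_def by (rule path_connected_path_component)
  then have "connectedin (top_of_set heights0) heights0"
    by (simp add: connectedin_subtopology connectedin_iff_connected path_connected_imp_connected)
  then show ?thesis
    unfolding piece_def by (rule connectedin_continuous_map_image[OF continuous_map_realize])
qed

lemma piece_homotopy_equivalent:
  "subtopology (Hom_complex G (cycle_graph k)) piece homotopy_equivalent_space circle_power (card free_reps)"
proof (rule homotopy_equivalent_circle_power[where q = realize])
  show "Hausdorff_space (subtopology (Hom_complex G (cycle_graph k)) piece)"
    by (intro Hausdorff_space_subtopology Hausdorff_Hom_complex)
  show "continuous_map (top_of_set heights0) (subtopology (Hom_complex G (cycle_graph k)) piece) realize"
    using continuous_map_realize by (auto simp: continuous_map_in_subtopology piece_def)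
  show "realize ` heights0 = topspace (subtopology (Hom_complex G (cycle_graph k)) piece)"
    using piece_sub by (auto simp: topspace_Hom_complex piece_def)
qed (rule realize_eq_iff)

text \<open>The height function 0 realizes the vertex \<open>f\<close> of the complex, and the
  hypothesis says that \<open>f\<close> is a vertex of the smallest cell containing
  \<open>x\<close>.\<close>

lemma mem_piece:
  assumes x: "x \<in> hom_points G (cycle_graph k)" and f: "\<And>v. v \<in> pverts G \<Longrightarrow> x v (f v) \<noteq> 0"
  shows "x \<in> piece"
  unfolding piece_def
proof (rule lift_coface[OF zero_heights0 x])
  show "refines (realize (\<lambda>_. 0)) x"
    using f pos_zero by (auto simp: refines_def pverts_cycle realize_nonzero_iff)
qed

end

text \<open>Picking one value from each support of a point yields a homomorphism whose piece
  contains the point. Many homomorphisms share a piece, so the partition is indexed by the set of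
  pieces and not by \<open>F\<close>.\<close>

lemma Hom_cycle_not_4:
  assumes fin: "finite (pverts G)" and arcs: "parcs G \<subseteq> pverts G \<times> pverts G" and sym: "sym (parcs G)"
    and nonisolated: "\<And>v. v \<in> pverts G \<Longrightarrow> \<exists>u. (v, u) \<in> parcs G"
    and k: "k \<ge> 3" "k \<noteq> 4"
  shows "\<exists>(I :: nat set) d. Hom_complex G (cycle_graph k) homotopy_equivalent_space sum_topology (\<lambda>i. circle_power (d i)) I"
proof -
  define F where "F = {f \<in> pverts G \<rightarrow>\<^sub>E {..<k}. \<forall>(u, v)\<in>parcs G. (f u, f v) \<in> parcs (cycle_graph k)}"
  have hom: "cycle_hom G k f" if "f \<in> F" for f
    using that assms by unfold_locales (auto simp: F_def PiE_iff)
  interpret hom_complex G "cycle_graph k"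
    by unfold_locales (use fin arcs in \<open>auto simp: cycle_graph_def\<close>)
  let ?X = "Hom_complex G (cycle_graph k)"
  show ?thesis
  proof (rule finite_partition_circle_powers[of "cycle_hom.piece G k ` F"])
    have "finite (pverts G \<rightarrow>\<^sub>E {..<k})" using fin by (intro finite_PiE) auto
    then show "finite (cycle_hom.piece G k ` F)" by (simp add: F_def)
    show "topspace ?X = \<Union> (cycle_hom.piece G k ` F)"
      unfolding topspace_Hom_complex
    proof
      show "hom_points G (cycle_graph k) \<subseteq> \<Union> (cycle_hom.piece G k ` F)"
      proof
        fix x assume x: "x \<in> hom_points G (cycle_graph k)"
        have "\<forall>v\<in>pverts G. \<exists>w. w < k \<and> x v w \<noteq> 0"
          using hom_pointsD(4)[OF x] by (auto simp: cycle_graph_def)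
        from bchoice[OF this] obtain g where g: "\<forall>v\<in>pverts G. g v < k \<and> x v (g v) \<noteq> 0" by (rule exE)
        define f where "f = restrict g (pverts G)"
        have "(f u, f v) \<in> parcs (cycle_graph k)" if uv: "(u, v) \<in> parcs G" for u v
        proof -
          have V: "u \<in> pverts G" "v \<in> pverts G" using arcs uv by auto
          then show ?thesis
            using hom_points_adj[OF x uv, of "g u" "g v"] g by (simp add: f_def cycle_graph_def)
        qed
        moreover have "f \<in> pverts G \<rightarrow>\<^sub>E {..<k}" using g by (auto simp: f_def)
        ultimately have f: "f \<in> F" unfolding F_def by blast
        then have "x \<in> cycle_hom.piece G k f"
          using g by (intro cycle_hom.mem_piece[OF hom x]) (simp_all add: f_def)
        with f show "x \<in> \<Union> (cycle_hom.piece G k ` F)" by blast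
      qed
      show "\<Union> (cycle_hom.piece G k ` F) \<subseteq> hom_points G (cycle_graph k)"
        using cycle_hom.piece_sub[OF hom] by blast
    qed
    show "openin ?X C" if "C \<in> cycle_hom.piece G k ` F" for C
      using that cycle_hom.openin_piece[OF hom] by blast
    \<comment> \<open>A connected set that meets a clopen set lies inside it; by symmetry, pieces
      that meet coincide.\<close>
    have sub: "cycle_hom.piece G k f' \<subseteq> cycle_hom.piece G k f"
      if "f \<in> F" "f' \<in> F" "cycle_hom.piece G k f \<inter> cycle_hom.piece G k f' \<noteq> {}" for f f'
      using connectedin_clopen_cases[OF cycle_hom.connectedin_piece[OF hom[OF that(2)]]
          cycle_hom.closedin_piece[OF hom[OF that(1)]] cycle_hom.openin_piece[OF hom[OF that(1)]]] that(3)
      by (auto simp: disjnt_def)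
    show "C = C'" if C: "C \<in> cycle_hom.piece G k ` F" "C' \<in> cycle_hom.piece G k ` F" "C \<inter> C' \<noteq> {}" for C C'
    proof -
      obtain f f' where "C = cycle_hom.piece G k f" "C' = cycle_hom.piece G k f'" "f \<in> F" "f' \<in> F"
        using C(1,2) by blast
      then show ?thesis using sub[of f f'] sub[of f' f] C(3) by (simp add: Int_commute subset_antisym)
    qed
    show "\<exists>d. subtopology ?X C homotopy_equivalent_space circle_power d" if "C \<in> cycle_hom.piece G k ` F" for C
      using that cycle_hom.piece_homotopy_equivalent[OF hom] by blast
  qed
qed

theorem Hom_cycle:
  fixes G :: "'a pair_pre_digraph"
  assumes fin: "finite (pverts G)" and arcs: "parcs G \<subseteq> pverts G \<times> pverts G" and sym: "sym (parcs G)" and k: "k \<ge> 3"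
  shows "\<exists>(I :: nat set) (d :: nat \<Rightarrow> nat).
           Hom_complex G (cycle_graph k)
             homotopy_equivalent_space sum_topology (\<lambda>i. circle_power (d i)) I"
proof -
  define G' where "G' = \<lparr>pverts = Domain (parcs G), parcs = parcs G\<rparr>"
  have "Hom_complex G (cycle_graph k) homotopy_equivalent_space Hom_complex G' (cycle_graph k)"
    unfolding G'_def using k
    by (intro remove_isolated[OF fin _ arcs sym, of _ 0]) (simp_all add: cycle_graph_def)
  moreover have "finite (pverts G')"
    using fin arcs by (auto simp: G'_def intro: finite_subset)
  moreover have "parcs G' \<subseteq> pverts G' \<times> pverts G'" "sym (parcs G')"
    using sym by (auto simp: G'_def dest: symD)
  moreover have "\<exists>u. (v, u) \<in> parcs G'" if "v \<in> pverts G'" for v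
    using that by (auto simp: G'_def)
  ultimately show ?thesis
    using Hom_cycle_4[of G'] Hom_cycle_not_4[of G' k] k homotopy_eqv_trans by (cases "k = 4") blast+
qed

theorem corollary1p2:
  fixes G :: "'a pair_pre_digraph" and k :: nat
  assumes "pair_graph G" and "k \<ge> 3"
  shows "\<exists>(I :: nat set) (d :: nat \<Rightarrow> nat).
           Hom_complex G (cycle_graph k)
             homotopy_equivalent_space sum_topology (\<lambda>i. circle_power (d i)) I"
proof -
  interpret pair_graph G by fact
  show ?thesis
  proof (rule Hom_cycle[OF finite_verts _ _ \<open>k \<ge> 3\<close>])
    show "parcs G \<subseteq> pverts G \<times> pverts G"
      using arc_fst_in_verts arc_snd_in_verts by fastforce
    show "sym (parcs G)"
      using sym_arcs by (simp add: symmetric_def)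
  qed
qed

end
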